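(* Let $\mathcal{C}$ be a braided Tambara-Yamagami fusion category over $k$, regarded as a premodular category with respect to a fixed ribbon structure, and let $\tilde{\mathcal{C}}$ be the modularization of $\mathcal{C}$. Then: (i) $\mathcal{C}$ is integral if and only if $\tilde{\mathcal{C}}$ is pointed. (ii) Suppose that $\mathcal{C}$ is not integral. Then $\tilde{\mathcal{C}} \simeq \mathcal{I}$ as braided tensor categories, where $\mathcal{I}$ is an Ising category.
   Context: $k$ is an algebraically closed field of characteristic zero. A fusion category over $k$ is a $k$-linear semisimple rigid tensor category with finitely many isomorphism classes of simple objects, finite-dimensional Hom spaces and simple unit object $\mathbf{1}$. It is pointed if all simple objects are invertible, and integral if the Frobenius-Perron dimension of every simple object is an integer. A Tambara-Yamagami fusion category is a fusion category having, up to isomorphism, exactly one non-invertible simple object $X$, and such that $X \otimes X \simeq \oplus_{g\in G} g$, where $G$ is the (finite, necessarily abelian) group of isomorphism classes of invertible objects. If it admits a braiding, then $G$ is an elementary abelian $2$-group and each braiding has two compatible ribbon structures. A premodular category is a braided fusion category with a ribbon structure; it is modular if its $S$-matrix is invertible. The modularization of a premodular category $\mathcal{C}$ is a modular category $\tilde{\mathcal{C}}$ together with a dominant braided (ribbon) tensor functor $F:\mathcal{C}\to\tilde{\mathcal{C}}$ (dominant: every object of $\tilde{\mathcal{C}}$ is a subobject of some $F(Z)$, with $Z$ an object of $\mathcal{C}$). An Ising category is a fusion category whose simple objects are, up to isomorphism, $\mathbf{1}$, an invertible object $a \not\simeq \mathbf{1}$ and one non-invertible object $X$, with $a\otimes a\simeq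 \mathbf{1}$ and $X \otimes X \simeq \mathbf{1} \oplus a$. *)

theory Defs
  imports "Jordan_Normal_Form.Char_Poly" "Jordan_Normal_Form.VS_Connect"
begin

section \<open>Categories\<close>

text \<open>Hom sets are pairwise disjoint: every arrow carries its domain and its codomain.
  Record fields are only constrained on the carriers \<open>Obj\<close> and \<open>Arr\<close>.\<close>

record ('o, 'm) cat =
  Obj :: "'o set"
  Arr :: "'m set"
  Dom :: "'m \<Rightarrow> 'o"
  Cod :: "'m \<Rightarrow> 'o"
  Ident :: "'o \<Rightarrow> 'm"
  Comp :: "'m \<Rightarrow> 'm \<Rightarrow> 'm" (infixl "\<cdot>\<index>" 70)

definition Hom :: "('o, 'm, 'x) cat_scheme \<Rightarrow> 'o \<Rightarrow> 'o \<Rightarrow> 'm set" where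
  "Hom C x y = {f \<in> Arr C. Dom C f = x \<and> Cod C f = y}"

locale category =
  fixes C :: "('o, 'm, 'x) cat_scheme" (structure)
  assumes dom_obj: "f \<in> Arr C \<Longrightarrow> Dom C f \<in> Obj C"
    and cod_obj: "f \<in> Arr C \<Longrightarrow> Cod C f \<in> Obj C"
    and ident_hom: "x \<in> Obj C \<Longrightarrow> Ident C x \<in> Hom C x x"
    and comp_hom: "\<lbrakk>f \<in> Hom C x y; g \<in> Hom C y z\<rbrakk> \<Longrightarrow> g \<cdot> f \<in> Hom C x z"
    and comp_assoc: "\<lbrakk>f \<in> Hom C w x; g \<in> Hom C x y; h \<in> Hom C y z\<rbrakk> \<Longrightarrow> (h \<cdot> g) \<cdot> f = h \<cdot> (g \<cdot> f)"
    and comp_ident_right: "f \<in> Hom C x y \<Longrightarrow> f \<cdot> Ident C x = f"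
    and comp_ident_left: "f \<in> Hom C x y \<Longrightarrow> Ident C y \<cdot> f = f"

context
  fixes C :: "('o, 'm, 'x) cat_scheme" (structure)
begin

definition inverse_arrows :: "'m \<Rightarrow> 'm \<Rightarrow> bool" where
  "inverse_arrows f g \<longleftrightarrow> f \<in> Arr C \<and> g \<in> Hom C (Cod C f) (Dom C f) \<and>
     g \<cdot> f = Ident C (Dom C f) \<and> f \<cdot> g = Ident C (Cod C f)"

definition is_iso :: "'m \<Rightarrow> bool" where
  "is_iso f \<longleftrightarrow> (\<exists>g. inverse_arrows f g)"

definition inv_arr :: "'m \<Rightarrow> 'm" where
  "inv_arr f = (THE g. inverse_arrows f g)"

definition isomorphic :: "'o \<Rightarrow> 'o \<Rightarrow> bool" where
  "isomorphic x y \<longleftrightarrow> (\<exists>f \<in> Hom C x y. is_iso f)"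

definition is_mono :: "'m \<Rightarrow> bool" where
  "is_mono f \<longleftrightarrow> f \<in> Arr C \<and>
     (\<forall>w. \<forall>g \<in> Hom C w (Dom C f). \<forall>h \<in> Hom C w (Dom C f). f \<cdot> g = f \<cdot> h \<longrightarrow> g = h)"

definition is_epi :: "'m \<Rightarrow> bool" where
  "is_epi f \<longleftrightarrow> f \<in> Arr C \<and>
     (\<forall>w. \<forall>g \<in> Hom C (Cod C f) w. \<forall>h \<in> Hom C (Cod C f) w. g \<cdot> f = h \<cdot> f \<longrightarrow> g = h)"

text \<open>\<open>xs\<close> lists, without repetition, one representative of each isomorphism class of objects
  satisfying \<open>P\<close>; in particular there are only finitely many such classes.\<close>

definition iso_reps :: "('o \<Rightarrow> bool) \<Rightarrow> 'o list \<Rightarrow> bool" where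
  "iso_reps P xs \<longleftrightarrow> (\<forall>x \<in> set xs. x \<in> Obj C \<and> P x) \<and>
     (\<forall>i < length xs. \<forall>j < length xs. isomorphic (xs ! i) (xs ! j) \<longrightarrow> i = j) \<and>
     (\<forall>y \<in> Obj C. P y \<longrightarrow> (\<exists>x \<in> set xs. isomorphic y x))"

end


section \<open>Linear and abelian categories\<close>

record ('o, 'm, 'k) linear_cat = "('o, 'm) cat" +
  Zero :: "'o \<Rightarrow> 'o \<Rightarrow> 'm"
  Add :: "'m \<Rightarrow> 'm \<Rightarrow> 'm"
  Scale :: "'k \<Rightarrow> 'm \<Rightarrow> 'm"

definition hom_space ::
  "('o, 'm, 'k, 'x) linear_cat_scheme \<Rightarrow> 'o \<Rightarrow> 'o \<Rightarrow> ('k, 'm) module" where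
  "hom_space C x y = \<lparr>carrier = Hom C x y, mult = undefined, one = undefined,
     zero = Zero C x y, add = Add C, smult = Scale C\<rparr>"

abbreviation hom_dim :: "('o, 'm, 'k::field, 'x) linear_cat_scheme \<Rightarrow> 'o \<Rightarrow> 'o \<Rightarrow> nat" where
  "hom_dim C x y \<equiv> vectorspace.dim class_ring (hom_space C x y)"

locale linear_category = category C
  for C :: "('o, 'm, 'k::field, 'x) linear_cat_scheme" (structure) +
  assumes hom_vectorspace:
      "\<lbrakk>x \<in> Obj C; y \<in> Obj C\<rbrakk> \<Longrightarrow> vectorspace class_ring (hom_space C x y)"
    and comp_add_right: "\<lbrakk>f \<in> Hom C x y; f' \<in> Hom C x y; g \<in> Hom C y z\<rbrakk> \<Longrightarrow>
      g \<cdot> Add C f f' = Add C (g \<cdot> f) (g \<cdot> f')"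
    and comp_add_left: "\<lbrakk>f \<in> Hom C x y; g \<in> Hom C y z; g' \<in> Hom C y z\<rbrakk> \<Longrightarrow>
      Add C g g' \<cdot> f = Add C (g \<cdot> f) (g' \<cdot> f)"
    and comp_scale_right: "\<lbrakk>f \<in> Hom C x y; g \<in> Hom C y z\<rbrakk> \<Longrightarrow>
      g \<cdot> Scale C a f = Scale C a (g \<cdot> f)"
    and comp_scale_left: "\<lbrakk>f \<in> Hom C x y; g \<in> Hom C y z\<rbrakk> \<Longrightarrow>
      Scale C a g \<cdot> f = Scale C a (g \<cdot> f)"

context
  fixes C :: "('o, 'm, 'k, 'x) linear_cat_scheme" (structure)
begin

definition zero_object :: "'o \<Rightarrow> bool" where
  "zero_object x \<longleftrightarrow> x \<in> Obj C \<and> Ident C x = Zero C x x"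

text \<open>\<open>z\<close> is a biproduct of the objects in the list \<open>xs\<close>; for the empty list, a zero object.\<close>

definition direct_sum :: "'o list \<Rightarrow> 'o \<Rightarrow> bool" where
  "direct_sum xs z \<longleftrightarrow> set xs \<subseteq> Obj C \<and> z \<in> Obj C \<and>
     (\<exists>\<iota> \<pi>. (\<forall>i < length xs. \<iota> i \<in> Hom C (xs ! i) z \<and> \<pi> i \<in> Hom C z (xs ! i)) \<and>
        (\<forall>i < length xs. \<forall>j < length xs.
           \<pi> j \<cdot> \<iota> i = (if i = j then Ident C (xs ! i) else Zero C (xs ! i) (xs ! j))) \<and>
        finsum (hom_space C z z) (\<lambda>i. \<iota> i \<cdot> \<pi> i) {..<length xs} = Ident C z)"

definition is_kernel :: "'m \<Rightarrow> 'm \<Rightarrow> bool" where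
  "is_kernel f i \<longleftrightarrow> f \<in> Arr C \<and> i \<in> Arr C \<and> Cod C i = Dom C f \<and>
     f \<cdot> i = Zero C (Dom C i) (Cod C f) \<and>
     (\<forall>w. \<forall>g \<in> Hom C w (Dom C f). f \<cdot> g = Zero C w (Cod C f) \<longrightarrow>
        (\<exists>!h. h \<in> Hom C w (Dom C i) \<and> i \<cdot> h = g))"

definition is_cokernel :: "'m \<Rightarrow> 'm \<Rightarrow> bool" where
  "is_cokernel f p \<longleftrightarrow> f \<in> Arr C \<and> p \<in> Arr C \<and> Dom C p = Cod C f \<and>
     p \<cdot> f = Zero C (Dom C f) (Cod C p) \<and>
     (\<forall>w. \<forall>g \<in> Hom C (Cod C f) w. g \<cdot> f = Zero C (Dom C f) w \<longrightarrow>
        (\<exists>!h. h \<in> Hom C (Cod C p) w \<and> h \<cdot> p = g))"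

definition simple_object :: "'o \<Rightarrow> bool" where
  "simple_object x \<longleftrightarrow> x \<in> Obj C \<and> \<not> zero_object x \<and>
     (\<forall>f. is_mono C f \<and> Cod C f = x \<longrightarrow> zero_object (Dom C f) \<or> is_iso C f)"

definition simple_reps :: "'o list" where
  "simple_reps = (SOME xs. iso_reps C simple_object xs)"

end

locale abelian_category = linear_category C
  for C :: "('o, 'm, 'k::field, 'x) linear_cat_scheme" (structure) +
  assumes direct_sums: "set xs \<subseteq> Obj C \<Longrightarrow> \<exists>z. direct_sum C xs z"
    and kernels: "f \<in> Arr C \<Longrightarrow> \<exists>i. is_kernel C f i"
    and cokernels: "f \<in> Arr C \<Longrightarrow> \<exists>p. is_cokernel C f p"
    and mono_normal: "is_mono C f \<Longrightarrow> \<exists>g. is_kernel C g f"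
    and epi_normal: "is_epi C f \<Longrightarrow> \<exists>g. is_cokernel C g f"

locale semisimple_category = abelian_category C
  for C :: "('o, 'm, 'k::field, 'x) linear_cat_scheme" (structure) +
  assumes semisimple: "x \<in> Obj C \<Longrightarrow> \<exists>xs. (\<forall>y \<in> set xs. simple_object C y) \<and> direct_sum C xs x"


section \<open>Fusion categories\<close>

record ('o, 'm, 'k) monoidal_cat = "('o, 'm, 'k) linear_cat" +
  TensO :: "'o \<Rightarrow> 'o \<Rightarrow> 'o" (infixl "\<boxtimes>\<index>" 75)
  TensA :: "'m \<Rightarrow> 'm \<Rightarrow> 'm" (infixl "\<star>\<index>" 75)
  TUnit :: 'o
  Assoc :: "'o \<Rightarrow> 'o \<Rightarrow> 'o \<Rightarrow> 'm"
  LUnit :: "'o \<Rightarrow> 'm"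
  RUnit :: "'o \<Rightarrow> 'm"

locale monoidal_category = category C
  for C :: "('o, 'm, 'k, 'x) monoidal_cat_scheme" (structure) +
  assumes unit_obj: "TUnit C \<in> Obj C"
    and tens_obj: "\<lbrakk>x \<in> Obj C; y \<in> Obj C\<rbrakk> \<Longrightarrow> x \<boxtimes> y \<in> Obj C"
    and tens_hom: "\<lbrakk>f \<in> Hom C x x'; g \<in> Hom C y y'\<rbrakk> \<Longrightarrow> f \<star> g \<in> Hom C (x \<boxtimes> y) (x' \<boxtimes> y')"
    and tens_ident: "\<lbrakk>x \<in> Obj C; y \<in> Obj C\<rbrakk> \<Longrightarrow> Ident C x \<star> Ident C y = Ident C (x \<boxtimes> y)"
    and tens_comp:
      "\<lbrakk>f \<in> Hom C x x'; f' \<in> Hom C x' x''; g \<in> Hom C y y'; g' \<in> Hom C y' y''\<rbrakk> \<Longrightarrow>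
        (f' \<cdot> f) \<star> (g' \<cdot> g) = (f' \<star> g') \<cdot> (f \<star> g)"
    and assoc_hom: "\<lbrakk>x \<in> Obj C; y \<in> Obj C; z \<in> Obj C\<rbrakk> \<Longrightarrow>
        Assoc C x y z \<in> Hom C ((x \<boxtimes> y) \<boxtimes> z) (x \<boxtimes> (y \<boxtimes> z))"
    and assoc_iso: "\<lbrakk>x \<in> Obj C; y \<in> Obj C; z \<in> Obj C\<rbrakk> \<Longrightarrow> is_iso C (Assoc C x y z)"
    and assoc_natural: "\<lbrakk>f \<in> Hom C x x'; g \<in> Hom C y y'; h \<in> Hom C z z'\<rbrakk> \<Longrightarrow>
        Assoc C x' y' z' \<cdot> ((f \<star> g) \<star> h) = (f \<star> (g \<star> h)) \<cdot> Assoc C x y z"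
    and lunit_hom: "x \<in> Obj C \<Longrightarrow> LUnit C x \<in> Hom C (TUnit C \<boxtimes> x) x"
    and lunit_iso: "x \<in> Obj C \<Longrightarrow> is_iso C (LUnit C x)"
    and lunit_natural: "f \<in> Hom C x y \<Longrightarrow>
        LUnit C y \<cdot> (Ident C (TUnit C) \<star> f) = f \<cdot> LUnit C x"
    and runit_hom: "x \<in> Obj C \<Longrightarrow> RUnit C x \<in> Hom C (x \<boxtimes> TUnit C) x"
    and runit_iso: "x \<in> Obj C \<Longrightarrow> is_iso C (RUnit C x)"
    and runit_natural: "f \<in> Hom C x y \<Longrightarrow>
        RUnit C y \<cdot> (f \<star> Ident C (TUnit C)) = f \<cdot> RUnit C x"
    and pentagon: "\<lbrakk>w \<in> Obj C; x \<in> Obj C; y \<in> Obj C; z \<in> Obj C\<rbrakk> \<Longrightarrow>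
        Assoc C w x (y \<boxtimes> z) \<cdot> Assoc C (w \<boxtimes> x) y z =
        (Ident C w \<star> Assoc C x y z) \<cdot> Assoc C w (x \<boxtimes> y) z \<cdot> (Assoc C w x y \<star> Ident C z)"
    and triangle: "\<lbrakk>x \<in> Obj C; y \<in> Obj C\<rbrakk> \<Longrightarrow>
        (Ident C x \<star> LUnit C y) \<cdot> Assoc C x (TUnit C) y = RUnit C x \<star> Ident C y"

context
  fixes C :: "('o, 'm, 'k, 'x) monoidal_cat_scheme" (structure)
begin

text \<open>\<open>y\<close> is a left dual of \<open>x\<close> (equivalently, \<open>x\<close> is a right dual of \<open>y\<close>), with evaluation
  \<open>ev : y \<boxtimes> x \<rightarrow> 1\<close> and coevaluation \<open>coev : 1 \<rightarrow> x \<boxtimes> y\<close>.\<close>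

definition is_dual :: "'o \<Rightarrow> 'o \<Rightarrow> 'm \<Rightarrow> 'm \<Rightarrow> bool" where
  "is_dual x y ev coev \<longleftrightarrow> x \<in> Obj C \<and> y \<in> Obj C \<and>
     ev \<in> Hom C (y \<boxtimes> x) (TUnit C) \<and> coev \<in> Hom C (TUnit C) (x \<boxtimes> y) \<and>
     RUnit C x \<cdot> (Ident C x \<star> ev) \<cdot> Assoc C x y x \<cdot> (coev \<star> Ident C x) = LUnit C x \<and>
     LUnit C y \<cdot> (ev \<star> Ident C y) \<cdot> inv_arr C (Assoc C y x y) \<cdot> (Ident C y \<star> coev) = RUnit C y"

definition transpose_arr :: "'o \<Rightarrow> 'o \<Rightarrow> 'm \<Rightarrow> 'm \<Rightarrow> 'm \<Rightarrow> 'm" where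
  "transpose_arr x y ev coev f =
     LUnit C y \<cdot> (ev \<star> Ident C y) \<cdot> ((Ident C y \<star> f) \<star> Ident C y) \<cdot>
     inv_arr C (Assoc C y x y) \<cdot> (Ident C y \<star> coev) \<cdot> inv_arr C (RUnit C y)"

definition invertible_object :: "'o \<Rightarrow> bool" where
  "invertible_object x \<longleftrightarrow> x \<in> Obj C \<and>
     (\<exists>y \<in> Obj C. isomorphic C (x \<boxtimes> y) (TUnit C) \<and> isomorphic C (y \<boxtimes> x) (TUnit C))"

end

locale fusion_category = monoidal_category C + semisimple_category C
  for C :: "('o, 'm, 'k::{alg_closed_field, field_char_0}, 'x) monoidal_cat_scheme" (structure) +
  assumes tens_add_left: "\<lbrakk>f \<in> Hom C x x'; f' \<in> Hom C x x'; g \<in> Hom C y y'\<rbrakk> \<Longrightarrow>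
      Add C f f' \<star> g = Add C (f \<star> g) (f' \<star> g)"
    and tens_add_right: "\<lbrakk>f \<in> Hom C x x'; g \<in> Hom C y y'; g' \<in> Hom C y y'\<rbrakk> \<Longrightarrow>
      f \<star> Add C g g' = Add C (f \<star> g) (f \<star> g')"
    and tens_scale_left: "\<lbrakk>f \<in> Hom C x x'; g \<in> Hom C y y'\<rbrakk> \<Longrightarrow>
      Scale C a f \<star> g = Scale C a (f \<star> g)"
    and tens_scale_right: "\<lbrakk>f \<in> Hom C x x'; g \<in> Hom C y y'\<rbrakk> \<Longrightarrow>
      f \<star> Scale C a g = Scale C a (f \<star> g)"
    and left_dual: "x \<in> Obj C \<Longrightarrow> \<exists>y ev coev. is_dual C x y ev coev"
    and right_dual: "x \<in> Obj C \<Longrightarrow> \<exists>y ev coev. is_dual C y x ev coev"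
    and hom_fin_dim: "\<lbrakk>x \<in> Obj C; y \<in> Obj C\<rbrakk> \<Longrightarrow> vectorspace.fin_dim class_ring (hom_space C x y)"
    and finitely_many_simples: "\<exists>xs. iso_reps C (simple_object C) xs"
    and unit_simple: "simple_object C (TUnit C)"

text \<open>The matrix of left multiplication by \<open>x\<close> on the Grothendieck ring, in the basis of simple
  objects: as the field is algebraically closed, the multiplicity of a simple object \<open>s\<close> in \<open>z\<close> is
  the dimension of \<open>Hom s z\<close>. The Frobenius-Perron dimension is its largest nonnegative real
  eigenvalue. Neither depends on the choice of representatives, up to simultaneous permutation
  of rows and columns.\<close>

definition fusion_matrix :: "('o, 'm, 'k::field, 'x) monoidal_cat_scheme \<Rightarrow> 'o \<Rightarrow> real mat" where
  "fusion_matrix C x = (let s = simple_reps C; n = length s in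
     mat n n (\<lambda>(i, j). real (hom_dim C (s ! i) (x \<boxtimes>\<^bsub>C\<^esub> (s ! j)))))"

definition FPdim :: "('o, 'm, 'k::field, 'x) monoidal_cat_scheme \<Rightarrow> 'o \<Rightarrow> real" where
  "FPdim C x = Max {r. 0 \<le> r \<and> eigenvalue (fusion_matrix C x) r}"

definition integral_category :: "('o, 'm, 'k::field, 'x) monoidal_cat_scheme \<Rightarrow> bool" where
  "integral_category C \<longleftrightarrow> (\<forall>x. simple_object C x \<longrightarrow> FPdim C x \<in> \<int>)"

definition pointed_category :: "('o, 'm, 'k, 'x) monoidal_cat_scheme \<Rightarrow> bool" where
  "pointed_category C \<longleftrightarrow> (\<forall>x. simple_object C x \<longrightarrow> invertible_object C x)"

locale tambara_yamagami_category = fusion_category C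
  for C :: "('o, 'm, 'k::{alg_closed_field, field_char_0}, 'x) monoidal_cat_scheme" (structure) +
  assumes tambara_yamagami: "\<exists>x gs. simple_object C x \<and> \<not> invertible_object C x \<and>
      (\<forall>y. simple_object C y \<and> \<not> invertible_object C y \<longrightarrow> isomorphic C y x) \<and>
      iso_reps C (invertible_object C) gs \<and> direct_sum C gs (x \<boxtimes> x)"

locale ising_category = fusion_category C
  for C :: "('o, 'm, 'k::{alg_closed_field, field_char_0}, 'x) monoidal_cat_scheme" (structure) +
  assumes ising: "\<exists>a x. iso_reps C (simple_object C) [TUnit C, a, x] \<and>
      invertible_object C a \<and> \<not> invertible_object C x \<and>
      isomorphic C (a \<boxtimes> a) (TUnit C) \<and> direct_sum C [TUnit C, a] (x \<boxtimes> x)"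


section \<open>Braidings, ribbon structures and modular categories\<close>

record ('o, 'm, 'k) braided_cat = "('o, 'm, 'k) monoidal_cat" +
  Braid :: "'o \<Rightarrow> 'o \<Rightarrow> 'm"

locale braided_fusion_category = fusion_category C
  for C :: "('o, 'm, 'k::{alg_closed_field, field_char_0}, 'x) braided_cat_scheme" (structure) +
  assumes braid_hom: "\<lbrakk>x \<in> Obj C; y \<in> Obj C\<rbrakk> \<Longrightarrow> Braid C x y \<in> Hom C (x \<boxtimes> y) (y \<boxtimes> x)"
    and braid_iso: "\<lbrakk>x \<in> Obj C; y \<in> Obj C\<rbrakk> \<Longrightarrow> is_iso C (Braid C x y)"
    and braid_natural: "\<lbrakk>f \<in> Hom C x x'; g \<in> Hom C y y'\<rbrakk> \<Longrightarrow>
        Braid C x' y' \<cdot> (f \<star> g) = (g \<star> f) \<cdot> Braid C x y"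
    and hexagon1: "\<lbrakk>x \<in> Obj C; y \<in> Obj C; z \<in> Obj C\<rbrakk> \<Longrightarrow>
        Assoc C y z x \<cdot> Braid C x (y \<boxtimes> z) \<cdot> Assoc C x y z =
        (Ident C y \<star> Braid C x z) \<cdot> Assoc C y x z \<cdot> (Braid C x y \<star> Ident C z)"
    and hexagon2: "\<lbrakk>x \<in> Obj C; y \<in> Obj C; z \<in> Obj C\<rbrakk> \<Longrightarrow>
        inv_arr C (Assoc C z x y) \<cdot> Braid C (x \<boxtimes> y) z \<cdot> inv_arr C (Assoc C x y z) =
        (Braid C x z \<star> Ident C y) \<cdot> inv_arr C (Assoc C x z y) \<cdot> (Ident C x \<star> Braid C y z)"

record ('o, 'm, 'k) ribbon_cat = "('o, 'm, 'k) braided_cat" +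
  Twist :: "'o \<Rightarrow> 'm"

locale premodular_category = braided_fusion_category C
  for C :: "('o, 'm, 'k::{alg_closed_field, field_char_0}, 'x) ribbon_cat_scheme" (structure) +
  assumes twist_hom: "x \<in> Obj C \<Longrightarrow> Twist C x \<in> Hom C x x"
    and twist_iso: "x \<in> Obj C \<Longrightarrow> is_iso C (Twist C x)"
    and twist_natural: "f \<in> Hom C x y \<Longrightarrow> Twist C y \<cdot> f = f \<cdot> Twist C x"
    and twist_tens: "\<lbrakk>x \<in> Obj C; y \<in> Obj C\<rbrakk> \<Longrightarrow>
        Twist C (x \<boxtimes> y) = Braid C y x \<cdot> Braid C x y \<cdot> (Twist C x \<star> Twist C y)"
    and twist_dual: "is_dual C x y ev coev \<Longrightarrow>
        Twist C y = transpose_arr C x y ev coev (Twist C x)"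

context
  fixes C :: "('o, 'm, 'k::field, 'x) ribbon_cat_scheme" (structure)
begin

text \<open>The quantum trace of \<open>f : x \<rightarrow> x\<close>, computed from any left dual of \<open>x\<close>. It is an endomorphism
  of the simple object \<open>TUnit C\<close>, hence a scalar, and it does not depend on the choice of the dual.\<close>

definition qtrace :: "'o \<Rightarrow> 'm \<Rightarrow> 'k" where
  "qtrace x f = (THE a. \<exists>y ev coev. is_dual C x y ev coev \<and>
     ev \<cdot> Braid C x y \<cdot> ((Twist C x \<cdot> f) \<star> Ident C y) \<cdot> coev = Scale C a (Ident C (TUnit C)))"

definition S_matrix :: "'k mat" where
  "S_matrix = (let s = simple_reps C; n = length s in
     mat n n (\<lambda>(i, j). qtrace (s ! i \<boxtimes> s ! j) (Braid C (s ! j) (s ! i) \<cdot> Braid C (s ! i) (s ! j))))"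

end

locale modular_category = premodular_category C
  for C :: "('o, 'm, 'k::{alg_closed_field, field_char_0}, 'x) ribbon_cat_scheme" (structure) +
  assumes S_matrix_invertible: "invertible_mat (S_matrix C)"


section \<open>Functors\<close>

record ('o, 'm, 'p, 'n) cat_functor =
  FObj :: "'o \<Rightarrow> 'p"
  FArr :: "'m \<Rightarrow> 'n"

locale is_functor =
  fixes C :: "('o, 'm, 'x) cat_scheme"
    and D :: "('p, 'n, 'y) cat_scheme"
    and F :: "('o, 'm, 'p, 'n, 'z) cat_functor_scheme"
  assumes fobj: "x \<in> Obj C \<Longrightarrow> FObj F x \<in> Obj D"
    and farr: "f \<in> Hom C x y \<Longrightarrow> FArr F f \<in> Hom D (FObj F x) (FObj F y)"
    and farr_ident: "x \<in> Obj C \<Longrightarrow> FArr F (Ident C x) = Ident D (FObj F x)"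
    and farr_comp: "\<lbrakk>f \<in> Hom C x y; g \<in> Hom C y z\<rbrakk> \<Longrightarrow>
        FArr F (g \<cdot>\<^bsub>C\<^esub> f) = FArr F g \<cdot>\<^bsub>D\<^esub> FArr F f"

definition nat_isomorphic ::
  "('o, 'm, 'x) cat_scheme \<Rightarrow> ('p, 'n, 'y) cat_scheme \<Rightarrow>
   ('o, 'm, 'p, 'n, 'z) cat_functor_scheme \<Rightarrow> ('o, 'm, 'p, 'n, 'w) cat_functor_scheme \<Rightarrow> bool" where
  "nat_isomorphic C D F G \<longleftrightarrow>
     (\<exists>\<eta>. (\<forall>x \<in> Obj C. \<eta> x \<in> Hom D (FObj F x) (FObj G x) \<and> is_iso D (\<eta> x)) \<and>
       (\<forall>x y. \<forall>f \<in> Hom C x y. \<eta> y \<cdot>\<^bsub>D\<^esub> FArr F f = FArr G f \<cdot>\<^bsub>D\<^esub> \<eta> x))"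

definition id_functor :: "('o, 'm, 'o, 'm) cat_functor" where
  "id_functor = \<lparr>FObj = id, FArr = id\<rparr>"

definition comp_functor ::
  "('p, 'n, 'q, 'l, 'z) cat_functor_scheme \<Rightarrow> ('o, 'm, 'p, 'n, 'w) cat_functor_scheme \<Rightarrow>
   ('o, 'm, 'q, 'l) cat_functor" where
  "comp_functor G F = \<lparr>FObj = FObj G \<circ> FObj F, FArr = FArr G \<circ> FArr F\<rparr>"

locale is_equivalence = is_functor C D F
  for C :: "('o, 'm, 'x) cat_scheme"
    and D :: "('p, 'n, 'y) cat_scheme"
    and F :: "('o, 'm, 'p, 'n, 'z) cat_functor_scheme" +
  assumes quasi_inverse: "\<exists>G :: ('p, 'n, 'o, 'm) cat_functor. is_functor D C G \<and>
      nat_isomorphic C C (comp_functor G F) id_functor \<and>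
      nat_isomorphic D D (comp_functor F G) id_functor"

text \<open>\<open>FTens F x y : F x \<boxtimes> F y \<rightarrow> F (x \<boxtimes> y)\<close> and \<open>FUnit F : 1 \<rightarrow> F 1\<close>.\<close>

record ('o, 'm, 'p, 'n) tensor_functor = "('o, 'm, 'p, 'n) cat_functor" +
  FTens :: "'o \<Rightarrow> 'o \<Rightarrow> 'n"
  FUnit :: 'n

text \<open>Tensor functors are strong monoidal linear functors. Between fusion categories these are
  automatically exact and faithful.\<close>

locale is_tensor_functor = is_functor C D F
  for C :: "('o, 'm, 'k, 'x) monoidal_cat_scheme"
    and D :: "('p, 'n, 'k, 'y) monoidal_cat_scheme"
    and F :: "('o, 'm, 'p, 'n, 'z) tensor_functor_scheme" +
  assumes farr_add: "\<lbrakk>f \<in> Hom C x y; g \<in> Hom C x y\<rbrakk> \<Longrightarrow>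
        FArr F (Add C f g) = Add D (FArr F f) (FArr F g)"
    and farr_scale: "f \<in> Hom C x y \<Longrightarrow> FArr F (Scale C a f) = Scale D a (FArr F f)"
    and funit_hom: "FUnit F \<in> Hom D (TUnit D) (FObj F (TUnit C))"
    and funit_iso: "is_iso D (FUnit F)"
    and ftens_hom: "\<lbrakk>x \<in> Obj C; y \<in> Obj C\<rbrakk> \<Longrightarrow>
        FTens F x y \<in> Hom D (FObj F x \<boxtimes>\<^bsub>D\<^esub> FObj F y) (FObj F (x \<boxtimes>\<^bsub>C\<^esub> y))"
    and ftens_iso: "\<lbrakk>x \<in> Obj C; y \<in> Obj C\<rbrakk> \<Longrightarrow> is_iso D (FTens F x y)"
    and ftens_natural: "\<lbrakk>f \<in> Hom C x x'; g \<in> Hom C y y'\<rbrakk> \<Longrightarrow>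
        FTens F x' y' \<cdot>\<^bsub>D\<^esub> (FArr F f \<star>\<^bsub>D\<^esub> FArr F g) = FArr F (f \<star>\<^bsub>C\<^esub> g) \<cdot>\<^bsub>D\<^esub> FTens F x y"
    and ftens_assoc: "\<lbrakk>x \<in> Obj C; y \<in> Obj C; z \<in> Obj C\<rbrakk> \<Longrightarrow>
        FArr F (Assoc C x y z) \<cdot>\<^bsub>D\<^esub> FTens F (x \<boxtimes>\<^bsub>C\<^esub> y) z \<cdot>\<^bsub>D\<^esub>
          (FTens F x y \<star>\<^bsub>D\<^esub> Ident D (FObj F z)) =
        FTens F x (y \<boxtimes>\<^bsub>C\<^esub> z) \<cdot>\<^bsub>D\<^esub> (Ident D (FObj F x) \<star>\<^bsub>D\<^esub> FTens F y z) \<cdot>\<^bsub>D\<^esub>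
          Assoc D (FObj F x) (FObj F y) (FObj F z)"
    and ftens_lunit: "x \<in> Obj C \<Longrightarrow>
        FArr F (LUnit C x) \<cdot>\<^bsub>D\<^esub> FTens F (TUnit C) x \<cdot>\<^bsub>D\<^esub> (FUnit F \<star>\<^bsub>D\<^esub> Ident D (FObj F x)) =
        LUnit D (FObj F x)"
    and ftens_runit: "x \<in> Obj C \<Longrightarrow>
        FArr F (RUnit C x) \<cdot>\<^bsub>D\<^esub> FTens F x (TUnit C) \<cdot>\<^bsub>D\<^esub> (Ident D (FObj F x) \<star>\<^bsub>D\<^esub> FUnit F) =
        RUnit D (FObj F x)"

locale is_braided_functor = is_tensor_functor C D F
  for C :: "('o, 'm, 'k, 'x) braided_cat_scheme"
    and D :: "('p, 'n, 'k, 'y) braided_cat_scheme"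
    and F :: "('o, 'm, 'p, 'n, 'z) tensor_functor_scheme" +
  assumes ftens_braid: "\<lbrakk>x \<in> Obj C; y \<in> Obj C\<rbrakk> \<Longrightarrow>
        FArr F (Braid C x y) \<cdot>\<^bsub>D\<^esub> FTens F x y =
        FTens F y x \<cdot>\<^bsub>D\<^esub> Braid D (FObj F x) (FObj F y)"

definition braided_equivalent ::
  "('o, 'm, 'k, 'x) braided_cat_scheme \<Rightarrow> ('p, 'n, 'k, 'y) braided_cat_scheme \<Rightarrow> bool" where
  "braided_equivalent C D \<longleftrightarrow>
     (\<exists>F :: ('o, 'm, 'p, 'n) tensor_functor. is_braided_functor C D F \<and> is_equivalence C D F)"

locale is_ribbon_functor = is_braided_functor C D F
  for C :: "('o, 'm, 'k, 'x) ribbon_cat_scheme"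
    and D :: "('p, 'n, 'k, 'y) ribbon_cat_scheme"
    and F :: "('o, 'm, 'p, 'n, 'z) tensor_functor_scheme" +
  assumes farr_twist: "x \<in> Obj C \<Longrightarrow> FArr F (Twist C x) = Twist D (FObj F x)"

definition dominant ::
  "('o, 'm, 'x) cat_scheme \<Rightarrow> ('p, 'n, 'y) cat_scheme \<Rightarrow>
   ('o, 'm, 'p, 'n, 'z) cat_functor_scheme \<Rightarrow> bool" where
  "dominant C D F \<longleftrightarrow> (\<forall>y \<in> Obj D. \<exists>x \<in> Obj C. \<exists>f \<in> Hom D y (FObj F x). is_mono D f)"

text \<open>\<open>D\<close>, together with \<open>F : C \<rightarrow> D\<close>, is a modularization of \<open>C\<close>.\<close>

locale modularization =
  source: premodular_category C + target: modular_category D + is_ribbon_functor C D F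
  for C :: "('o, 'm, 'k::{alg_closed_field, field_char_0}, 'x) ribbon_cat_scheme"
    and D :: "('p, 'n, 'k, 'y) ribbon_cat_scheme"
    and F :: "('o, 'm, 'p, 'n, 'z) tensor_functor_scheme" +
  assumes dominant: "dominant C D F"

end

theory Submission
  imports Defs
begin

text \<open>
  Write \<open>X\<close> for the non-invertible simple object of the Tambara-Yamagami category \<open>C\<close>, \<open>G\<close> for
  its group of invertible objects and \<open>n\<close> for the order of \<open>G\<close>. The invertible objects have
  Frobenius-Perron dimension 1 and \<open>X\<close> has dimension \<open>sqrt n\<close>, so \<open>C\<close> is integral if and only if
  \<open>n\<close> is a square (\<open>integral_iff_sqrt\<close>).

  Let \<open>F\<close> be the functor to the modularization and \<open>P = F X\<close>. Then \<open>P \<otimes> P\<close> is the sum of the \<open>n\<close>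
  invertible objects \<open>F g\<close>, and since \<open>F\<close> is dominant every simple object of the modularization
  is isomorphic to some \<open>F g\<close> or occurs in \<open>P\<close> (\<open>modular_square_image\<close>). The rest of the
  argument takes place inside the modularization, in the locale \<open>modular_square\<close>.

  If one non-invertible object occurs in \<open>P\<close>, then all constituents of \<open>P\<close> are non-invertible,
  because products of two constituents are sums of objects \<open>F g\<close>. So there are two cases. If the
  modularization is pointed, then \<open>P\<close> is a sum of some number \<open>m\<close> of invertible objects, and
  counting the summands of \<open>P \<otimes> P\<close> gives \<open>n = m * m\<close> (\<open>pointed_square\<close>).

  Otherwise the braiding decides. The object \<open>g \<otimes> X\<close> is simple, so the double braiding of \<open>g\<close>
  with \<open>X\<close> is a scalar \<open>b\<close>. By the hexagon axioms its double braiding with \<open>X \<otimes> X\<close> is the square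
  of \<open>b\<close>, and by naturality so is its double braiding with every invertible object, the unit
  included; hence \<open>b\<close> is a sign and invertible objects centralize each other
  (\<open>ks_double_braid\<close>). Two objects \<open>F g\<close> and \<open>F h\<close> with the same sign have the same double
  braidings with all simple objects, hence proportional rows in the S-matrix, hence are
  isomorphic (\<open>modular_separates\<close>). This leaves at most two objects \<open>F g\<close> up to isomorphism. For
  a non-invertible simple object \<open>Y\<close> with dual \<open>Y'\<close>, duality shows that \<open>Y \<otimes> Y'\<close> contains each
  of them at most once, and it is not simple; so there are exactly two, the unit and an object
  \<open>a\<close> with \<open>Y \<otimes> Y' = 1 \<oplus> a\<close>. Again by duality \<open>Y'\<close> is the only non-invertible simple object, so
  the modularization is an Ising category, and \<open>P\<close> is a multiple of \<open>Y'\<close>, whence \<open>n = 2 * m * m\<close>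
  for some \<open>m > 0\<close> (\<open>not_pointed_ising\<close>). This is not a square, so \<open>C\<close> is not integral. The two
  cases together give both parts of the theorem.

  The S-matrix argument needs quantum traces to be independent of the chosen dual and quantum
  dimensions to be multiplicative (\<open>qdim_tensor\<close>). Both are proved in a calculus without
  associators: evaluations, coevaluations and braidings are whiskered on the right by an
  arbitrary object and so become natural transformations between iterated left multiplications
  \<open>w \<mapsto> x \<otimes> (y \<otimes> w)\<close>, which compose strictly.
\<close>

section \<open>Categories\<close>

context category
begin

lemma in_Hom: "f \<in> Hom C x y \<longleftrightarrow> f \<in> Arr C \<and> Dom C f = x \<and> Cod C f = y"
  by (auto simp: Hom_def)

lemma dom_in_Obj [simp]: "f \<in> Arr C \<Longrightarrow> Dom C f \<in> Obj C"
  and cod_in_Obj [simp]: "f \<in> Arr C \<Longrightarrow> Cod C f \<in> Obj C"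
  by (rule dom_obj, simp) (rule cod_obj, simp)

lemma Hom_objs: "f \<in> Hom C x y \<Longrightarrow> x \<in> Obj C \<and> y \<in> Obj C"
  by (auto simp: in_Hom)

lemma ident_simps [simp]:
  assumes "x \<in> Obj C"
  shows "Ident C x \<in> Arr C" "Dom C (Ident C x) = x" "Cod C (Ident C x) = x"
  using ident_hom[OF assms] by (auto simp: in_Hom)

lemma comp_simps [simp]:
  assumes "f \<in> Arr C" "g \<in> Arr C" "Cod C f = Dom C g"
  shows "g \<cdot> f \<in> Arr C" "Dom C (g \<cdot> f) = Dom C f" "Cod C (g \<cdot> f) = Cod C g"
  using comp_hom[of f "Dom C f" "Cod C f" g "Cod C g"] assms by (auto simp: in_Hom)

lemma assoc_simp [simp]:
  "\<lbrakk>f \<in> Arr C; g \<in> Arr C; h \<in> Arr C; Cod C f = Dom C g; Cod C g = Dom C h\<rbrakk> \<Longrightarrow>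
    (h \<cdot> g) \<cdot> f = h \<cdot> (g \<cdot> f)"
  by (rule comp_assoc) (auto simp: in_Hom)

lemma ident_right_simp [simp]: "\<lbrakk>f \<in> Arr C; Dom C f = x\<rbrakk> \<Longrightarrow> f \<cdot> Ident C x = f"
  by (rule comp_ident_right[where y = "Cod C f"]) (auto simp: in_Hom)

lemma ident_left_simp [simp]: "\<lbrakk>f \<in> Arr C; Cod C f = x\<rbrakk> \<Longrightarrow> Ident C x \<cdot> f = f"
  by (rule comp_ident_left[where x = "Dom C f"]) (auto simp: in_Hom)

lemma inverse_arrows_unique:
  assumes "inverse_arrows C f g" "inverse_arrows C f h"
  shows "g = h"
proof -
  have "g = g \<cdot> (f \<cdot> h)" using assms by (simp add: inverse_arrows_def in_Hom)
  also have "\<dots> = (g \<cdot> f) \<cdot> h" using assms by (subst assoc_simp) (simp_all add: inverse_arrows_def in_Hom)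
  also have "\<dots> = h" using assms by (simp add: inverse_arrows_def in_Hom)
  finally show ?thesis .
qed

lemma iso_inverse_arrows: "is_iso C f \<Longrightarrow> inverse_arrows C f (inv_arr C f)"
  unfolding is_iso_def inv_arr_def by (metis inverse_arrows_unique theI)

lemma iso_arr [simp]: "is_iso C f \<Longrightarrow> f \<in> Arr C"
  by (auto simp: is_iso_def inverse_arrows_def)

lemma inv_simps [simp]:
  assumes "is_iso C f"
  shows "inv_arr C f \<in> Arr C" "Dom C (inv_arr C f) = Cod C f" "Cod C (inv_arr C f) = Dom C f"
    "inv_arr C f \<cdot> f = Ident C (Dom C f)" "f \<cdot> inv_arr C f = Ident C (Cod C f)"
    "is_iso C (inv_arr C f)"
proof -
  have i: "inverse_arrows C f (inv_arr C f)" by (rule iso_inverse_arrows[OF assms])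
  then show s: "inv_arr C f \<in> Arr C" "Dom C (inv_arr C f) = Cod C f" "Cod C (inv_arr C f) = Dom C f"
    "inv_arr C f \<cdot> f = Ident C (Dom C f)" "f \<cdot> inv_arr C f = Ident C (Cod C f)"
    by (simp_all add: inverse_arrows_def in_Hom)
  have "inverse_arrows C (inv_arr C f) f"
    unfolding inverse_arrows_def in_Hom s using s(1) iso_arr[OF assms] by simp
  then show "is_iso C (inv_arr C f)" unfolding is_iso_def by blast
qed

lemma inv_comp_simps [simp]:
  assumes "is_iso C f" "k \<in> Arr C"
  shows "Cod C k = Dom C f \<Longrightarrow> inv_arr C f \<cdot> (f \<cdot> k) = k"
    and "Cod C k = Cod C f \<Longrightarrow> f \<cdot> (inv_arr C f \<cdot> k) = k"
  by (subst assoc_simp[symmetric], simp_all add: assms del: assoc_simp)+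

lemma isoI:
  assumes "f \<in> Hom C x y" "g \<in> Hom C y x" "g \<cdot> f = Ident C x" "f \<cdot> g = Ident C y"
  shows "is_iso C f" "inv_arr C f = g"
proof -
  have i: "inverse_arrows C f g" using assms by (auto simp: inverse_arrows_def in_Hom)
  then show "is_iso C f" by (auto simp: is_iso_def)
  then show "inv_arr C f = g" using i inverse_arrows_unique iso_inverse_arrows by blast
qed

lemma iso_ident [simp]: "x \<in> Obj C \<Longrightarrow> is_iso C (Ident C x)"
  by (rule isoI(1)[of _ x x "Ident C x"]) (auto simp: in_Hom)

lemma iso_comp [simp]:
  assumes "is_iso C f" "is_iso C g" "Cod C f = Dom C g"
  shows "is_iso C (g \<cdot> f)"
  by (rule isoI(1)[of _ "Dom C f" "Cod C g" "inv_arr C f \<cdot> inv_arr C g"]) (auto simp: in_Hom assms)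

lemma iso_cancel_left:
  assumes "is_iso C f" "g \<in> Arr C" "h \<in> Arr C" "Cod C g = Dom C f" "Cod C h = Dom C f"
  shows "f \<cdot> g = f \<cdot> h \<longleftrightarrow> g = h"
  using inv_comp_simps(1)[of f g] inv_comp_simps(1)[of f h] assms by metis

lemma iso_cancel_right:
  assumes "is_iso C f" "g \<in> Arr C" "h \<in> Arr C" "Dom C g = Cod C f" "Dom C h = Cod C f"
  shows "g \<cdot> f = h \<cdot> f \<longleftrightarrow> g = h"
proof
  assume "g \<cdot> f = h \<cdot> f"
  then have "(g \<cdot> f) \<cdot> inv_arr C f = (h \<cdot> f) \<cdot> inv_arr C f" by simp
  then show "g = h" using assms by simp
qed simp

text \<open>An equation between composites, made applicable inside a longer composite that is associated to
  the right.\<close>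

lemma comp_eq_extend:
  assumes "g \<cdot> f = h" "f \<in> Arr C" "g \<in> Arr C" "Cod C f = Dom C g" "k \<in> Arr C" "Cod C k = Dom C f"
  shows "g \<cdot> (f \<cdot> k) = h \<cdot> k"
  using assms assoc_simp by metis

lemma isomorphicI: "\<lbrakk>f \<in> Hom C x y; is_iso C f\<rbrakk> \<Longrightarrow> isomorphic C x y"
  by (auto simp: isomorphic_def)

lemma isomorphic_refl [simp]: "x \<in> Obj C \<Longrightarrow> isomorphic C x x"
  by (rule isomorphicI[of "Ident C x"]) (auto simp: in_Hom)

lemma isomorphic_sym: "isomorphic C x y \<Longrightarrow> isomorphic C y x"
  unfolding isomorphic_def by (metis in_Hom inv_simps(1,2,3,6))

lemma isomorphic_trans: "\<lbrakk>isomorphic C x y; isomorphic C y z\<rbrakk> \<Longrightarrow> isomorphic C x z"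
  unfolding isomorphic_def by (metis comp_hom in_Hom iso_comp)

lemma isomorphic_objs: "isomorphic C x y \<Longrightarrow> x \<in> Obj C \<and> y \<in> Obj C"
  by (auto simp: isomorphic_def in_Hom)

end

section \<open>Linear categories\<close>

lemma hom_space_simps [simp]:
  "carrier (hom_space C x y) = Hom C x y" "zero (hom_space C x y) = Zero C x y"
  "add (hom_space C x y) = Add C" "module.smult (hom_space C x y) = Scale C"
  by (auto simp: hom_space_def)

text \<open>Any finite set can index the summands. Products and dependent sums of index sets then describe
  tensor products and iterated decompositions without arithmetic on list positions.\<close>

definition biproduct ::
  "('o, 'm, 'k, 'x) linear_cat_scheme \<Rightarrow> 'i set \<Rightarrow> ('i \<Rightarrow> 'o) \<Rightarrow> 'o \<Rightarrow> ('i \<Rightarrow> 'm) \<Rightarrow> ('i \<Rightarrow> 'm) \<Rightarrow> bool" where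
  "biproduct C I x z \<iota> \<pi> \<longleftrightarrow> finite I \<and> z \<in> Obj C \<and>
     (\<forall>i \<in> I. x i \<in> Obj C \<and> \<iota> i \<in> Hom C (x i) z \<and> \<pi> i \<in> Hom C z (x i)) \<and>
     (\<forall>i \<in> I. \<forall>j \<in> I. Comp C (\<pi> j) (\<iota> i) = (if i = j then Ident C (x i) else Zero C (x i) (x j))) \<and>
     finsum (hom_space C z z) (\<lambda>i. Comp C (\<iota> i) (\<pi> i)) I = Ident C z"

context linear_category
begin

lemma hom_module: "\<lbrakk>x \<in> Obj C; y \<in> Obj C\<rbrakk> \<Longrightarrow> Module.module class_ring (hom_space C x y)"
  using hom_vectorspace vectorspace.axioms(1) by blast

lemma hom_abelian_group: "\<lbrakk>x \<in> Obj C; y \<in> Obj C\<rbrakk> \<Longrightarrow> abelian_group (hom_space C x y)"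
  using hom_module module.axioms(2) by blast

lemma hom_abelian_monoid: "\<lbrakk>x \<in> Obj C; y \<in> Obj C\<rbrakk> \<Longrightarrow> abelian_monoid (hom_space C x y)"
  using hom_abelian_group abelian_group.axioms(1) by blast

lemma zero_simps [simp]:
  assumes "x \<in> Obj C" "y \<in> Obj C"
  shows "Zero C x y \<in> Arr C" "Dom C (Zero C x y) = x" "Cod C (Zero C x y) = y"
  using abelian_monoid.zero_closed[OF hom_abelian_monoid[OF assms]] by (auto simp: in_Hom)

lemma add_simps [simp]:
  assumes "f \<in> Arr C" "g \<in> Arr C" "Dom C f = Dom C g" "Cod C f = Cod C g"
  shows "Add C f g \<in> Arr C" "Dom C (Add C f g) = Dom C g" "Cod C (Add C f g) = Cod C g"
  using abelian_monoid.a_closed[OF hom_abelian_monoid[of "Dom C f" "Cod C f"], of f g] assms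
  by (auto simp: in_Hom)

lemma scale_simps [simp]:
  assumes "f \<in> Arr C"
  shows "Scale C a f \<in> Arr C" "Dom C (Scale C a f) = Dom C f" "Cod C (Scale C a f) = Cod C f"
  using module.smult_closed[OF hom_module[of "Dom C f" "Cod C f"], of a f] assms
  by (auto simp: in_Hom)

lemma scale_scale [simp]: "f \<in> Arr C \<Longrightarrow> Scale C a (Scale C b f) = Scale C (a * b) f"
  using module.smult_assoc1[OF hom_module[of "Dom C f" "Cod C f"], of a b f]
  by (auto simp: in_Hom)

lemma scale_one [simp]: "f \<in> Arr C \<Longrightarrow> Scale C 1 f = f"
  using module.smult_one[OF hom_module[of "Dom C f" "Cod C f"], of f]
  by (auto simp: in_Hom)

lemma scale_zero_left [simp]: "f \<in> Arr C \<Longrightarrow> Scale C 0 f = Zero C (Dom C f) (Cod C f)"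
  using module.lmult_0[OF hom_module[of "Dom C f" "Cod C f"], of f]
  by (auto simp: in_Hom)

lemma scale_zero_right [simp]: "\<lbrakk>x \<in> Obj C; y \<in> Obj C\<rbrakk> \<Longrightarrow> Scale C a (Zero C x y) = Zero C x y"
  using module.rmult_0[OF hom_module[of x y], of a]
  by (auto simp: in_Hom)

lemma add_zero [simp]:
  assumes "f \<in> Arr C" "Dom C f = x" "Cod C f = y"
  shows "Add C f (Zero C x y) = f" "Add C (Zero C x y) f = f"
  using abelian_monoid.l_zero[OF hom_abelian_monoid[of x y], of f]
    abelian_monoid.r_zero[OF hom_abelian_monoid[of x y], of f] assms
  by (auto simp: in_Hom)

lemma add_comm: "\<lbrakk>f \<in> Arr C; g \<in> Arr C; Dom C f = Dom C g; Cod C f = Cod C g\<rbrakk> \<Longrightarrow> Add C f g = Add C g f"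
  using abelian_monoid.a_comm[OF hom_abelian_monoid[of "Dom C f" "Cod C f"], of f g]
  by (auto simp: in_Hom)

lemma add_assoc: "\<lbrakk>f \<in> Arr C; g \<in> Arr C; h \<in> Arr C; Dom C f = Dom C g; Cod C f = Cod C g;
    Dom C g = Dom C h; Cod C g = Cod C h\<rbrakk> \<Longrightarrow> Add C (Add C f g) h = Add C f (Add C g h)"
  using abelian_monoid.a_assoc[OF hom_abelian_monoid[of "Dom C f" "Cod C f"], of f g h]
  by (auto simp: in_Hom)

lemma scale_add_left: "f \<in> Arr C \<Longrightarrow> Scale C (a + b) f = Add C (Scale C a f) (Scale C b f)"
  using module.smult_l_distr[OF hom_module[of "Dom C f" "Cod C f"], of a b f]
  by (auto simp: in_Hom)

lemma scale_add_right: "\<lbrakk>f \<in> Arr C; g \<in> Arr C; Dom C f = Dom C g; Cod C f = Cod C g\<rbrakk> \<Longrightarrow>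
    Scale C a (Add C f g) = Add C (Scale C a f) (Scale C a g)"
  using module.smult_r_distr[OF hom_module[of "Dom C f" "Cod C f"], of a f g]
  by (auto simp: in_Hom)

lemma comp_scale [simp]:
  assumes "f \<in> Arr C" "g \<in> Arr C" "Cod C f = Dom C g"
  shows "g \<cdot> Scale C a f = Scale C a (g \<cdot> f)" "Scale C a g \<cdot> f = Scale C a (g \<cdot> f)"
  using comp_scale_right[of f "Dom C f" "Cod C f" g "Cod C g" a]
    comp_scale_left[of f "Dom C f" "Cod C f" g "Cod C g" a] assms
  by (auto simp: in_Hom)

lemma comp_add:
  assumes "f \<in> Arr C" "g \<in> Arr C" "h \<in> Arr C"
  shows "\<lbrakk>Cod C f = Dom C h; Dom C g = Dom C f; Cod C g = Cod C f\<rbrakk> \<Longrightarrow>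
      h \<cdot> Add C f g = Add C (h \<cdot> f) (h \<cdot> g)"
    and "\<lbrakk>Cod C h = Dom C f; Dom C g = Dom C f; Cod C g = Cod C f\<rbrakk> \<Longrightarrow>
      Add C f g \<cdot> h = Add C (f \<cdot> h) (g \<cdot> h)"
  using comp_add_right[of f "Dom C f" "Cod C f" g h "Cod C h"]
    comp_add_left[of h "Dom C h" "Cod C h" f "Cod C f" g] assms
  by (auto simp: in_Hom)

lemma comp_zero [simp]:
  assumes "f \<in> Arr C" "w \<in> Obj C"
  shows "Dom C f = x \<Longrightarrow> f \<cdot> Zero C w x = Zero C w (Cod C f)"
    and "Cod C f = x \<Longrightarrow> Zero C x w \<cdot> f = Zero C (Dom C f) w"
proof -
  show "f \<cdot> Zero C w x = Zero C w (Cod C f)" if "Dom C f = x"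
    using that assms comp_scale(1)[of "Zero C w x" f 0] by auto
  show "Zero C x w \<cdot> f = Zero C (Dom C f) w" if "Cod C f = x"
    using that assms comp_scale(2)[of f "Zero C x w" 0] by auto
qed

lemma diff_zero_iff:
  assumes "f \<in> Arr C" "g \<in> Arr C" "Dom C g = Dom C f" "Cod C g = Cod C f"
  shows "Add C f (Scale C (- 1) g) = Zero C (Dom C f) (Cod C f) \<longleftrightarrow> f = g"
proof
  have gg: "Add C g (Scale C (- 1) g) = Zero C (Dom C f) (Cod C f)"
    "Add C (Scale C (- 1) g) g = Zero C (Dom C f) (Cod C f)"
    using scale_add_left[of g 1 "-1"] scale_add_left[of g "-1" 1] assms by auto
  then show "f = g \<Longrightarrow> Add C f (Scale C (- 1) g) = Zero C (Dom C f) (Cod C f)" by simp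
  assume z: "Add C f (Scale C (- 1) g) = Zero C (Dom C f) (Cod C f)"
  have "f = Add C f (Add C (Scale C (- 1) g) g)" using gg assms by simp
  also have "\<dots> = Add C (Add C f (Scale C (- 1) g)) g" using assms by (subst add_assoc) auto
  also have "\<dots> = g" using z assms by simp
  finally show "f = g" .
qed

lemma scale_cancel:
  assumes "f \<in> Arr C" "f \<noteq> Zero C (Dom C f) (Cod C f)"
  shows "Scale C a f = Scale C b f \<longleftrightarrow> a = b"
proof
  assume e: "Scale C a f = Scale C b f"
  show "a = b"
  proof (rule ccontr)
    assume n: "a \<noteq> b"
    have "Scale C (a - b) f = Add C (Scale C a f) (Scale C (- 1) (Scale C b f))"
      using scale_add_left[of f a "- b"] assms by simp
    also have "\<dots> = Zero C (Dom C f) (Cod C f)"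
      using e assms diff_zero_iff[of "Scale C a f" "Scale C b f"] by simp
    finally have "Scale C (inverse (a - b)) (Scale C (a - b) f) = Zero C (Dom C f) (Cod C f)"
      using assms by simp
    then show False using n assms by simp
  qed
qed simp

lemma scale_eq_zero_iff:
  assumes "f \<in> Arr C"
  shows "Scale C a f = Zero C (Dom C f) (Cod C f) \<longleftrightarrow> a = 0 \<or> f = Zero C (Dom C f) (Cod C f)"
  using scale_cancel[OF assms, of a 0] assms by (auto) (metis dom_in_Obj cod_in_Obj scale_zero_right)

subsection \<open>Finite sums of arrows\<close>

abbreviation hsum where
  "hsum x y \<equiv> finsum (hom_space C x y)"

lemma hsum_simps [simp]:
  assumes "x \<in> Obj C" "y \<in> Obj C" "\<And>i. i \<in> I \<Longrightarrow> f i \<in> Hom C x y"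
  shows "hsum x y f I \<in> Arr C" "Dom C (hsum x y f I) = x" "Cod C (hsum x y f I) = y"
  using abelian_monoid.finsum_closed[OF hom_abelian_monoid[OF assms(1,2)], of f I] assms(3)
  by (auto simp: in_Hom)

lemma hsum_insert:
  assumes "x \<in> Obj C" "y \<in> Obj C" "finite I" "i \<notin> I" "\<And>j. j \<in> insert i I \<Longrightarrow> f j \<in> Hom C x y"
  shows "hsum x y f (insert i I) = Add C (f i) (hsum x y f I)"
  using abelian_monoid.finsum_insert[OF hom_abelian_monoid[OF assms(1,2)], of I i f] assms(3-)
  by auto

lemma hsum_empty [simp]:
  "x \<in> Obj C \<Longrightarrow> y \<in> Obj C \<Longrightarrow> hsum x y f {} = Zero C x y"
  using abelian_monoid.finsum_empty[OF hom_abelian_monoid[of x y]] by auto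

lemma hsum_cong:
  assumes "x \<in> Obj C" "y \<in> Obj C" "\<And>i. i \<in> I \<Longrightarrow> f i \<in> Hom C x y" "\<And>i. i \<in> I \<Longrightarrow> f i = g i"
  shows "hsum x y f I = hsum x y g I"
  using abelian_monoid.finsum_cong'[OF hom_abelian_monoid[OF assms(1,2)], of I I g f] assms(3-)
  by auto

text \<open>The map \<open>T\<close> will be composition with a fixed arrow, tensoring with a fixed object, or the action
  of a linear functor.\<close>

lemma hsum_additive:
  assumes "finite I" "x \<in> Obj C" "y \<in> Obj C" "x' \<in> Obj D" "y' \<in> Obj D" "linear_category D"
    and f: "\<And>i. i \<in> I \<Longrightarrow> f i \<in> Hom C x y"
    and T: "\<And>g. g \<in> Hom C x y \<Longrightarrow> T g \<in> Hom D x' y'"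
    and add: "\<And>g h. \<lbrakk>g \<in> Hom C x y; h \<in> Hom C x y\<rbrakk> \<Longrightarrow> T (Add C g h) = Add D (T g) (T h)"
    and zero: "T (Zero C x y) = Zero D x' y'"
  shows "T (hsum x y f I) = finsum (hom_space D x' y') (\<lambda>i. T (f i)) I"
  using assms(1) f
proof (induction I)
  case empty
  interpret D: linear_category D by fact
  show ?case using assms(2-5) zero by simp
next
  case (insert i I)
  interpret D: linear_category D by fact
  have "T (hsum x y f (insert i I)) = T (Add C (f i) (hsum x y f I))"
    using insert assms(2,3) by (subst hsum_insert) auto
  also have "\<dots> = Add D (T (f i)) (T (hsum x y f I))"
    using insert assms(2,3) by (intro add) (auto simp: in_Hom)
  also have "\<dots> = finsum (hom_space D x' y') (\<lambda>i. T (f i)) (insert i I)"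
    using insert assms(4,5) T by (subst D.hsum_insert) auto
  finally show ?case .
qed

lemma comp_hsum_left:
  assumes "finite I" "x \<in> Obj C" "g \<in> Arr C" "\<And>i. i \<in> I \<Longrightarrow> f i \<in> Hom C x (Dom C g)"
  shows "g \<cdot> hsum x (Dom C g) f I = hsum x (Cod C g) (\<lambda>i. g \<cdot> f i) I"
  by (rule hsum_additive[where T = "\<lambda>h. g \<cdot> h" and D = C])
    (use assms linear_category_axioms in \<open>auto simp: in_Hom comp_add\<close>)

lemma comp_hsum_right:
  assumes "finite I" "y \<in> Obj C" "g \<in> Arr C" "\<And>i. i \<in> I \<Longrightarrow> f i \<in> Hom C (Cod C g) y"
  shows "hsum (Cod C g) y f I \<cdot> g = hsum (Dom C g) y (\<lambda>i. f i \<cdot> g) I"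
  by (rule hsum_additive[where T = "\<lambda>h. h \<cdot> g" and D = C])
    (use assms linear_category_axioms in \<open>auto simp: in_Hom comp_add\<close>)

lemma hsum_zero:
  assumes "x \<in> Obj C" "y \<in> Obj C" "\<And>i. i \<in> I \<Longrightarrow> f i = Zero C x y"
  shows "hsum x y f I = Zero C x y"
proof -
  have "hsum x y f I = hsum x y (\<lambda>i. Zero C x y) I"
    using assms by (intro hsum_cong) (auto simp: in_Hom)
  then show ?thesis
    using abelian_monoid.finsum_zero[OF hom_abelian_monoid[OF assms(1,2)]] by simp
qed

lemma hsum_single:
  assumes "finite I" "i \<in> I" "f i \<in> Hom C x y" "\<And>j. j \<in> I \<Longrightarrow> j \<noteq> i \<Longrightarrow> f j = Zero C x y"
  shows "hsum x y f I = f i"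
proof -
  have xy: "x \<in> Obj C" "y \<in> Obj C" using assms(3) by (auto simp: in_Hom)
  have "hsum x y f I = hsum x y f (insert i (I - {i}))" using assms(2) by (simp add: insert_absorb)
  also have "\<dots> = Add C (f i) (hsum x y f (I - {i}))"
  proof (rule hsum_insert)
    show "f j \<in> Hom C x y" if "j \<in> insert i (I - {i})" for j
      using that assms(3) assms(4)[of j] xy by (cases "j = i") (auto simp: in_Hom)
  qed (use assms xy in auto)
  also have "hsum x y f (I - {i}) = Zero C x y" using assms xy by (intro hsum_zero) auto
  finally show ?thesis using assms(3) by (auto simp: in_Hom)
qed

end

section \<open>Biproducts\<close>

context linear_category
begin

lemma biproductD:
  assumes "biproduct C I x z \<iota> \<pi>"
  shows "finite I" "z \<in> Obj C"
    "i \<in> I \<Longrightarrow> x i \<in> Obj C"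
    "i \<in> I \<Longrightarrow> \<iota> i \<in> Arr C" "i \<in> I \<Longrightarrow> Dom C (\<iota> i) = x i" "i \<in> I \<Longrightarrow> Cod C (\<iota> i) = z"
    "i \<in> I \<Longrightarrow> \<pi> i \<in> Arr C" "i \<in> I \<Longrightarrow> Dom C (\<pi> i) = z" "i \<in> I \<Longrightarrow> Cod C (\<pi> i) = x i"
    "i \<in> I \<Longrightarrow> \<pi> i \<cdot> \<iota> i = Ident C (x i)"
    "\<lbrakk>i \<in> I; j \<in> I; i \<noteq> j\<rbrakk> \<Longrightarrow> \<pi> j \<cdot> \<iota> i = Zero C (x i) (x j)"
    "hsum z z (\<lambda>i. \<iota> i \<cdot> \<pi> i) I = Ident C z"
  using assms by (auto simp: biproduct_def in_Hom)

lemma biproduct_comp: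
  assumes b: "biproduct C I x z \<iota> \<pi>" and k: "k \<in> Arr C" "Cod C k = x i" "i \<in> I"
  shows "\<pi> i \<cdot> (\<iota> i \<cdot> k) = k" and "\<lbrakk>j \<in> I; i \<noteq> j\<rbrakk> \<Longrightarrow> \<pi> j \<cdot> (\<iota> i \<cdot> k) = Zero C (Dom C k) (x j)"
  using assoc_simp[of k "\<iota> i" "\<pi> i"] assoc_simp[of k "\<iota> i" "\<pi> j"] biproductD[OF b] k by auto

lemmas biproduct_simps = biproductD biproduct_comp

lemma biproduct_expand_in:
  assumes b: "biproduct C I x z \<iota> \<pi>" and f: "f \<in> Arr C" "Cod C f = z"
  shows "hsum (Dom C f) z (\<lambda>i. \<iota> i \<cdot> (\<pi> i \<cdot> f)) I = f"
proof -
  note [simp] = biproduct_simps[OF b]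
  have "f = hsum (Cod C f) z (\<lambda>i. \<iota> i \<cdot> \<pi> i) I \<cdot> f" using f by simp
  also have "\<dots> = hsum (Dom C f) z (\<lambda>i. (\<iota> i \<cdot> \<pi> i) \<cdot> f) I"
    using f by (intro comp_hsum_right) (auto simp: in_Hom)
  also have "\<dots> = hsum (Dom C f) z (\<lambda>i. \<iota> i \<cdot> (\<pi> i \<cdot> f)) I"
    using f by (intro hsum_cong) (auto simp: in_Hom)
  finally show ?thesis ..
qed

lemma biproduct_expand_out:
  assumes b: "biproduct C I x z \<iota> \<pi>" and f: "f \<in> Arr C" "Dom C f = z"
  shows "hsum z (Cod C f) (\<lambda>i. f \<cdot> (\<iota> i \<cdot> \<pi> i)) I = f"
proof -
  note [simp] = biproduct_simps[OF b]
  have "f = f \<cdot> hsum z (Dom C f) (\<lambda>i. \<iota> i \<cdot> \<pi> i) I" using f by simp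
  also have "\<dots> = hsum z (Cod C f) (\<lambda>i. f \<cdot> (\<iota> i \<cdot> \<pi> i)) I"
    using f by (intro comp_hsum_left) (auto simp: in_Hom)
  finally show ?thesis ..
qed

lemma biproduct_jointly_monic:
  assumes b: "biproduct C I x z \<iota> \<pi>" and f: "f \<in> Hom C w z" "g \<in> Hom C w z"
    and e: "\<And>i. i \<in> I \<Longrightarrow> \<pi> i \<cdot> f = \<pi> i \<cdot> g"
  shows "f = g"
proof -
  note [simp] = biproduct_simps[OF b]
  have w: "w \<in> Obj C" using f by (auto simp: in_Hom)
  have "f = hsum w z (\<lambda>i. \<iota> i \<cdot> (\<pi> i \<cdot> f)) I"
    using biproduct_expand_in[OF b, of f] f by (auto simp: in_Hom)
  also have "\<dots> = hsum w z (\<lambda>i. \<iota> i \<cdot> (\<pi> i \<cdot> g)) I"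
    using f w by (intro hsum_cong) (auto simp: in_Hom e)
  also have "\<dots> = g"
    using biproduct_expand_in[OF b, of g] f by (auto simp: in_Hom)
  finally show ?thesis .
qed

lemma biproduct_jointly_epic:
  assumes b: "biproduct C I x z \<iota> \<pi>" and f: "f \<in> Hom C z w" "g \<in> Hom C z w"
    and e: "\<And>i. i \<in> I \<Longrightarrow> f \<cdot> \<iota> i = g \<cdot> \<iota> i"
  shows "f = g"
proof -
  note [simp] = biproduct_simps[OF b]
  have w: "w \<in> Obj C" using f by (auto simp: in_Hom)
  have e': "f \<cdot> (\<iota> i \<cdot> \<pi> i) = g \<cdot> (\<iota> i \<cdot> \<pi> i)" if "i \<in> I" for i
    using comp_eq_extend[OF e[OF that], of "\<pi> i"] that f assoc_simp[of "\<pi> i" "\<iota> i" g]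
    by (auto simp: in_Hom)
  have "f = hsum z w (\<lambda>i. f \<cdot> (\<iota> i \<cdot> \<pi> i)) I"
    using biproduct_expand_out[OF b, of f] f by (auto simp: in_Hom)
  also have "\<dots> = hsum z w (\<lambda>i. g \<cdot> (\<iota> i \<cdot> \<pi> i)) I"
    using f w by (intro hsum_cong) (auto simp: in_Hom e')
  also have "\<dots> = g"
    using biproduct_expand_out[OF b, of g] f by (auto simp: in_Hom)
  finally show ?thesis .
qed

text \<open>Joint monicity replaces the equation that decomposes the identity: composed with one projection,
  the sum of all \<open>\<iota> i \<cdot> \<pi> i\<close> has a single non-zero term. For iterated and transported biproducts this is
  easier to check than a sum.\<close>

lemma biproductI:
  assumes "finite I" "z \<in> Obj C"
    and ty: "\<And>i. i \<in> I \<Longrightarrow> \<iota> i \<in> Hom C (x i) z" "\<And>i. i \<in> I \<Longrightarrow> \<pi> i \<in> Hom C z (x i)"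
    and ortho: "\<And>i j. \<lbrakk>i \<in> I; j \<in> I\<rbrakk> \<Longrightarrow> \<pi> j \<cdot> \<iota> i = (if i = j then Ident C (x i) else Zero C (x i) (x j))"
    and monic: "\<And>f g. \<lbrakk>f \<in> Hom C z z; g \<in> Hom C z z; \<And>i. i \<in> I \<Longrightarrow> \<pi> i \<cdot> f = \<pi> i \<cdot> g\<rbrakk> \<Longrightarrow> f = g"
  shows "biproduct C I x z \<iota> \<pi>"
proof -
  have [simp]: "\<iota> i \<in> Arr C" "Dom C (\<iota> i) = x i" "Cod C (\<iota> i) = z"
    "\<pi> i \<in> Arr C" "Dom C (\<pi> i) = z" "Cod C (\<pi> i) = x i" "x i \<in> Obj C" if "i \<in> I" for i
    using ty[OF that] Hom_objs[OF ty(1)[OF that]] by (simp_all add: in_Hom)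
  let ?S = "hsum z z (\<lambda>i. \<iota> i \<cdot> \<pi> i) I"
  have "?S = Ident C z"
  proof (rule monic)
    fix j assume j: "j \<in> I"
    have e: "\<pi> j \<cdot> (\<iota> i \<cdot> \<pi> i) = (if i = j then \<pi> i else Zero C z (x j))" if "i \<in> I" for i
      using that j ortho[OF that j] assoc_simp[of "\<pi> i" "\<iota> i" "\<pi> j"] assms(2) by auto
    have "\<pi> j \<cdot> ?S = hsum z (x j) (\<lambda>i. \<pi> j \<cdot> (\<iota> i \<cdot> \<pi> i)) I"
      using comp_hsum_left[of I z "\<pi> j" "\<lambda>i. \<iota> i \<cdot> \<pi> i"] j assms(1,2) by (auto simp: in_Hom)
    also have "\<dots> = \<pi> j \<cdot> (\<iota> j \<cdot> \<pi> j)"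
      using j assms(1,2) by (intro hsum_single) (auto simp: in_Hom e)
    finally show "\<pi> j \<cdot> ?S = \<pi> j \<cdot> Ident C z" using j by (simp add: e)
  qed (use assms(1,2) in \<open>auto simp: in_Hom\<close>)
  then show ?thesis using assms(1,2) ty ortho by (auto simp: biproduct_def)
qed

lemma biproduct_iso_target:
  assumes b: "biproduct C I x z \<iota> \<pi>" and u: "u \<in> Hom C z z'" "is_iso C u"
  shows "biproduct C I x z' (\<lambda>i. u \<cdot> \<iota> i) (\<lambda>i. \<pi> i \<cdot> inv_arr C u)"
proof (rule biproductI)
  note [simp] = biproduct_simps[OF b] u(2)
  have [simp]: "Dom C u = z" "Cod C u = z'" using u by (auto simp: in_Hom)
  show "z' \<in> Obj C" using u(1) Hom_objs by blast
  show "(\<pi> j \<cdot> inv_arr C u) \<cdot> (u \<cdot> \<iota> i) = (if i = j then Ident C (x i) else Zero C (x i) (x j))"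
    if "i \<in> I" "j \<in> I" for i j using that by simp
  fix f g assume fg: "f \<in> Hom C z' z'" "g \<in> Hom C z' z'"
    and e: "\<And>i. i \<in> I \<Longrightarrow> (\<pi> i \<cdot> inv_arr C u) \<cdot> f = (\<pi> i \<cdot> inv_arr C u) \<cdot> g"
  have "inv_arr C u \<cdot> f = inv_arr C u \<cdot> g"
    by (rule biproduct_jointly_monic[OF b, where w = z']) (use fg e in \<open>auto simp: in_Hom\<close>)
  then show "f = g" using fg by (subst (asm) iso_cancel_left) (auto simp: in_Hom)
qed (use biproductD[OF b] u in \<open>auto simp: in_Hom\<close>)

lemma biproduct_iso_summands:
  assumes b: "biproduct C I x z \<iota> \<pi>" and v: "\<And>i. i \<in> I \<Longrightarrow> isomorphic C (x i) (x' i)"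
  shows "\<exists>\<iota> \<pi>. biproduct C I x' z \<iota> \<pi>"
proof -
  note [simp] = biproduct_simps[OF b]
  obtain v where v: "\<And>i. i \<in> I \<Longrightarrow> v i \<in> Hom C (x i) (x' i) \<and> is_iso C (v i)"
    using v unfolding isomorphic_def by metis
  have [simp]: "Dom C (v i) = x i" "Cod C (v i) = x' i" "is_iso C (v i)" "v i \<in> Arr C" if "i \<in> I" for i
    using v[OF that] by (auto simp: in_Hom)
  have [simp]: "x' i \<in> Obj C" if "i \<in> I" for i
    using v[OF that] Hom_objs by blast
  have "biproduct C I x' z (\<lambda>i. \<iota> i \<cdot> inv_arr C (v i)) (\<lambda>i. v i \<cdot> \<pi> i)"
  proof (rule biproductI)
    show "(v j \<cdot> \<pi> j) \<cdot> (\<iota> i \<cdot> inv_arr C (v i)) = (if i = j then Ident C (x' i) else Zero C (x' i) (x' j))"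
      if "i \<in> I" "j \<in> I" for i j
      using that by (cases "i = j") auto
    fix f g assume fg: "f \<in> Hom C z z" "g \<in> Hom C z z"
      and e: "\<And>i. i \<in> I \<Longrightarrow> (v i \<cdot> \<pi> i) \<cdot> f = (v i \<cdot> \<pi> i) \<cdot> g"
    show "f = g"
    proof (rule biproduct_jointly_monic[OF b fg])
      fix i assume i: "i \<in> I"
      show "\<pi> i \<cdot> f = \<pi> i \<cdot> g"
        using e[OF i] i fg iso_cancel_left[of "v i" "\<pi> i \<cdot> f" "\<pi> i \<cdot> g"] by (auto simp: in_Hom)
    qed
  qed (auto simp: in_Hom)
  then show ?thesis by blast
qed

lemma biproduct_reindex:
  assumes b: "biproduct C I x z \<iota> \<pi>" and h: "bij_betw h J I"
  shows "biproduct C J (\<lambda>j. x (h j)) z (\<lambda>j. \<iota> (h j)) (\<lambda>j. \<pi> (h j))"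
proof (rule biproductI)
  note [simp] = biproduct_simps[OF b]
  have [simp]: "h j \<in> I" if "j \<in> J" for j using h that by (auto simp: bij_betw_def)
  show "finite J" using h biproductD(1)[OF b] bij_betw_finite by blast
  show "z \<in> Obj C" by simp
  show "\<pi> (h j) \<cdot> \<iota> (h i) = (if i = j then Ident C (x (h i)) else Zero C (x (h i)) (x (h j)))"
    if "i \<in> J" "j \<in> J" for i j
  proof (cases "i = j")
    case False
    then have "h i \<noteq> h j" using h that by (auto simp: bij_betw_def inj_on_def)
    then show ?thesis using that False by simp
  qed (use that in simp)
  fix f g assume fg: "f \<in> Hom C z z" "g \<in> Hom C z z"
    and e: "\<And>j. j \<in> J \<Longrightarrow> \<pi> (h j) \<cdot> f = \<pi> (h j) \<cdot> g"
  show "f = g"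
  proof (rule biproduct_jointly_monic[OF b fg])
    fix i assume "i \<in> I"
    then show "\<pi> i \<cdot> f = \<pi> i \<cdot> g" using e h by (auto simp: bij_betw_def)
  qed
qed (use h biproductD[OF b] in \<open>auto simp: in_Hom bij_betw_def\<close>)

lemma biproduct_Sigma:
  assumes b: "biproduct C I x z \<iota> \<pi>"
    and c: "\<And>i. i \<in> I \<Longrightarrow> biproduct C (J i) (y i) (x i) (\<kappa> i) (\<rho> i)"
  shows "biproduct C (Sigma I J) (\<lambda>(i, j). y i j) z (\<lambda>(i, j). \<iota> i \<cdot> \<kappa> i j) (\<lambda>(i, j). \<rho> i j \<cdot> \<pi> i)"
proof (rule biproductI)
  note [simp] = biproduct_simps[OF b] biproduct_simps[OF c]
  show "finite (Sigma I J)" "z \<in> Obj C" by auto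
  show "(case p of (i, j) \<Rightarrow> \<iota> i \<cdot> \<kappa> i j) \<in> Hom C (case p of (i, j) \<Rightarrow> y i j) z" if "p \<in> Sigma I J" for p
    using that by (auto simp: in_Hom)
  show "(case p of (i, j) \<Rightarrow> \<rho> i j \<cdot> \<pi> i) \<in> Hom C z (case p of (i, j) \<Rightarrow> y i j)" if "p \<in> Sigma I J" for p
    using that by (auto simp: in_Hom)
  show "(case q of (i, j) \<Rightarrow> \<rho> i j \<cdot> \<pi> i) \<cdot> (case p of (i, j) \<Rightarrow> \<iota> i \<cdot> \<kappa> i j) =
      (if p = q then Ident C (case p of (i, j) \<Rightarrow> y i j)
       else Zero C (case p of (i, j) \<Rightarrow> y i j) (case q of (i, j) \<Rightarrow> y i j))"
    if pq: "p \<in> Sigma I J" "q \<in> Sigma I J" for p q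
  proof -
    obtain i j k l where [simp]: "p = (i, j)" "q = (k, l)" by (cases p, cases q)
    have "(\<rho> k l \<cdot> \<pi> k) \<cdot> (\<iota> i \<cdot> \<kappa> i j) = (if p = q then Ident C (y i j) else Zero C (y i j) (y k l))"
      using pq by (cases "i = k"; cases "j = l") auto
    then show ?thesis by simp
  qed
  fix f g assume fg: "f \<in> Hom C z z" "g \<in> Hom C z z"
    and e: "\<And>p. p \<in> Sigma I J \<Longrightarrow> (case p of (i, j) \<Rightarrow> \<rho> i j \<cdot> \<pi> i) \<cdot> f = (case p of (i, j) \<Rightarrow> \<rho> i j \<cdot> \<pi> i) \<cdot> g"
  show "f = g"
  proof (rule biproduct_jointly_monic[OF b fg])
    fix i assume i: "i \<in> I"
    show "\<pi> i \<cdot> f = \<pi> i \<cdot> g"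
    proof (rule biproduct_jointly_monic[OF c[OF i], where w = z])
      fix j assume "j \<in> J i"
      then show "\<rho> i j \<cdot> (\<pi> i \<cdot> f) = \<rho> i j \<cdot> (\<pi> i \<cdot> g)"
        using e[of "(i, j)"] i fg by (auto simp: in_Hom)
    qed (use i fg in \<open>auto simp: in_Hom\<close>)
  qed
qed

lemma direct_sum_iff_biproduct:
  "direct_sum C xs z \<longleftrightarrow> (\<exists>\<iota> \<pi>. biproduct C {..<length xs} ((!) xs) z \<iota> \<pi>)"
proof -
  have "set xs \<subseteq> Obj C \<longleftrightarrow> (\<forall>i < length xs. xs ! i \<in> Obj C)" by (auto simp: set_conv_nth)
  then show ?thesis
    unfolding direct_sum_def biproduct_def Ball_def lessThan_iff by (simp add: all_conj_distrib imp_conjR) blast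
qed

lemma biproduct_single:
  assumes "x \<in> Obj C"
  shows "biproduct C {i} (\<lambda>_. x) x (\<lambda>_. Ident C x) (\<lambda>_. Ident C x)"
  by (rule biproductI) (use assms in \<open>auto simp: in_Hom\<close>)

lemma biproduct_unique_summand_iso:
  assumes b: "biproduct C {i} x z \<iota> \<pi>"
  shows "isomorphic C (x i) z"
proof -
  note [simp] = biproduct_simps[OF b]
  have "hsum z z (\<lambda>i. \<iota> i \<cdot> \<pi> i) {i} = \<iota> i \<cdot> \<pi> i"
    by (rule hsum_single) (auto simp: in_Hom)
  then have "\<iota> i \<cdot> \<pi> i = Ident C z" by simp
  then show ?thesis
    by (intro isomorphicI[of "\<iota> i"] isoI(1)[of "\<iota> i" "x i" z "\<pi> i"]) (auto simp: in_Hom)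
qed

subsection \<open>Zero objects and thin hom spaces\<close>

lemma zero_object_from:
  assumes "zero_object C x" "f \<in> Arr C"
  shows "Dom C f = x \<Longrightarrow> f = Zero C x (Cod C f)" and "Cod C f = x \<Longrightarrow> f = Zero C (Dom C f) x"
proof -
  have z: "x \<in> Obj C" "Ident C x = Zero C x x" using assms by (auto simp: zero_object_def)
  show "f = Zero C x (Cod C f)" if "Dom C f = x"
    using that ident_right_simp[of f x] z comp_zero(1)[of f x x] assms(2) by auto
  show "f = Zero C (Dom C f) x" if "Cod C f = x"
    using that ident_left_simp[of f x] z comp_zero(2)[of f x x] assms(2) by auto
qed

lemma zero_object_iso:
  assumes "isomorphic C x y" "zero_object C x"
  shows "zero_object C y"
proof -
  obtain f where f: "f \<in> Hom C x y" "is_iso C f" using assms(1) by (auto simp: isomorphic_def)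
  have [simp]: "Dom C f = x" "Cod C f = y" "y \<in> Obj C" "x \<in> Obj C" using f by (auto simp: in_Hom)
  have "f = Zero C x y" using zero_object_from(1)[OF assms(2), of f] f by simp
  then have "f \<cdot> inv_arr C f = Zero C y y" using f by (metis \<open>Cod C f = y\<close> \<open>Dom C f = x\<close> \<open>y \<in> Obj C\<close> comp_zero(2) inv_simps(1-3))
  then show ?thesis using f by (simp add: zero_object_def)
qed

text \<open>A hom space of dimension at most one. The condition speaks about pairs of vectors, so it pulls
  back along every injective linear map.\<close>

definition thin :: "'o \<Rightarrow> 'o \<Rightarrow> bool" where
  "thin x y \<longleftrightarrow> (\<forall>f \<in> Hom C x y. \<forall>g \<in> Hom C x y. \<exists>a b. (a \<noteq> 0 \<or> b \<noteq> 0) \<and>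
     Add C (Scale C a f) (Scale C b g) = Zero C x y)"

lemma thin_transfer:
  assumes t: "thin x' y'" and o: "x' \<in> Obj C" "y' \<in> Obj C"
    and o': "x \<in> Obj C" "y \<in> Obj C"
    and T: "\<And>f. f \<in> Hom C x y \<Longrightarrow> T f \<in> Hom C x' y'"
    and add: "\<And>f g. \<lbrakk>f \<in> Hom C x y; g \<in> Hom C x y\<rbrakk> \<Longrightarrow> T (Add C f g) = Add C (T f) (T g)"
    and scale: "\<And>a f. f \<in> Hom C x y \<Longrightarrow> T (Scale C a f) = Scale C a (T f)"
    and inj: "\<And>f. \<lbrakk>f \<in> Hom C x y; T f = Zero C x' y'\<rbrakk> \<Longrightarrow> f = Zero C x y"
  shows "thin x y"
  unfolding thin_def
proof (intro ballI)
  fix f g assume fg: "f \<in> Hom C x y" "g \<in> Hom C x y"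
  obtain a b where ab: "a \<noteq> 0 \<or> b \<noteq> 0" "Add C (Scale C a (T f)) (Scale C b (T g)) = Zero C x' y'"
    using t T fg unfolding thin_def by meson
  have h: "Scale C a f \<in> Hom C x y" "Scale C b g \<in> Hom C x y"
    "Add C (Scale C a f) (Scale C b g) \<in> Hom C x y" using fg by (auto simp: in_Hom)
  have "T (Add C (Scale C a f) (Scale C b g)) = Zero C x' y'"
    using ab(2) fg h by (simp add: add scale)
  then show "\<exists>a b. (a \<noteq> 0 \<or> b \<noteq> 0) \<and> Add C (Scale C a f) (Scale C b g) = Zero C x y"
    using inj h(3) ab(1) by blast
qed

lemma thinI_scalar:
  assumes "\<And>f g. \<lbrakk>f \<in> Hom C x y; g \<in> Hom C x y; f \<noteq> Zero C x y\<rbrakk> \<Longrightarrow> \<exists>a. g = Scale C a f"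
  shows "thin x y"
  unfolding thin_def
proof (intro ballI)
  fix f g assume fg: "f \<in> Hom C x y" "g \<in> Hom C x y"
  have o: "x \<in> Obj C" "y \<in> Obj C" using fg by (auto simp: in_Hom)
  show "\<exists>a b. (a \<noteq> 0 \<or> b \<noteq> 0) \<and> Add C (Scale C a f) (Scale C b g) = Zero C x y"
  proof (cases "f = Zero C x y")
    case True
    then show ?thesis using fg o by (intro exI[of _ 1] exI[of _ 0]) (auto simp: in_Hom)
  next
    case False
    then obtain a where a: "g = Scale C a f" using assms fg by blast
    then have "Add C (Scale C a f) (Scale C (- 1) g) = Zero C x y"
      using diff_zero_iff[of "Scale C a f" g] fg by (auto simp: in_Hom)
    then show ?thesis by (intro exI[of _ a] exI[of _ "-1"]) auto
  qed
qed

end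

section \<open>Simple objects\<close>

context abelian_category
begin

text \<open>The kernel of \<open>f\<close> is a monomorphism into \<open>x\<close>. It is not an isomorphism because \<open>f\<close> is not zero, so
  its domain is zero and \<open>f\<close> is a monomorphism into the simple object \<open>y\<close>.\<close>

lemma schur_iso:
  assumes x: "simple_object C x" and y: "simple_object C y"
    and f: "f \<in> Hom C x y" "f \<noteq> Zero C x y"
  shows "is_iso C f"
proof -
  have fs [simp]: "f \<in> Arr C" "Dom C f = x" "Cod C f = y" "x \<in> Obj C" "y \<in> Obj C"
    using f x y by (auto simp: in_Hom simple_object_def)
  obtain i where i: "is_kernel C f i" using kernels fs(1) by blast
  have [simp]: "i \<in> Arr C" "Cod C i = x" and fi: "f \<cdot> i = Zero C (Dom C i) y"
    using i by (auto simp: is_kernel_def)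
  have un: "\<exists>!h. h \<in> Hom C w (Dom C i) \<and> i \<cdot> h = g"
    if "g \<in> Hom C w x" "f \<cdot> g = Zero C w y" for w g
    using i that by (auto simp: is_kernel_def)
  have mono_i: "is_mono C i"
    unfolding is_mono_def
  proof (intro conjI allI ballI impI)
    fix w g h assume gh: "g \<in> Hom C w (Dom C i)" "h \<in> Hom C w (Dom C i)" "i \<cdot> g = i \<cdot> h"
    have "f \<cdot> (i \<cdot> g) = Zero C w y"
      using gh comp_eq_extend[OF fi, of g] by (auto simp: in_Hom)
    moreover have "i \<cdot> g \<in> Hom C w x" using gh by (auto simp: in_Hom)
    ultimately show "g = h" using un[of "i \<cdot> g" w] gh by metis
  qed simp
  have not_iso: "\<not> is_iso C i"
  proof
    assume iso: "is_iso C i"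
    have "f = (f \<cdot> i) \<cdot> inv_arr C i" using iso by simp
    also have "\<dots> = Zero C x y" unfolding fi using iso by simp
    finally show False using f(2) by simp
  qed
  then have z: "zero_object C (Dom C i)"
    using x mono_i by (auto simp: simple_object_def)
  have "is_mono C f"
    unfolding is_mono_def
  proof (intro conjI allI ballI impI)
    fix w g h assume gh: "g \<in> Hom C w (Dom C f)" "h \<in> Hom C w (Dom C f)" "f \<cdot> g = f \<cdot> h"
    have [simp]: "g \<in> Arr C" "h \<in> Arr C" "Dom C g = w" "Cod C g = x" "Dom C h = w" "Cod C h = x" "w \<in> Obj C"
      using gh Hom_objs by (auto simp: in_Hom)
    let ?d = "Add C g (Scale C (- 1) h)"
    have "f \<cdot> ?d = Add C (f \<cdot> g) (Scale C (- 1) (f \<cdot> h))" by (simp add: comp_add)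
    also have "\<dots> = Zero C w y" using diff_zero_iff[of "f \<cdot> g" "f \<cdot> h"] gh(3) by simp
    finally obtain k where k: "k \<in> Hom C w (Dom C i)" "i \<cdot> k = ?d"
      using un[of ?d w] by (auto simp: in_Hom)
    have "k = Zero C w (Dom C i)" using zero_object_from(2)[OF z, of k] k by (auto simp: in_Hom)
    then have "?d = Zero C w x" using k(2) by simp
    then show "g = h" using diff_zero_iff[of g h] by simp
  qed simp
  then show ?thesis using x y by (auto simp: simple_object_def)
qed

lemma simple_iso_invariant:
  assumes "isomorphic C x y" "simple_object C x"
  shows "simple_object C y"
proof -
  obtain u where u: "u \<in> Hom C x y" "is_iso C u" using assms(1) by (auto simp: isomorphic_def)
  have us [simp]: "u \<in> Arr C" "Dom C u = x" "Cod C u = y" using u by (auto simp: in_Hom)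
  have xy [simp]: "x \<in> Obj C" "y \<in> Obj C" using isomorphic_objs[OF assms(1)] by auto
  show ?thesis
    unfolding simple_object_def
  proof (intro conjI allI impI)
    show "\<not> zero_object C y"
      using assms zero_object_iso isomorphic_sym by (auto simp: simple_object_def)
    fix f assume f: "is_mono C f \<and> Cod C f = y"
    then have fa [simp]: "f \<in> Arr C" "Cod C f = y" by (auto simp: is_mono_def)
    let ?g = "inv_arr C u \<cdot> f"
    have "is_mono C ?g"
      unfolding is_mono_def
    proof (intro conjI allI ballI impI)
      fix w g h assume gh: "g \<in> Hom C w (Dom C ?g)" "h \<in> Hom C w (Dom C ?g)" "?g \<cdot> g = ?g \<cdot> h"
      have gh' [simp]: "g \<in> Arr C" "h \<in> Arr C" "Dom C g = w" "Dom C h = w" "Cod C g = Dom C f" "Cod C h = Dom C f"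
        using gh u(2) by (auto simp: in_Hom)
      have "f \<cdot> g = f \<cdot> h"
        using gh(3) u(2) iso_cancel_left[of "inv_arr C u" "f \<cdot> g" "f \<cdot> h"] by simp
      then show "g = h" using f gh u(2) unfolding is_mono_def by auto
    qed (use u(2) in simp)
    then have "zero_object C (Dom C ?g) \<or> is_iso C ?g"
      using assms(2) u(2) by (auto simp: simple_object_def)
    moreover have "is_iso C f" if "is_iso C ?g"
    proof -
      have "f = u \<cdot> ?g" using u(2) by simp
      then show ?thesis using that u(2) iso_comp[of ?g u] by auto
    qed
    ultimately show "zero_object C (Dom C f) \<or> is_iso C f" using u(2) by auto
  qed (simp)
qed

lemma simple_obj [simp]: "simple_object C x \<Longrightarrow> x \<in> Obj C"
  by (simp add: simple_object_def)

lemma simple_ident_nonzero: "simple_object C x \<Longrightarrow> Ident C x \<noteq> Zero C x x"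
  unfolding simple_object_def zero_object_def by blast

lemma iso_nonzero:
  assumes "is_iso C f" "simple_object C (Dom C f)"
  shows "f \<noteq> Zero C (Dom C f) (Cod C f)"
proof
  assume "f = Zero C (Dom C f) (Cod C f)"
  then have "inv_arr C f \<cdot> f = Zero C (Dom C f) (Dom C f)"
    using assms(1) by (metis comp_zero(1) dom_in_Obj inv_simps(1-3) iso_arr)
  then show False using simple_ident_nonzero[OF assms(2)] assms(1) by simp
qed

end

context fusion_category
begin

text \<open>The value of a polynomial at an endomorphism, by the Horner scheme.\<close>

definition eval_end :: "'o \<Rightarrow> 'm \<Rightarrow> 'k poly \<Rightarrow> 'm" where
  "eval_end x f p = fold_coeffs (\<lambda>a g. Add C (Scale C a (Ident C x)) (f \<cdot> g)) p (Zero C x x)"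

lemma eval_end_zero [simp]: "eval_end x f 0 = Zero C x x"
  by (simp add: eval_end_def)

lemma eval_end_pCons:
  assumes "f \<in> Hom C x x"
  shows "eval_end x f (pCons a p) = Add C (Scale C a (Ident C x)) (f \<cdot> eval_end x f p)"
proof (cases "a = 0 \<and> p = 0")
  case True
  then show ?thesis using assms Hom_objs[OF assms] by (auto simp: in_Hom)
next
  case False
  then show ?thesis by (auto simp: eval_end_def fold_coeffs_pCons_not_0_0_eq fold_coeffs_pCons_coeff_not_0_eq)
qed

lemma eval_end_simps [simp]:
  assumes "f \<in> Hom C x x"
  shows "eval_end x f p \<in> Arr C" "Dom C (eval_end x f p) = x" "Cod C (eval_end x f p) = x"
  using Hom_objs[OF assms] assms
  by (induction p) (auto simp: eval_end_pCons in_Hom)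

lemma eval_end_add:
  assumes "f \<in> Hom C x x"
  shows "eval_end x f (p + q) = Add C (eval_end x f p) (eval_end x f q)"
proof (induction p arbitrary: q)
  case 0
  then show ?case using assms Hom_objs[OF assms] by simp
next
  case (pCons a p)
  have [simp]: "x \<in> Obj C" "f \<in> Arr C" "Dom C f = x" "Cod C f = x"
    using assms Hom_objs[OF assms] by (auto simp: in_Hom)
  obtain b q' where q: "q = pCons b q'" by (cases q) auto
  let ?i = "Ident C x" and ?P = "f \<cdot> eval_end x f p" and ?Q = "f \<cdot> eval_end x f q'"
  have "eval_end x f (pCons a p + q) = Add C (Add C (Scale C a ?i) (Scale C b ?i)) (Add C ?P ?Q)"
    using assms by (simp add: q eval_end_pCons pCons.IH comp_add scale_add_left)
  also have "\<dots> = Add C (Add C (Scale C a ?i) ?P) (Add C (Scale C b ?i) ?Q)"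
  proof -
    have "Add C (Scale C b ?i) (Add C ?P ?Q) = Add C ?P (Add C (Scale C b ?i) ?Q)"
      using assms add_assoc[of "Scale C b ?i" ?P ?Q] add_assoc[of ?P "Scale C b ?i" ?Q]
        add_comm[of "Scale C b ?i" ?P] by simp
    then show ?thesis using assms by (simp add: add_assoc)
  qed
  finally show ?case using assms by (simp add: q eval_end_pCons)
qed

lemma eval_end_smult:
  assumes "f \<in> Hom C x x"
  shows "eval_end x f (Polynomial.smult c p) = Scale C c (eval_end x f p)"
proof -
  have [simp]: "x \<in> Obj C" "f \<in> Arr C" "Dom C f = x" "Cod C f = x"
    using assms Hom_objs[OF assms] by (auto simp: in_Hom)
  show ?thesis using assms by (induction p) (auto simp: eval_end_pCons scale_add_right)
qed

lemma eval_end_linear_factor: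
  assumes "f \<in> Hom C x x"
  shows "eval_end x f ([:- a, 1:] * p) = Add C f (Scale C (- a) (Ident C x)) \<cdot> eval_end x f p"
proof -
  have [simp]: "x \<in> Obj C" "f \<in> Arr C" "Dom C f = x" "Cod C f = x"
    using assms Hom_objs[OF assms] by (auto simp: in_Hom)
  have "[:- a, 1:] * p = pCons 0 p + Polynomial.smult (- a) p" by simp
  then have "eval_end x f ([:- a, 1:] * p) = Add C (f \<cdot> eval_end x f p) (Scale C (- a) (eval_end x f p))"
    using assms by (simp only: eval_end_add eval_end_smult eval_end_pCons) simp
  then show ?thesis using assms by (simp add: comp_add)
qed

lemma eval_end_sum:
  assumes "f \<in> Hom C x x" "finite J"
  shows "eval_end x f (\<Sum>j\<in>J. p j) = hsum x x (\<lambda>j. eval_end x f (p j)) J"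
  using assms(2)
proof (induction J)
  case empty
  then show ?case using assms Hom_objs[OF assms(1)] by simp
next
  case (insert j J)
  then show ?case
    using assms Hom_objs[OF assms(1)] by (subst hsum_insert) (auto simp: eval_end_add in_Hom)
qed

text \<open>There are more powers of \<open>f\<close> than the dimension of the endomorphism space allows to be independent:
  either two of them coincide, or they satisfy a linear relation.\<close>

lemma annihilating_polynomial:
  assumes f: "f \<in> Hom C x x"
  shows "\<exists>p. p \<noteq> 0 \<and> eval_end x f p = Zero C x x"
proof -
  have xo: "x \<in> Obj C" using f Hom_objs by blast
  interpret V: vectorspace class_ring "hom_space C x x" using hom_vectorspace xo by blast
  have fd: "V.fin_dim" using hom_fin_dim xo by blast
  define e where "e n = eval_end x f (monom 1 n)" for n
  have e_car: "e n \<in> Hom C x x" for n using f by (auto simp: e_def in_Hom)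
  show ?thesis
  proof (cases "inj_on e {..V.dim}")
    case False
    then obtain i j where ij: "i \<noteq> j" "e i = e j" by (auto simp: inj_on_def)
    let ?p = "monom 1 i + Polynomial.smult (- 1) (monom 1 j) :: 'k poly"
    have "coeff ?p i = 1" using ij by simp
    then have "?p \<noteq> 0" by (metis coeff_0 zero_neq_one)
    moreover have "eval_end x f ?p = Zero C x x"
      using diff_zero_iff[of "e i" "e j"] e_car[of i] e_car[of j] f ij
      by (simp only: eval_end_add eval_end_smult) (simp add: e_def in_Hom)
    ultimately show ?thesis by blast
  next
    case inj: True
    have "\<not> V.lin_indpt (e ` {..V.dim})"
    proof
      assume "V.lin_indpt (e ` {..V.dim})"
      then have "card (e ` {..V.dim}) \<le> V.dim"
        using V.li_le_dim(2)[OF fd, of "e ` {..V.dim}"] e_car by (simp add: image_subset_iff)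
      then show False using card_image[OF inj] by simp
    qed
    then obtain A a v where A: "finite A" "A \<subseteq> e ` {..V.dim}" "V.lincomb a A = Zero C x x" "v \<in> A" "a v \<noteq> 0"
      unfolding V.lin_dep_def by auto
    obtain J where J: "J \<subseteq> {..V.dim}" "A = e ` J" using A(2) by (meson subset_imageE)
    have injJ: "inj_on e J" using inj J(1) inj_on_subset by blast
    have finJ: "finite J" using J(1) finite_subset by blast
    let ?p = "\<Sum>j\<in>J. Polynomial.smult (a (e j)) (monom 1 j)"
    have car: "a (e j) \<odot>\<^bsub>hom_space C x x\<^esub> e j \<in> Hom C x x" for j
      using e_car[of j] by (auto simp: in_Hom)
    have "V.lincomb a A = finsum (hom_space C x x) (\<lambda>w. Scale C (a w) w) (e ` J)"
      unfolding V.lincomb_def J(2) by simp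
    also have "\<dots> = hsum x x (\<lambda>j. Scale C (a (e j)) (e j)) J"
    proof (subst V.M.finsum_reindex)
      show "(\<lambda>w. Scale C (a w) w) \<in> e ` J \<rightarrow> carrier (hom_space C x x)" using car by auto
    qed (use injJ in auto)
    also have "\<dots> = eval_end x f ?p"
      using f finJ by (simp add: eval_end_sum eval_end_smult e_def del: smult_monom)
    finally have z: "eval_end x f ?p = Zero C x x" using A(3) by simp
    obtain j where j: "j \<in> J" "v = e j" using A(4) J(2) by blast
    have "coeff ?p j = a (e j)"
      using finJ j(1) by (simp add: coeff_sum if_distrib[of "\<lambda>u. _ * u"] sum.delta cong: if_cong)
    then have "?p \<noteq> 0" using A(5) j(2) by (metis coeff_0)
    then show ?thesis using z by blast
  qed
qed

text \<open>If \<open>f\<close> is not a scalar, then every \<open>f - a\<close> is an isomorphism. The linear factors of an annihilating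
  polynomial can therefore be cancelled one at a time, until a non-zero multiple of the
  identity would have to vanish.\<close>

lemma schur_scalar:
  assumes x: "simple_object C x" and f: "f \<in> Hom C x x"
  shows "\<exists>a. f = Scale C a (Ident C x)"
proof (rule ccontr)
  assume na: "\<not> (\<exists>a. f = Scale C a (Ident C x))"
  have [simp]: "x \<in> Obj C" "f \<in> Arr C" "Dom C f = x" "Cod C f = x"
    using f x by (auto simp: in_Hom)
  have iso: "is_iso C (Add C f (Scale C (- a) (Ident C x)))" for a
  proof (rule schur_iso[OF x x])
    show "Add C f (Scale C (- a) (Ident C x)) \<noteq> Zero C x x"
      using na diff_zero_iff[of f "Scale C a (Ident C x)"] by auto
  qed (auto simp: in_Hom)
  have "p = 0" if "eval_end x f p = Zero C x x" for p
    using that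
  proof (induction "degree p" arbitrary: p)
    case 0
    then obtain c where "p = [:c:]" by (metis degree_eq_zeroE)
    then show ?case
      using 0 f scale_eq_zero_iff[of "Ident C x" c] simple_ident_nonzero[OF x]
      by (auto simp: eval_end_pCons)
  next
    case (Suc n)
    obtain a where "poly p a = 0" using alg_closed_imp_poly_has_root[of p] Suc(2) by auto
    then obtain q where q: "p = [:- a, 1:] * q" using poly_eq_0_iff_dvd by (metis dvdE)
    have q0: "q \<noteq> 0" using q Suc(2) by auto
    have "degree p = Suc (degree q)" unfolding q using q0 by (subst degree_mult_eq) auto
    then have n: "n = degree q" using Suc(2) by simp
    let ?g = "Add C f (Scale C (- a) (Ident C x))"
    have "?g \<cdot> eval_end x f q = ?g \<cdot> Zero C x x"
      using Suc(3) f unfolding q eval_end_linear_factor[OF f] by simp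
    then have "eval_end x f q = Zero C x x"
      by (subst (asm) iso_cancel_left[OF iso]) (use f in simp_all)
    then have "q = 0" using Suc(1)[OF n] by blast
    then show ?case using q0 by simp
  qed
  then show False using annihilating_polynomial[OF f] by blast
qed

lemma simple_hom_scalar:
  assumes "simple_object C x" "simple_object C y" "f \<in> Hom C x y" "g \<in> Hom C x y" "f \<noteq> Zero C x y"
  shows "\<exists>a. g = Scale C a f"
proof -
  have iso: "is_iso C f" by (rule schur_iso) fact+
  have [simp]: "f \<in> Arr C" "g \<in> Arr C" "Dom C f = x" "Cod C f = y" "Dom C g = x" "Cod C g = y" "x \<in> Obj C"
    using assms by (auto simp: in_Hom)
  obtain a where a: "inv_arr C f \<cdot> g = Scale C a (Ident C x)"
    using schur_scalar[OF assms(1), of "inv_arr C f \<cdot> g"] iso by (auto simp: in_Hom)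
  have "g = f \<cdot> (inv_arr C f \<cdot> g)" using iso by simp
  also have "\<dots> = Scale C a f" unfolding a by simp
  finally show ?thesis by blast
qed

lemma thin_simple: "\<lbrakk>simple_object C x; simple_object C y\<rbrakk> \<Longrightarrow> thin x y"
  by (rule thinI_scalar) (rule simple_hom_scalar)

lemma simple_isomorphicI:
  "\<lbrakk>simple_object C x; simple_object C y; f \<in> Hom C x y; f \<noteq> Zero C x y\<rbrakk> \<Longrightarrow> isomorphic C x y"
  using schur_iso isomorphicI by blast

lemma semisimple_biproduct:
  assumes "z \<in> Obj C"
  obtains n :: nat and x \<iota> \<pi> where "biproduct C {..<n} x z \<iota> \<pi>" "\<And>i. i < n \<Longrightarrow> simple_object C (x i)"
proof -
  obtain xs where "\<forall>y \<in> set xs. simple_object C y" "direct_sum C xs z" using semisimple assms by blast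
  then show ?thesis using that unfolding direct_sum_iff_biproduct by (metis nth_mem)
qed

lemma hom_from_simple_nonzero:
  assumes b: "biproduct C I x z \<iota> \<pi>" and s: "simple_object C s" "f \<in> Hom C s z" "f \<noteq> Zero C s z"
  obtains i where "i \<in> I" "\<pi> i \<cdot> f \<noteq> Zero C s (x i)"
proof -
  have "\<exists>i\<in>I. \<pi> i \<cdot> f \<noteq> Zero C s (x i)"
  proof (rule ccontr)
    assume "\<not> (\<exists>i\<in>I. \<pi> i \<cdot> f \<noteq> Zero C s (x i))"
    then have "f = Zero C s z"
      using s biproductD[OF b] by (intro biproduct_jointly_monic[OF b, of f s]) (auto simp: in_Hom)
    then show False using s by simp
  qed
  then show ?thesis using that by blast
qed

lemma hom_to_simple_nonzero:
  assumes b: "biproduct C I x z \<iota> \<pi>" and s: "simple_object C s" "f \<in> Hom C z s" "f \<noteq> Zero C z s"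
  obtains i where "i \<in> I" "f \<cdot> \<iota> i \<noteq> Zero C (x i) s"
proof -
  have "\<exists>i\<in>I. f \<cdot> \<iota> i \<noteq> Zero C (x i) s"
  proof (rule ccontr)
    assume "\<not> (\<exists>i\<in>I. f \<cdot> \<iota> i \<noteq> Zero C (x i) s)"
    then have "f = Zero C z s"
      using s biproductD[OF b] by (intro biproduct_jointly_epic[OF b, of f s]) (auto simp: in_Hom)
    then show False using s by simp
  qed
  then show ?thesis using that by blast
qed

lemma simple_constituent:
  assumes b: "biproduct C I x z \<iota> \<pi>" "\<And>i. i \<in> I \<Longrightarrow> simple_object C (x i)"
    and s: "simple_object C s" "f \<in> Hom C s z" "f \<noteq> Zero C s z"
  obtains i where "i \<in> I" "isomorphic C s (x i)"
proof -
  obtain i where i: "i \<in> I" "\<pi> i \<cdot> f \<noteq> Zero C s (x i)"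
    using hom_from_simple_nonzero[OF b(1) s] by blast
  have "isomorphic C s (x i)"
    by (rule simple_isomorphicI[of _ _ "\<pi> i \<cdot> f"]) (use i s b biproductD[OF b(1)] in \<open>auto simp: in_Hom\<close>)
  then show ?thesis using that i by blast
qed

lemma hom_from_simple_retraction:
  assumes s: "simple_object C s" "f \<in> Hom C s z" "f \<noteq> Zero C s z"
  obtains r where "r \<in> Hom C z s" "r \<cdot> f = Ident C s"
proof -
  have zo: "z \<in> Obj C" using s Hom_objs by blast
  obtain n :: nat and x \<iota> \<pi> where b: "biproduct C {..<n} x z \<iota> \<pi>" and xs: "\<And>i. i < n \<Longrightarrow> simple_object C (x i)"
    using semisimple_biproduct[OF zo] by metis
  obtain i where i: "i < n" "\<pi> i \<cdot> f \<noteq> Zero C s (x i)"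
    using hom_from_simple_nonzero[OF b s] by blast
  note [simp] = biproduct_simps[OF b]
  have iso: "is_iso C (\<pi> i \<cdot> f)"
    using i s xs by (intro schur_iso[of s "x i"]) (auto simp: in_Hom)
  show ?thesis
  proof (rule that)
    show "inv_arr C (\<pi> i \<cdot> f) \<cdot> \<pi> i \<in> Hom C z s" using iso i s by (auto simp: in_Hom)
    show "(inv_arr C (\<pi> i \<cdot> f) \<cdot> \<pi> i) \<cdot> f = Ident C s"
      using inv_simps(1-4)[OF iso] iso i s by (simp add: in_Hom)
  qed
qed

lemma hom_to_simple_section:
  assumes s: "simple_object C s" "f \<in> Hom C z s" "f \<noteq> Zero C z s"
  obtains r where "r \<in> Hom C s z" "f \<cdot> r = Ident C s"
proof -
  have zo: "z \<in> Obj C" using s Hom_objs by blast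
  obtain n :: nat and x \<iota> \<pi> where b: "biproduct C {..<n} x z \<iota> \<pi>" and xs: "\<And>i. i < n \<Longrightarrow> simple_object C (x i)"
    using semisimple_biproduct[OF zo] by metis
  obtain i where i: "i < n" "f \<cdot> \<iota> i \<noteq> Zero C (x i) s"
    using hom_to_simple_nonzero[OF b s] by blast
  note [simp] = biproduct_simps[OF b]
  have iso: "is_iso C (f \<cdot> \<iota> i)"
    using i s xs by (intro schur_iso[of "x i" s]) (auto simp: in_Hom)
  show ?thesis
  proof (rule that)
    show "\<iota> i \<cdot> inv_arr C (f \<cdot> \<iota> i) \<in> Hom C s z" using iso i s by (auto simp: in_Hom)
    show "f \<cdot> (\<iota> i \<cdot> inv_arr C (f \<cdot> \<iota> i)) = Ident C s"
      using inv_simps[OF iso] assoc_simp[of "inv_arr C (f \<cdot> \<iota> i)" "\<iota> i" f] iso i s by (simp add: in_Hom)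
  qed
qed

text \<open>The idempotents \<open>\<iota> i \<cdot> \<pi> i\<close> are scalars, and two different ones annihilate each other.\<close>

lemma biproduct_of_simple_singleton:
  assumes b: "biproduct C I x z \<iota> \<pi>" and nz: "\<And>i. i \<in> I \<Longrightarrow> \<not> zero_object C (x i)"
    and z: "simple_object C z"
  shows "\<exists>i. I = {i}"
proof -
  note [simp] = biproduct_simps[OF b]
  have zo: "z \<in> Obj C" using z by simp
  obtain i where i: "i \<in> I" "\<pi> i \<cdot> Ident C z \<noteq> Zero C z (x i)"
    using hom_from_simple_nonzero[OF b z, of "Ident C z"] simple_ident_nonzero[OF z] by (auto simp: in_Hom)
  have "j = i" if j: "j \<in> I" for j
  proof (rule ccontr)
    assume ne: "j \<noteq> i"
    obtain a where a: "\<iota> i \<cdot> \<pi> i = Scale C a (Ident C z)"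
      using schur_scalar[OF z, of "\<iota> i \<cdot> \<pi> i"] i by (auto simp: in_Hom)
    have "\<pi> i \<cdot> (\<iota> i \<cdot> \<pi> i) = Scale C a (\<pi> i)" unfolding a using i by simp
    then have "\<pi> i = Scale C a (\<pi> i)" using i by simp
    then have a1: "a = 1" using scale_cancel[of "\<pi> i" 1 a] i by auto
    have "(\<iota> i \<cdot> \<pi> i) \<cdot> \<iota> j = Scale C a (\<iota> j)" unfolding a using j by simp
    then have "\<iota> j = Zero C (x j) z" using i(1) j ne a1 by simp
    then have "\<pi> j \<cdot> \<iota> j = Zero C (x j) (x j)" using j by simp
    then show False using nz[OF j] j by (simp add: zero_object_def)
  qed
  then show ?thesis using i(1) by blast
qed

text \<open>Two summands would give two linearly independent idempotents.\<close>

lemma thin_self_simple: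
  assumes z: "z \<in> Obj C" "\<not> zero_object C z" "thin z z"
  shows "simple_object C z"
proof -
  obtain n :: nat and x \<iota> \<pi> where b: "biproduct C {..<n} x z \<iota> \<pi>" and xs: "\<And>i. i < n \<Longrightarrow> simple_object C (x i)"
    using semisimple_biproduct[OF z(1)] by metis
  note [simp] = biproduct_simps[OF b]
  have n0: "n \<noteq> 0"
  proof
    assume "n = 0"
    then have "Ident C z = Zero C z z" using biproductD(12)[OF b] z by simp
    then show False using z by (simp add: zero_object_def)
  qed
  have "n = 1"
  proof (rule ccontr)
    assume "n \<noteq> 1"
    then have n: "0 < n" "1 < n" using n0 by auto
    obtain a c where ac: "a \<noteq> 0 \<or> c \<noteq> 0"
      "Add C (Scale C a (\<iota> 0 \<cdot> \<pi> 0)) (Scale C c (\<iota> 1 \<cdot> \<pi> 1)) = Zero C z z"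
      using z(3) n unfolding thin_def by (metis (no_types, lifting) lessThan_iff biproductD(4-9)[OF b] comp_simps in_Hom)
    let ?A = "Add C (Scale C a (\<iota> 0 \<cdot> \<pi> 0)) (Scale C c (\<iota> 1 \<cdot> \<pi> 1))"
    have "\<pi> 0 \<cdot> ?A = Scale C a (\<pi> 0)" "\<pi> 1 \<cdot> ?A = Scale C c (\<pi> 1)"
      using n by (simp_all add: comp_add)
    then have "Scale C a (\<pi> 0) = Zero C z (x 0)" "Scale C c (\<pi> 1) = Zero C z (x 1)"
      unfolding ac(2) using n z by simp_all
    then have "\<pi> 0 = Zero C z (x 0) \<or> \<pi> 1 = Zero C z (x 1)"
      using ac(1) scale_eq_zero_iff[of "\<pi> 0" a] scale_eq_zero_iff[of "\<pi> 1" c] n by auto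
    then have "\<pi> 0 \<cdot> \<iota> 0 = Zero C (x 0) (x 0) \<or> \<pi> 1 \<cdot> \<iota> 1 = Zero C (x 1) (x 1)"
      using n by (metis biproductD(3,4,5,6)[OF b] comp_zero(2) lessThan_iff)
    then show False using simple_ident_nonzero[OF xs, of 0] simple_ident_nonzero[OF xs, of 1] n by simp
  qed
  then have "{..<n} = {0}" by auto
  then have "isomorphic C (x 0) z" using biproduct_unique_summand_iso[of 0 x z] b by simp
  then show ?thesis using simple_iso_invariant xs \<open>n = 1\<close> by simp
qed

lemma thin_distinct_constituents:
  assumes b: "biproduct C I x z \<iota> \<pi>" and t: "thin s z \<or> thin z s" and s: "simple_object C s"
    and ij: "i \<in> I" "j \<in> I" "isomorphic C s (x i)" "isomorphic C s (x j)"
  shows "i = j"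
proof (rule ccontr)
  assume ne: "i \<noteq> j"
  note [simp] = biproduct_simps[OF b]
  obtain u where u: "u \<in> Hom C s (x i)" "is_iso C u" using ij by (auto simp: isomorphic_def)
  obtain v where v: "v \<in> Hom C s (x j)" "is_iso C v" using ij by (auto simp: isomorphic_def)
  have [simp]: "u \<in> Arr C" "v \<in> Arr C" "Dom C u = s" "Cod C u = x i" "Dom C v = s" "Cod C v = x j"
    "s \<in> Obj C" "is_iso C u" "is_iso C v"
    using u v s by (auto simp: in_Hom)
  have nz: "u \<noteq> Zero C s (x i)" "v \<noteq> Zero C s (x j)"
    using iso_nonzero[of u] iso_nonzero[of v] s by auto
  from t show False
  proof
    assume "thin s z"
    moreover have "\<iota> i \<cdot> u \<in> Hom C s z" "\<iota> j \<cdot> v \<in> Hom C s z" using ij by (auto simp: in_Hom)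
    ultimately obtain a c where ac: "a \<noteq> 0 \<or> c \<noteq> 0"
      "Add C (Scale C a (\<iota> i \<cdot> u)) (Scale C c (\<iota> j \<cdot> v)) = Zero C s z"
      unfolding thin_def by meson
    let ?A = "Add C (Scale C a (\<iota> i \<cdot> u)) (Scale C c (\<iota> j \<cdot> v))"
    have "\<pi> i \<cdot> ?A = Scale C a u" "\<pi> j \<cdot> ?A = Scale C c v"
      using ij ne by (simp_all add: comp_add)
    then have "Scale C a u = Zero C s (x i)" "Scale C c v = Zero C s (x j)"
      unfolding ac(2) using ij by simp_all
    then show False using ac(1) nz scale_eq_zero_iff[of u a] scale_eq_zero_iff[of v c] by auto
  next
    assume "thin z s"
    moreover have "inv_arr C u \<cdot> \<pi> i \<in> Hom C z s" "inv_arr C v \<cdot> \<pi> j \<in> Hom C z s" using ij by (auto simp: in_Hom)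
    ultimately obtain a c where ac: "a \<noteq> 0 \<or> c \<noteq> 0"
      "Add C (Scale C a (inv_arr C u \<cdot> \<pi> i)) (Scale C c (inv_arr C v \<cdot> \<pi> j)) = Zero C z s"
      unfolding thin_def by meson
    let ?A = "Add C (Scale C a (inv_arr C u \<cdot> \<pi> i)) (Scale C c (inv_arr C v \<cdot> \<pi> j))"
    have "?A \<cdot> (\<iota> i \<cdot> u) = Scale C a (Ident C s)" "?A \<cdot> (\<iota> j \<cdot> v) = Scale C c (Ident C s)"
      using ij ne by (simp_all add: comp_add)
    then have "Scale C a (Ident C s) = Zero C s s" "Scale C c (Ident C s) = Zero C s s"
      unfolding ac(2) using ij by simp_all
    then show False
      using ac(1) simple_ident_nonzero[OF s] scale_eq_zero_iff[of "Ident C s" a] scale_eq_zero_iff[of "Ident C s" c]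
      by auto
  qed
qed

lemma thin_from_distinct_constituents:
  assumes b: "biproduct C I x z \<iota> \<pi>" "\<And>i. i \<in> I \<Longrightarrow> simple_object C (x i)" and s: "simple_object C s"
    and u: "\<And>i j. \<lbrakk>i \<in> I; j \<in> I; isomorphic C s (x i); isomorphic C s (x j)\<rbrakk> \<Longrightarrow> i = j"
  shows "thin s z"
proof (rule thinI_scalar)
  note [simp] = biproduct_simps[OF b(1)]
  fix f g assume fg: "f \<in> Hom C s z" "g \<in> Hom C s z" "f \<noteq> Zero C s z"
  have [simp]: "f \<in> Arr C" "g \<in> Arr C" "Dom C f = s" "Dom C g = s" "Cod C f = z" "Cod C g = z" "s \<in> Obj C"
    using fg s by (auto simp: in_Hom)
  obtain i where i: "i \<in> I" "\<pi> i \<cdot> f \<noteq> Zero C s (x i)" using hom_from_simple_nonzero[OF b(1) s fg(1,3)] by blast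
  have si: "isomorphic C s (x i)"
    by (rule simple_isomorphicI[of _ _ "\<pi> i \<cdot> f"]) (use i s b(2) in \<open>auto simp: in_Hom\<close>)
  have other: "\<pi> j \<cdot> h = Zero C s (x j)" if "j \<in> I" "j \<noteq> i" "h \<in> Hom C s z" for j h
  proof (rule ccontr)
    assume "\<pi> j \<cdot> h \<noteq> Zero C s (x j)"
    then have "isomorphic C s (x j)"
      using that s b(2) by (intro simple_isomorphicI[of _ _ "\<pi> j \<cdot> h"]) (auto simp: in_Hom)
    then show False using u[OF i(1) that(1) si] that by simp
  qed
  obtain a where a: "\<pi> i \<cdot> g = Scale C a (\<pi> i \<cdot> f)"
    using simple_hom_scalar[OF s b(2)[OF i(1)], of "\<pi> i \<cdot> f" "\<pi> i \<cdot> g"] i by (auto simp: in_Hom)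
  have "g = Scale C a f"
  proof (rule biproduct_jointly_monic[OF b(1) fg(2)])
    fix j assume j: "j \<in> I"
    show "\<pi> j \<cdot> g = \<pi> j \<cdot> Scale C a f"
      using a other[OF j _ fg(1)] other[OF j _ fg(2)] j by (cases "j = i") auto
  qed (simp add: in_Hom)
  then show "\<exists>a. g = Scale C a f" ..
qed

end

section \<open>Multiplicities\<close>

context fusion_category
begin

text \<open>The inclusions of the summands isomorphic to \<open>s\<close>, each composed with an isomorphism from \<open>s\<close>, form
  a basis: by Schur's lemma the components of an arrow are multiples of these isomorphisms.\<close>

lemma hom_dim_biproduct:
  assumes b: "biproduct C I x z \<iota> \<pi>" "\<And>i. i \<in> I \<Longrightarrow> simple_object C (x i)" and s: "simple_object C s"
  shows "hom_dim C s z = card {i \<in> I. isomorphic C s (x i)}"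
proof -
  note [simp] = biproduct_simps[OF b(1)]
  let ?J = "{i \<in> I. isomorphic C s (x i)}"
  have so [simp]: "s \<in> Obj C" using s by simp
  interpret V: vectorspace class_ring "hom_space C s z" using hom_vectorspace so biproductD(2)[OF b(1)] by blast
  have "\<forall>i \<in> ?J. \<exists>u. u \<in> Hom C s (x i) \<and> is_iso C u" unfolding isomorphic_def by blast
  then obtain u where u: "\<And>i. i \<in> ?J \<Longrightarrow> u i \<in> Hom C s (x i) \<and> is_iso C (u i)"
    unfolding Bex_def using bchoice[of ?J "\<lambda>i u. u \<in> Hom C s (x i) \<and> is_iso C u"] by blast
  have us [simp]: "u i \<in> Arr C" "Dom C (u i) = s" "Cod C (u i) = x i" "is_iso C (u i)"
    if "i \<in> I" "isomorphic C s (x i)" for i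
    using u[of i] that by (auto simp: in_Hom)
  have nz: "u i \<noteq> Zero C s (x i)" if "i \<in> ?J" for i
    using iso_nonzero[of "u i"] that s by auto
  define e where "e i = \<iota> i \<cdot> u i" for i
  have e_car: "e i \<in> Hom C s z" if "i \<in> ?J" for i using that by (auto simp: e_def in_Hom)
  have e_simps [simp]: "e i \<in> Arr C" "Dom C (e i) = s" "Cod C (e i) = z"
    if "i \<in> I" "isomorphic C s (x i)" for i using e_car[of i] that by (auto simp: in_Hom)
  have pe: "\<pi> j \<cdot> e i = (if i = j then u i else Zero C s (x j))" if "i \<in> ?J" "j \<in> I" for i j
    using that by (auto simp: e_def)
  have inj: "inj_on e ?J"
  proof (rule inj_onI)
    fix i j assume ij: "i \<in> ?J" "j \<in> ?J" "e i = e j"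
    show "i = j"
    proof (rule ccontr)
      assume "i \<noteq> j"
      then have "u i = Zero C s (x i)" using pe[of i i] pe[of j i] ij by auto
      then show False using nz[OF ij(1)] by simp
    qed
  qed
  have finJ: "finite ?J" using biproductD(1)[OF b(1)] by simp
  let ?B = "e ` ?J"
  have lc: "V.lincomb a ?B = hsum s z (\<lambda>i. Scale C (a (e i)) (e i)) ?J" for a
    unfolding V.lincomb_def hom_space_simps
    using inj by (subst V.M.finsum_reindex) (auto simp: in_Hom)
  have proj: "\<pi> j \<cdot> V.lincomb a ?B = Scale C (a (e j)) (u j)" if j: "j \<in> ?J" for a j
  proof -
    have "\<pi> j \<cdot> hsum s (Dom C (\<pi> j)) (\<lambda>i. Scale C (a (e i)) (e i)) ?J =
        hsum s (x j) (\<lambda>i. \<pi> j \<cdot> Scale C (a (e i)) (e i)) ?J"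
      using j finJ by (subst comp_hsum_left) (auto simp: in_Hom)
    also have "\<dots> = \<pi> j \<cdot> Scale C (a (e j)) (e j)"
    proof (rule hsum_single[OF finJ j])
      show "\<pi> j \<cdot> Scale C (a (e j)) (e j) \<in> Hom C s (x j)" using j by (auto simp: in_Hom)
      show "\<pi> j \<cdot> Scale C (a (e i)) (e i) = Zero C s (x j)" if "i \<in> ?J" "i \<noteq> j" for i
        using that j pe[of i j] by auto
    qed
    also have "\<dots> = Scale C (a (e j)) (u j)" using pe[of j j] j by simp
    finally show ?thesis using j by (simp add: lc)
  qed
  have proj0: "\<pi> j \<cdot> f = Zero C s (x j)" if "j \<in> I - ?J" "f \<in> Hom C s z" for j f
  proof (rule ccontr)
    assume "\<pi> j \<cdot> f \<noteq> Zero C s (x j)"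
    then have "isomorphic C s (x j)"
      using that b(2) s by (intro simple_isomorphicI[of _ _ "\<pi> j \<cdot> f"]) (auto simp: in_Hom)
    then show False using that by simp
  qed
  have lc_car: "V.lincomb a ?B \<in> Hom C s z" for a
    using V.lincomb_closed[of ?B a] e_car by (simp add: image_subset_iff)
  have "V.basis ?B"
  proof (subst V.basis_criterion)
    show "finite ?B" using finJ by simp
    show "?B \<subseteq> carrier (hom_space C s z)" using e_car by auto
    show "\<forall>v. v \<in> carrier (hom_space C s z) \<longrightarrow>
        (\<exists>!a. a \<in> ?B \<rightarrow>\<^sub>E carrier class_ring \<and> V.lincomb a ?B = v)"
    proof (intro allI impI)
      fix v assume "v \<in> carrier (hom_space C s z)"
      then have v: "v \<in> Hom C s z" by simp
      have "\<exists>a. \<pi> j \<cdot> v = Scale C a (u j)" if "j \<in> ?J" for j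
        using simple_hom_scalar[OF s b(2), of j "u j" "\<pi> j \<cdot> v"] that nz[OF that] v by (auto simp: in_Hom)
      then obtain c where c: "\<And>j. j \<in> ?J \<Longrightarrow> \<pi> j \<cdot> v = Scale C (c j) (u j)" by metis
      let ?a = "\<lambda>w \<in> ?B. c (inv_into ?J e w)"
      show "\<exists>!a. a \<in> ?B \<rightarrow>\<^sub>E carrier class_ring \<and> V.lincomb a ?B = v"
      proof (rule ex1I[of _ ?a])
        have "V.lincomb ?a ?B = v"
        proof (rule biproduct_jointly_monic[OF b(1) lc_car v])
          fix j assume j: "j \<in> I"
          show "\<pi> j \<cdot> V.lincomb ?a ?B = \<pi> j \<cdot> v"
          proof (cases "j \<in> ?J")
            case True
            then show ?thesis using inj by (simp only: proj c) (simp add: inv_into_f_f)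
          next
            case False
            then show ?thesis using proj0 j v lc_car by simp
          qed
        qed
        then show "?a \<in> ?B \<rightarrow>\<^sub>E carrier class_ring \<and> V.lincomb ?a ?B = v" by simp
      next
        fix a assume a: "a \<in> ?B \<rightarrow>\<^sub>E carrier class_ring \<and> V.lincomb a ?B = v"
        have "a (e j) = c j" if j: "j \<in> ?J" for j
          using proj[OF j, of a] c[OF j] a scale_cancel[of "u j" "a (e j)" "c j"] nz[OF j] j by auto
        note ac = this
        show "a = ?a"
        proof (rule PiE_ext)
          show "a \<in> ?B \<rightarrow>\<^sub>E UNIV" "?a \<in> ?B \<rightarrow>\<^sub>E UNIV" using a by auto
          fix w assume "w \<in> ?B"
          then obtain j where j: "j \<in> ?J" "w = e j" by blast
          then show "a w = ?a w" using ac[OF j(1)] inv_into_f_f[OF inj j(1)] by simp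
        qed
      qed
    qed
  qed
  then have "V.dim = card ?B" using V.dim_basis finJ by blast
  then show ?thesis using card_image[OF inj] by simp
qed

text \<open>The index set is partitioned by the isomorphism types of simple objects, and each block is
  counted by the dimension of a hom space. So the number of simple summands does not depend on the
  decomposition.\<close>

lemma biproduct_simple_card:
  assumes R: "iso_reps C (simple_object C) R"
    and b: "biproduct C I x z \<iota> \<pi>" "\<And>i. i \<in> I \<Longrightarrow> simple_object C (x i)"
  shows "card I = (\<Sum>s\<in>set R. hom_dim C s z)"
proof -
  have dist: "s = t" if "s \<in> set R" "t \<in> set R" "isomorphic C s t" for s t
    using R that unfolding iso_reps_def in_set_conv_nth by blast
  have Rs: "simple_object C s" if "s \<in> set R" for s using R that by (simp add: iso_reps_def)
  have fin: "finite I" using biproductD(1)[OF b(1)] .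
  let ?A = "\<lambda>s. {i \<in> I. isomorphic C s (x i)}"
  have ex: "\<exists>s\<in>set R. isomorphic C s (x i)" if "i \<in> I" for i
  proof -
    have "x i \<in> Obj C" "simple_object C (x i)" using b(2)[OF that] by auto
    then obtain s where "s \<in> set R" "isomorphic C (x i) s" using R unfolding iso_reps_def by blast
    then show ?thesis using isomorphic_sym by blast
  qed
  then have "I = (\<Union>s\<in>set R. ?A s)" by blast
  then have "card I = card (\<Union>s\<in>set R. ?A s)" by simp
  also have "\<dots> = (\<Sum>s\<in>set R. card (?A s))"
  proof (rule card_UN_disjoint)
    have "?A s \<inter> ?A t = {}" if "s \<in> set R" "t \<in> set R" "s \<noteq> t" for s t
      using dist[OF that(1,2)] that(3) isomorphic_trans isomorphic_sym by blast
    then show "\<forall>s\<in>set R. \<forall>t\<in>set R. s \<noteq> t \<longrightarrow> ?A s \<inter> ?A t = {}" by blast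
  qed (use fin in auto)
  also have "\<dots> = (\<Sum>s\<in>set R. hom_dim C s z)"
    by (intro sum.cong refl hom_dim_biproduct[OF b, symmetric]) (auto simp: Rs)
  finally show ?thesis .
qed

lemma biproduct_simple_card_unique:
  assumes "biproduct C I x z \<iota> \<pi>" "\<And>i. i \<in> I \<Longrightarrow> simple_object C (x i)"
    and "biproduct C J y z \<kappa> \<rho>" "\<And>j. j \<in> J \<Longrightarrow> simple_object C (y j)"
  shows "card I = card J"
proof -
  obtain R where R: "iso_reps C (simple_object C) R" using finitely_many_simples by blast
  show ?thesis using biproduct_simple_card[OF R assms(1,2)] biproduct_simple_card[OF R assms(3,4)] by simp
qed

end

section \<open>Tensor products\<close>

context monoidal_category
begin

lemma tens_simps [simp]:
  assumes "f \<in> Arr C" "g \<in> Arr C"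
  shows "f \<star> g \<in> Arr C" "Dom C (f \<star> g) = Dom C f \<boxtimes> Dom C g" "Cod C (f \<star> g) = Cod C f \<boxtimes> Cod C g"
  using tens_hom[of f "Dom C f" "Cod C f" g "Dom C g" "Cod C g"] assms by (auto simp: in_Hom)

lemma tens_objs [simp]: "x \<in> Obj C \<Longrightarrow> y \<in> Obj C \<Longrightarrow> x \<boxtimes> y \<in> Obj C" "TUnit C \<in> Obj C"
  by (fact tens_obj) (fact unit_obj)

declare tens_ident [simp]

lemma interchange:
  "\<lbrakk>f \<in> Arr C; f' \<in> Arr C; g \<in> Arr C; g' \<in> Arr C; Cod C f = Dom C f'; Cod C g = Dom C g'\<rbrakk> \<Longrightarrow>
    (f' \<star> g') \<cdot> (f \<star> g) = (f' \<cdot> f) \<star> (g' \<cdot> g)"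
  by (rule tens_comp[symmetric]) (auto simp: in_Hom)

lemma interchange_extend:
  "\<lbrakk>f \<in> Arr C; f' \<in> Arr C; g \<in> Arr C; g' \<in> Arr C; Cod C f = Dom C f'; Cod C g = Dom C g';
    h \<in> Arr C; Cod C h = Dom C f \<boxtimes> Dom C g\<rbrakk> \<Longrightarrow>
    (f' \<star> g') \<cdot> ((f \<star> g) \<cdot> h) = ((f' \<cdot> f) \<star> (g' \<cdot> g)) \<cdot> h"
  by (rule comp_eq_extend[OF interchange]) auto

lemmas fuse = interchange interchange_extend

lemma tens_iso [simp]:
  assumes "is_iso C f" "is_iso C g"
  shows "is_iso C (f \<star> g)" "inv_arr C (f \<star> g) = inv_arr C f \<star> inv_arr C g"
  using isoI[of "f \<star> g" "Dom C f \<boxtimes> Dom C g" "Cod C f \<boxtimes> Cod C g" "inv_arr C f \<star> inv_arr C g"] assms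
  by (simp_all add: in_Hom fuse)

lemma inv_ident [simp]: "x \<in> Obj C \<Longrightarrow> inv_arr C (Ident C x) = Ident C x"
  by (rule isoI(2)[of _ x x]) (auto simp: in_Hom)

lemma assoc_arr_simps [simp]:
  assumes "x \<in> Obj C" "y \<in> Obj C" "z \<in> Obj C"
  shows "Assoc C x y z \<in> Arr C" "Dom C (Assoc C x y z) = (x \<boxtimes> y) \<boxtimes> z"
    "Cod C (Assoc C x y z) = x \<boxtimes> (y \<boxtimes> z)" "is_iso C (Assoc C x y z)"
  using assoc_hom[OF assms] assoc_iso[OF assms] by (auto simp: in_Hom)

lemma lunit_simps [simp]:
  assumes "x \<in> Obj C"
  shows "LUnit C x \<in> Arr C" "Dom C (LUnit C x) = TUnit C \<boxtimes> x" "Cod C (LUnit C x) = x" "is_iso C (LUnit C x)"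
  using lunit_hom[OF assms] lunit_iso[OF assms] by (auto simp: in_Hom)

lemma runit_simps [simp]:
  assumes "x \<in> Obj C"
  shows "RUnit C x \<in> Arr C" "Dom C (RUnit C x) = x \<boxtimes> TUnit C" "Cod C (RUnit C x) = x" "is_iso C (RUnit C x)"
  using runit_hom[OF assms] runit_iso[OF assms] by (auto simp: in_Hom)

lemma assoc_nat:
  assumes "f \<in> Arr C" "g \<in> Arr C" "h \<in> Arr C"
  shows "Assoc C (Cod C f) (Cod C g) (Cod C h) \<cdot> ((f \<star> g) \<star> h) =
    (f \<star> (g \<star> h)) \<cdot> Assoc C (Dom C f) (Dom C g) (Dom C h)"
  by (rule assoc_natural) (use assms in \<open>auto simp: in_Hom\<close>)

lemma assoc_inv_nat:
  assumes "f \<in> Arr C" "g \<in> Arr C" "h \<in> Arr C"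
  shows "inv_arr C (Assoc C (Cod C f) (Cod C g) (Cod C h)) \<cdot> (f \<star> (g \<star> h)) =
    ((f \<star> g) \<star> h) \<cdot> inv_arr C (Assoc C (Dom C f) (Dom C g) (Dom C h))" (is "?l = ?r")
proof -
  let ?a = "Assoc C (Cod C f) (Cod C g) (Cod C h)" and ?b = "Assoc C (Dom C f) (Dom C g) (Dom C h)"
  have "?l = inv_arr C ?a \<cdot> ((f \<star> (g \<star> h)) \<cdot> ?b) \<cdot> inv_arr C ?b" using assms by simp
  also have "\<dots> = inv_arr C ?a \<cdot> (?a \<cdot> ((f \<star> g) \<star> h)) \<cdot> inv_arr C ?b" using assms by (simp only: assoc_nat)
  also have "\<dots> = ?r" using assms by simp
  finally show ?thesis .
qed

lemma lunit_nat: "f \<in> Arr C \<Longrightarrow> LUnit C (Cod C f) \<cdot> (Ident C (TUnit C) \<star> f) = f \<cdot> LUnit C (Dom C f)"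
  by (rule lunit_natural) (auto simp: in_Hom)

lemma runit_nat: "f \<in> Arr C \<Longrightarrow> RUnit C (Cod C f) \<cdot> (f \<star> Ident C (TUnit C)) = f \<cdot> RUnit C (Dom C f)"
  by (rule runit_natural) (auto simp: in_Hom)

lemma unit_whisker_faithful:
  assumes "f \<in> Arr C" "g \<in> Arr C" "Dom C f = Dom C g" "Cod C f = Cod C g"
    and "Ident C (TUnit C) \<star> f = Ident C (TUnit C) \<star> g"
  shows "f = g"
proof -
  have "f \<cdot> LUnit C (Dom C f) = g \<cdot> LUnit C (Dom C f)"
    using lunit_nat[of f] lunit_nat[of g] assms by simp
  then show ?thesis using assms by (subst (asm) iso_cancel_right) auto
qed

lemma whisker_unit_faithful:
  assumes "f \<in> Arr C" "g \<in> Arr C" "Dom C f = Dom C g" "Cod C f = Cod C g"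
    and "f \<star> Ident C (TUnit C) = g \<star> Ident C (TUnit C)"
  shows "f = g"
proof -
  have "f \<cdot> RUnit C (Dom C f) = g \<cdot> RUnit C (Dom C f)"
    using runit_nat[of f] runit_nat[of g] assms by simp
  then show ?thesis using assms by (subst (asm) iso_cancel_right) auto
qed

text \<open>Kelly's coherence for a unit in the first place; the triangle axiom speaks about a unit in the
  middle. Whiskered by a further unit it follows from the pentagon for \<open>1, 1, x, w\<close> and two triangles, and
  whiskering by the unit is faithful.\<close>

lemma lunit_tensor:
  assumes [simp]: "x \<in> Obj C" "w \<in> Obj C"
  shows "LUnit C (x \<boxtimes> w) \<cdot> Assoc C (TUnit C) x w = LUnit C x \<star> Ident C w"
proof -
  let ?I = "TUnit C"
  let ?m = "Assoc C ?I (?I \<boxtimes> x) w \<cdot> (Assoc C ?I ?I x \<star> Ident C w)"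
  have "(Ident C ?I \<star> (LUnit C (x \<boxtimes> w) \<cdot> Assoc C ?I x w)) \<cdot> ?m =
      (Ident C ?I \<star> LUnit C (x \<boxtimes> w)) \<cdot> ((Ident C ?I \<star> Assoc C ?I x w) \<cdot> Assoc C ?I (?I \<boxtimes> x) w \<cdot> (Assoc C ?I ?I x \<star> Ident C w))"
    by (simp add: fuse)
  also have "\<dots> = (Ident C ?I \<star> LUnit C (x \<boxtimes> w)) \<cdot> (Assoc C ?I ?I (x \<boxtimes> w) \<cdot> Assoc C (?I \<boxtimes> ?I) x w)"
    by (subst pentagon) simp_all
  also have "\<dots> = ((Ident C ?I \<star> LUnit C (x \<boxtimes> w)) \<cdot> Assoc C ?I ?I (x \<boxtimes> w)) \<cdot> Assoc C (?I \<boxtimes> ?I) x w"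
    by simp
  also have "\<dots> = (RUnit C ?I \<star> Ident C (x \<boxtimes> w)) \<cdot> Assoc C (?I \<boxtimes> ?I) x w"
    by (subst triangle) simp_all
  also have "\<dots> = Assoc C ?I x w \<cdot> ((RUnit C ?I \<star> Ident C x) \<star> Ident C w)"
    using assoc_nat[of "RUnit C ?I" "Ident C x" "Ident C w"] by simp
  also have "\<dots> = Assoc C ?I x w \<cdot> (((Ident C ?I \<star> LUnit C x) \<cdot> Assoc C ?I ?I x) \<star> Ident C w)"
    by (subst triangle) simp_all
  also have "\<dots> = (Assoc C ?I x w \<cdot> ((Ident C ?I \<star> LUnit C x) \<star> Ident C w)) \<cdot> (Assoc C ?I ?I x \<star> Ident C w)"
    by (simp add: fuse)
  also have "\<dots> = (Ident C ?I \<star> (LUnit C x \<star> Ident C w)) \<cdot> ?m"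
    using assoc_nat[of "Ident C ?I" "LUnit C x" "Ident C w"] by simp
  finally have "Ident C ?I \<star> (LUnit C (x \<boxtimes> w) \<cdot> Assoc C ?I x w) = Ident C ?I \<star> (LUnit C x \<star> Ident C w)"
    by (subst (asm) iso_cancel_right) simp_all
  then show ?thesis by (rule unit_whisker_faithful[rotated 4]) simp_all
qed

subsection \<open>Whiskered structure maps\<close>

abbreviation whisker :: "'o \<Rightarrow> 'm \<Rightarrow> 'm" (infixr "\<triangleright>" 76) where
  "x \<triangleright> f \<equiv> Ident C x \<star> f"

lemma whisker_comp: "\<lbrakk>x \<in> Obj C; f \<in> Arr C; g \<in> Arr C; Cod C f = Dom C g\<rbrakk> \<Longrightarrow> x \<triangleright> (g \<cdot> f) = (x \<triangleright> g) \<cdot> (x \<triangleright> f)"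
  by (simp add: fuse)

lemma assoc_whisker:
  assumes "x \<in> Obj C" "y \<in> Obj C" "k \<in> Arr C"
  shows "Assoc C x y (Cod C k) \<cdot> (Ident C (x \<boxtimes> y) \<star> k) = (x \<triangleright> y \<triangleright> k) \<cdot> Assoc C x y (Dom C k)"
  using assoc_nat[of "Ident C x" "Ident C y" k] assms by simp

lemma assoc_inv_whisker:
  assumes "x \<in> Obj C" "y \<in> Obj C" "k \<in> Arr C"
  shows "inv_arr C (Assoc C x y (Cod C k)) \<cdot> (x \<triangleright> y \<triangleright> k) = (Ident C (x \<boxtimes> y) \<star> k) \<cdot> inv_arr C (Assoc C x y (Dom C k))"
  using assoc_inv_nat[of "Ident C x" "Ident C y" k] assms by simp

lemma lunit_inv_nat:
  assumes "f \<in> Arr C"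
  shows "inv_arr C (LUnit C (Cod C f)) \<cdot> f = (TUnit C \<triangleright> f) \<cdot> inv_arr C (LUnit C (Dom C f))"
proof -
  have "inv_arr C (LUnit C (Cod C f)) \<cdot> f =
      inv_arr C (LUnit C (Cod C f)) \<cdot> (f \<cdot> LUnit C (Dom C f)) \<cdot> inv_arr C (LUnit C (Dom C f))"
    using assms by simp
  also have "\<dots> = (TUnit C \<triangleright> f) \<cdot> inv_arr C (LUnit C (Dom C f))"
    unfolding lunit_nat[OF assms, symmetric] using assms by simp
  finally show ?thesis .
qed

text \<open>Evaluation and coevaluation, whiskered on the right by an arbitrary object. In terms of these
  natural transformations between iterated left multiplications no associators are visible.\<close>

definition ev_at :: "'o \<Rightarrow> 'o \<Rightarrow> 'm \<Rightarrow> 'o \<Rightarrow> 'm" where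
  "ev_at x y ev w = LUnit C w \<cdot> (ev \<star> Ident C w) \<cdot> inv_arr C (Assoc C y x w)"

definition coev_at :: "'o \<Rightarrow> 'o \<Rightarrow> 'm \<Rightarrow> 'o \<Rightarrow> 'm" where
  "coev_at x y coev w = Assoc C x y w \<cdot> (coev \<star> Ident C w) \<cdot> inv_arr C (LUnit C w)"

lemma dual_simps:
  assumes "is_dual C x y ev coev"
  shows "x \<in> Obj C" "y \<in> Obj C" "ev \<in> Arr C" "Dom C ev = y \<boxtimes> x" "Cod C ev = TUnit C"
    "coev \<in> Arr C" "Dom C coev = TUnit C" "Cod C coev = x \<boxtimes> y"
  using assms by (auto simp: is_dual_def in_Hom)

lemma ev_at_simps:
  assumes "is_dual C x y ev coev" "w \<in> Obj C"
  shows "ev_at x y ev w \<in> Arr C" "Dom C (ev_at x y ev w) = y \<boxtimes> (x \<boxtimes> w)" "Cod C (ev_at x y ev w) = w"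
    "coev_at x y coev w \<in> Arr C" "Dom C (coev_at x y coev w) = w" "Cod C (coev_at x y coev w) = x \<boxtimes> (y \<boxtimes> w)"
  using dual_simps[OF assms(1)] assms(2) by (simp_all add: ev_at_def coev_at_def)

lemma ev_at_nat:
  assumes d: "is_dual C x y ev coev" and k: "k \<in> Arr C"
  shows "ev_at x y ev (Cod C k) \<cdot> (y \<triangleright> x \<triangleright> k) = k \<cdot> ev_at x y ev (Dom C k)"
proof -
  note [simp] = dual_simps[OF d] k
  have "ev_at x y ev (Cod C k) \<cdot> (y \<triangleright> x \<triangleright> k) =
      LUnit C (Cod C k) \<cdot> (ev \<star> Ident C (Cod C k)) \<cdot> (inv_arr C (Assoc C y x (Cod C k)) \<cdot> (y \<triangleright> x \<triangleright> k))"
    by (simp add: ev_at_def)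
  also have "\<dots> = LUnit C (Cod C k) \<cdot> (TUnit C \<triangleright> k) \<cdot> (ev \<star> Ident C (Dom C k)) \<cdot> inv_arr C (Assoc C y x (Dom C k))"
    by (subst assoc_inv_whisker) (simp_all add: fuse)
  also have "\<dots> = k \<cdot> ev_at x y ev (Dom C k)"
    by (subst lunit_nat) (simp_all add: ev_at_def)
  finally show ?thesis .
qed

lemma coev_at_nat:
  assumes d: "is_dual C x y ev coev" and k: "k \<in> Arr C"
  shows "coev_at x y coev (Cod C k) \<cdot> k = (x \<triangleright> y \<triangleright> k) \<cdot> coev_at x y coev (Dom C k)"
proof -
  note [simp] = dual_simps[OF d] k
  have "coev_at x y coev (Cod C k) \<cdot> k =
      Assoc C x y (Cod C k) \<cdot> (coev \<star> Ident C (Cod C k)) \<cdot> (inv_arr C (LUnit C (Cod C k)) \<cdot> k)"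
    by (simp add: coev_at_def)
  also have "\<dots> = (Assoc C x y (Cod C k) \<cdot> (Ident C (x \<boxtimes> y) \<star> k)) \<cdot> (coev \<star> Ident C (Dom C k)) \<cdot> inv_arr C (LUnit C (Dom C k))"
    by (subst lunit_inv_nat) (simp_all add: fuse)
  also have "\<dots> = (x \<triangleright> y \<triangleright> k) \<cdot> coev_at x y coev (Dom C k)"
    by (subst assoc_whisker) (simp_all add: coev_at_def)
  finally show ?thesis .
qed

text \<open>The zigzag equation of the duality tensored with \<open>w\<close>, with the associators absorbed by one
  pentagon.\<close>

lemma zigzag_left:
  assumes d: "is_dual C x y ev coev" and [simp]: "w \<in> Obj C"
  shows "(x \<triangleright> ev_at x y ev w) \<cdot> coev_at x y coev (x \<boxtimes> w) = Ident C (x \<boxtimes> w)"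
proof -
  note [simp] = dual_simps[OF d]
  let ?I = "TUnit C"
  let ?z = "RUnit C x \<cdot> (x \<triangleright> ev) \<cdot> Assoc C x y x \<cdot> (coev \<star> Ident C x)"
  have z: "?z = LUnit C x" using d by (simp add: is_dual_def)
  have p: "Assoc C x y (x \<boxtimes> w) \<cdot> Assoc C (x \<boxtimes> y) x w =
      (x \<triangleright> Assoc C y x w) \<cdot> Assoc C x (y \<boxtimes> x) w \<cdot> (Assoc C x y x \<star> Ident C w)"
    by (rule pentagon) simp_all
  have "((x \<triangleright> ev_at x y ev w) \<cdot> coev_at x y coev (x \<boxtimes> w)) \<cdot> (LUnit C x \<star> Ident C w) =
      ((x \<triangleright> ev_at x y ev w) \<cdot> coev_at x y coev (x \<boxtimes> w)) \<cdot> (LUnit C (x \<boxtimes> w) \<cdot> Assoc C ?I x w)"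
    by (simp add: lunit_tensor)
  also have "\<dots> = (x \<triangleright> ev_at x y ev w) \<cdot> Assoc C x y (x \<boxtimes> w) \<cdot> ((coev \<star> Ident C (x \<boxtimes> w)) \<cdot> Assoc C ?I x w)"
    using ev_at_simps[OF d] by (simp add: coev_at_def)
  also have "(coev \<star> Ident C (x \<boxtimes> w)) \<cdot> Assoc C ?I x w = Assoc C (x \<boxtimes> y) x w \<cdot> ((coev \<star> Ident C x) \<star> Ident C w)"
    using assoc_nat[of coev "Ident C x" "Ident C w"] by simp
  also have "(x \<triangleright> ev_at x y ev w) \<cdot> Assoc C x y (x \<boxtimes> w) \<cdot> (Assoc C (x \<boxtimes> y) x w \<cdot> ((coev \<star> Ident C x) \<star> Ident C w)) =
      (x \<triangleright> ev_at x y ev w) \<cdot> (Assoc C x y (x \<boxtimes> w) \<cdot> Assoc C (x \<boxtimes> y) x w) \<cdot> ((coev \<star> Ident C x) \<star> Ident C w)"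
    using ev_at_simps[OF d] by simp
  also have "\<dots> = ((x \<triangleright> ev_at x y ev w) \<cdot> (x \<triangleright> Assoc C y x w)) \<cdot> Assoc C x (y \<boxtimes> x) w \<cdot>
      ((Assoc C x y x \<star> Ident C w) \<cdot> ((coev \<star> Ident C x) \<star> Ident C w))"
    unfolding p using ev_at_simps[OF d] by simp
  also have "\<dots> = (x \<triangleright> LUnit C w) \<cdot> ((x \<triangleright> (ev \<star> Ident C w)) \<cdot> Assoc C x (y \<boxtimes> x) w) \<cdot>
      ((Assoc C x y x \<cdot> (coev \<star> Ident C x)) \<star> Ident C w)"
    using ev_at_simps[OF d] by (simp add: fuse ev_at_def)
  also have "(x \<triangleright> (ev \<star> Ident C w)) \<cdot> Assoc C x (y \<boxtimes> x) w = Assoc C x ?I w \<cdot> ((x \<triangleright> ev) \<star> Ident C w)"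
    using assoc_nat[of "Ident C x" ev "Ident C w"] by simp
  also have "(x \<triangleright> LUnit C w) \<cdot> (Assoc C x ?I w \<cdot> ((x \<triangleright> ev) \<star> Ident C w)) \<cdot>
      ((Assoc C x y x \<cdot> (coev \<star> Ident C x)) \<star> Ident C w) =
      ((x \<triangleright> LUnit C w) \<cdot> Assoc C x ?I w) \<cdot> (((x \<triangleright> ev) \<cdot> Assoc C x y x \<cdot> (coev \<star> Ident C x)) \<star> Ident C w)"
    by (simp add: fuse)
  also have "\<dots> = ?z \<star> Ident C w"
    by (subst triangle) (simp_all add: fuse)
  also have "\<dots> = Ident C (x \<boxtimes> w) \<cdot> (LUnit C x \<star> Ident C w)"
    unfolding z by simp
  finally show ?thesis
    using ev_at_simps[OF d] by (subst (asm) iso_cancel_right) simp_all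
qed

lemma zigzag_right:
  assumes d: "is_dual C x y ev coev" and [simp]: "w \<in> Obj C"
  shows "ev_at x y ev (y \<boxtimes> w) \<cdot> (y \<triangleright> coev_at x y coev w) = Ident C (y \<boxtimes> w)"
proof -
  note [simp] = dual_simps[OF d]
  let ?I = "TUnit C"
  let ?z = "LUnit C y \<cdot> (ev \<star> Ident C y) \<cdot> inv_arr C (Assoc C y x y) \<cdot> (y \<triangleright> coev)"
  have z: "?z = RUnit C y" using d by (simp add: is_dual_def)
  have p: "Assoc C y x (y \<boxtimes> w) \<cdot> Assoc C (y \<boxtimes> x) y w =
      (y \<triangleright> Assoc C x y w) \<cdot> Assoc C y (x \<boxtimes> y) w \<cdot> (Assoc C y x y \<star> Ident C w)"
    by (rule pentagon) simp_all
  have p': "inv_arr C (Assoc C y x (y \<boxtimes> w)) \<cdot> (y \<triangleright> Assoc C x y w) \<cdot> Assoc C y (x \<boxtimes> y) w =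
      Assoc C (y \<boxtimes> x) y w \<cdot> (inv_arr C (Assoc C y x y) \<star> Ident C w)" (is "?l = ?r")
  proof -
    have "?l = inv_arr C (Assoc C y x (y \<boxtimes> w)) \<cdot>
        ((y \<triangleright> Assoc C x y w) \<cdot> Assoc C y (x \<boxtimes> y) w \<cdot> (Assoc C y x y \<star> Ident C w)) \<cdot> (inv_arr C (Assoc C y x y) \<star> Ident C w)"
      by (simp add: fuse)
    also have "\<dots> = ?r" unfolding p[symmetric] by simp
    finally show ?thesis .
  qed
  have "(ev_at x y ev (y \<boxtimes> w) \<cdot> (y \<triangleright> coev_at x y coev w)) \<cdot> (RUnit C y \<star> Ident C w) =
      (ev_at x y ev (y \<boxtimes> w) \<cdot> (y \<triangleright> coev_at x y coev w)) \<cdot> ((y \<triangleright> LUnit C w) \<cdot> Assoc C y ?I w)"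
    by (simp add: triangle)
  also have "\<dots> = ev_at x y ev (y \<boxtimes> w) \<cdot> (y \<triangleright> Assoc C x y w) \<cdot> ((y \<triangleright> (coev \<star> Ident C w)) \<cdot> Assoc C y ?I w)"
    using ev_at_simps[OF d] by (simp add: coev_at_def fuse)
  also have "(y \<triangleright> (coev \<star> Ident C w)) \<cdot> Assoc C y ?I w = Assoc C y (x \<boxtimes> y) w \<cdot> ((y \<triangleright> coev) \<star> Ident C w)"
    using assoc_nat[of "Ident C y" coev "Ident C w"] by simp
  also have "ev_at x y ev (y \<boxtimes> w) \<cdot> (y \<triangleright> Assoc C x y w) \<cdot> (Assoc C y (x \<boxtimes> y) w \<cdot> ((y \<triangleright> coev) \<star> Ident C w)) =
     LUnit C (y \<boxtimes> w) \<cdot> (ev \<star> Ident C (y \<boxtimes> w)) \<cdot> (inv_arr C (Assoc C y x (y \<boxtimes> w)) \<cdot> (y \<triangleright> Assoc C x y w) \<cdot> Assoc C y (x \<boxtimes> y) w) \<cdot>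
       ((y \<triangleright> coev) \<star> Ident C w)"
    by (simp add: ev_at_def)
  also have "\<dots> = LUnit C (y \<boxtimes> w) \<cdot> ((ev \<star> Ident C (y \<boxtimes> w)) \<cdot> Assoc C (y \<boxtimes> x) y w) \<cdot>
       ((inv_arr C (Assoc C y x y) \<cdot> (y \<triangleright> coev)) \<star> Ident C w)"
    unfolding p' by (simp add: fuse)
  also have "(ev \<star> Ident C (y \<boxtimes> w)) \<cdot> Assoc C (y \<boxtimes> x) y w = Assoc C ?I y w \<cdot> ((ev \<star> Ident C y) \<star> Ident C w)"
    using assoc_nat[of ev "Ident C y" "Ident C w"] by simp
  also have "LUnit C (y \<boxtimes> w) \<cdot> (Assoc C ?I y w \<cdot> ((ev \<star> Ident C y) \<star> Ident C w)) \<cdot>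
       ((inv_arr C (Assoc C y x y) \<cdot> (y \<triangleright> coev)) \<star> Ident C w) =
       (LUnit C (y \<boxtimes> w) \<cdot> Assoc C ?I y w) \<cdot> (((ev \<star> Ident C y) \<cdot> inv_arr C (Assoc C y x y) \<cdot> (y \<triangleright> coev)) \<star> Ident C w)"
    by (simp add: fuse)
  also have "\<dots> = ?z \<star> Ident C w"
    by (subst lunit_tensor) (simp_all add: fuse)
  also have "\<dots> = Ident C (y \<boxtimes> w) \<cdot> (RUnit C y \<star> Ident C w)"
    unfolding z by simp
  finally show ?thesis
    using ev_at_simps[OF d] by (subst (asm) iso_cancel_right) simp_all
qed

end

section \<open>Braidings\<close>

context braided_fusion_category
begin

lemma braid_simps [simp]:
  assumes "x \<in> Obj C" "y \<in> Obj C"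
  shows "Braid C x y \<in> Arr C" "Dom C (Braid C x y) = x \<boxtimes> y" "Cod C (Braid C x y) = y \<boxtimes> x"
    "is_iso C (Braid C x y)"
  using braid_hom[OF assms] braid_iso[OF assms] by (auto simp: in_Hom)

lemma braid_nat:
  assumes "f \<in> Arr C" "g \<in> Arr C"
  shows "Braid C (Cod C f) (Cod C g) \<cdot> (f \<star> g) = (g \<star> f) \<cdot> Braid C (Dom C f) (Dom C g)"
  by (rule braid_natural) (use assms in \<open>auto simp: in_Hom\<close>)

text \<open>The crossing of the first two strands of \<open>x \<otimes> (y \<otimes> w)\<close>.\<close>

definition braid_at :: "'o \<Rightarrow> 'o \<Rightarrow> 'o \<Rightarrow> 'm" where
  "braid_at x y w = Assoc C y x w \<cdot> (Braid C x y \<star> Ident C w) \<cdot> inv_arr C (Assoc C x y w)"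

lemma braid_at_simps [simp]:
  assumes "x \<in> Obj C" "y \<in> Obj C" "w \<in> Obj C"
  shows "braid_at x y w \<in> Arr C" "Dom C (braid_at x y w) = x \<boxtimes> (y \<boxtimes> w)"
    "Cod C (braid_at x y w) = y \<boxtimes> (x \<boxtimes> w)" "is_iso C (braid_at x y w)"
  using assms by (simp_all add: braid_at_def)

lemma braid_at_assoc:
  assumes "x \<in> Obj C" "y \<in> Obj C" "w \<in> Obj C"
  shows "braid_at x y w \<cdot> Assoc C x y w = Assoc C y x w \<cdot> (Braid C x y \<star> Ident C w)"
  using assms by (simp add: braid_at_def)

lemma braid_at_nat:
  assumes [simp]: "x \<in> Obj C" "y \<in> Obj C" "k \<in> Arr C"
  shows "braid_at x y (Cod C k) \<cdot> (x \<triangleright> y \<triangleright> k) = (y \<triangleright> x \<triangleright> k) \<cdot> braid_at x y (Dom C k)"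
proof -
  have "braid_at x y (Cod C k) \<cdot> (x \<triangleright> y \<triangleright> k) = Assoc C y x (Cod C k) \<cdot> (Braid C x y \<star> Ident C (Cod C k)) \<cdot>
      (inv_arr C (Assoc C x y (Cod C k)) \<cdot> (x \<triangleright> y \<triangleright> k))"
    by (simp add: braid_at_def)
  also have "\<dots> = (Assoc C y x (Cod C k) \<cdot> (Ident C (y \<boxtimes> x) \<star> k)) \<cdot> (Braid C x y \<star> Ident C (Dom C k)) \<cdot>
      inv_arr C (Assoc C x y (Dom C k))"
    by (subst assoc_inv_whisker) (simp_all add: fuse)
  also have "\<dots> = (y \<triangleright> x \<triangleright> k) \<cdot> braid_at x y (Dom C k)"
    by (subst assoc_whisker) (simp_all add: braid_at_def)
  finally show ?thesis .
qed

lemma braid_at_nat_right: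
  assumes [simp]: "f \<in> Arr C" "v \<in> Obj C" "w \<in> Obj C"
  shows "braid_at v (Cod C f) w \<cdot> (v \<triangleright> (f \<star> Ident C w)) = (f \<star> Ident C (v \<boxtimes> w)) \<cdot> braid_at v (Dom C f) w"
proof -
  have "braid_at v (Cod C f) w \<cdot> (v \<triangleright> (f \<star> Ident C w)) =
      Assoc C (Cod C f) v w \<cdot> ((Braid C v (Cod C f) \<cdot> (v \<triangleright> f)) \<star> Ident C w) \<cdot> inv_arr C (Assoc C v (Dom C f) w)"
    using assoc_inv_nat[of "Ident C v" f "Ident C w"] by (simp add: braid_at_def fuse)
  also have "Braid C v (Cod C f) \<cdot> (v \<triangleright> f) = (f \<star> Ident C v) \<cdot> Braid C v (Dom C f)"
    using braid_nat[of "Ident C v" f] by simp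
  also have "Assoc C (Cod C f) v w \<cdot> (((f \<star> Ident C v) \<cdot> Braid C v (Dom C f)) \<star> Ident C w) \<cdot> inv_arr C (Assoc C v (Dom C f) w) =
      (Assoc C (Cod C f) v w \<cdot> ((f \<star> Ident C v) \<star> Ident C w)) \<cdot> (Braid C v (Dom C f) \<star> Ident C w) \<cdot> inv_arr C (Assoc C v (Dom C f) w)"
    by (simp add: fuse)
  also have "\<dots> = (f \<star> Ident C (v \<boxtimes> w)) \<cdot> braid_at v (Dom C f) w"
    using assoc_nat[of f "Ident C v" "Ident C w"] by (simp add: braid_at_def)
  finally show ?thesis .
qed

lemma braid_at_nat_left:
  assumes [simp]: "f \<in> Arr C" "v \<in> Obj C" "w \<in> Obj C"
  shows "braid_at (Cod C f) v w \<cdot> (f \<star> Ident C (v \<boxtimes> w)) = (v \<triangleright> (f \<star> Ident C w)) \<cdot> braid_at (Dom C f) v w"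
proof -
  have "braid_at (Cod C f) v w \<cdot> (f \<star> Ident C (v \<boxtimes> w)) =
      Assoc C v (Cod C f) w \<cdot> ((Braid C (Cod C f) v \<cdot> (f \<star> Ident C v)) \<star> Ident C w) \<cdot> inv_arr C (Assoc C (Dom C f) v w)"
    using assoc_inv_nat[of f "Ident C v" "Ident C w"] by (simp add: braid_at_def fuse)
  also have "Braid C (Cod C f) v \<cdot> (f \<star> Ident C v) = (v \<triangleright> f) \<cdot> Braid C (Dom C f) v"
    using braid_nat[of f "Ident C v"] by simp
  also have "Assoc C v (Cod C f) w \<cdot> (((v \<triangleright> f) \<cdot> Braid C (Dom C f) v) \<star> Ident C w) \<cdot> inv_arr C (Assoc C (Dom C f) v w) =
      (Assoc C v (Cod C f) w \<cdot> ((v \<triangleright> f) \<star> Ident C w)) \<cdot> (Braid C (Dom C f) v \<star> Ident C w) \<cdot> inv_arr C (Assoc C (Dom C f) v w)"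
    by (simp add: fuse)
  also have "\<dots> = (v \<triangleright> (f \<star> Ident C w)) \<cdot> braid_at (Dom C f) v w"
    using assoc_nat[of "Ident C v" f "Ident C w"] by (simp add: braid_at_def)
  finally show ?thesis .
qed

text \<open>This lemma and the next one are the hexagons whiskered by \<open>w\<close>. Both sides are composed with an
  isomorphism that brings three pentagons into play.\<close>

lemma braid_at_tensor_right:
  assumes [simp]: "v \<in> Obj C" "x \<in> Obj C" "y \<in> Obj C" "w \<in> Obj C"
  shows "Assoc C x y (v \<boxtimes> w) \<cdot> braid_at v (x \<boxtimes> y) w =
    (x \<triangleright> braid_at v y w) \<cdot> braid_at v x (y \<boxtimes> w) \<cdot> (v \<triangleright> Assoc C x y w)" (is "?L = ?R")
proof -
  let ?i = "Ident C w"
  let ?m = "Assoc C v (x \<boxtimes> y) w \<cdot> (Assoc C v x y \<star> ?i)"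
  have "?R \<cdot> ?m = (x \<triangleright> braid_at v y w) \<cdot> braid_at v x (y \<boxtimes> w) \<cdot>
      ((v \<triangleright> Assoc C x y w) \<cdot> Assoc C v (x \<boxtimes> y) w \<cdot> (Assoc C v x y \<star> ?i))"
    by simp
  also have "\<dots> = (x \<triangleright> braid_at v y w) \<cdot> (braid_at v x (y \<boxtimes> w) \<cdot> Assoc C v x (y \<boxtimes> w)) \<cdot> Assoc C (v \<boxtimes> x) y w"
    by (subst pentagon[symmetric]) simp_all
  also have "\<dots> = (x \<triangleright> braid_at v y w) \<cdot> Assoc C x v (y \<boxtimes> w) \<cdot> ((Braid C v x \<star> Ident C (y \<boxtimes> w)) \<cdot> Assoc C (v \<boxtimes> x) y w)"
    by (subst braid_at_assoc) simp_all
  also have "(Braid C v x \<star> Ident C (y \<boxtimes> w)) \<cdot> Assoc C (v \<boxtimes> x) y w = Assoc C (x \<boxtimes> v) y w \<cdot> ((Braid C v x \<star> Ident C y) \<star> ?i)"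
    using assoc_nat[of "Braid C v x" "Ident C y" ?i] by simp
  also have "(x \<triangleright> braid_at v y w) \<cdot> Assoc C x v (y \<boxtimes> w) \<cdot> (Assoc C (x \<boxtimes> v) y w \<cdot> ((Braid C v x \<star> Ident C y) \<star> ?i)) =
      (x \<triangleright> braid_at v y w) \<cdot> (Assoc C x v (y \<boxtimes> w) \<cdot> Assoc C (x \<boxtimes> v) y w) \<cdot> ((Braid C v x \<star> Ident C y) \<star> ?i)"
    by simp
  also have "\<dots> = (x \<triangleright> (braid_at v y w \<cdot> Assoc C v y w)) \<cdot> Assoc C x (v \<boxtimes> y) w \<cdot> ((Assoc C x v y \<cdot> (Braid C v x \<star> Ident C y)) \<star> ?i)"
    by (subst pentagon) (simp_all add: fuse)
  also have "\<dots> = (x \<triangleright> Assoc C y v w) \<cdot> ((x \<triangleright> (Braid C v y \<star> ?i)) \<cdot> Assoc C x (v \<boxtimes> y) w) \<cdot> ((Assoc C x v y \<cdot> (Braid C v x \<star> Ident C y)) \<star> ?i)"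
    by (subst braid_at_assoc) (simp_all add: fuse)
  also have "(x \<triangleright> (Braid C v y \<star> ?i)) \<cdot> Assoc C x (v \<boxtimes> y) w = Assoc C x (y \<boxtimes> v) w \<cdot> ((x \<triangleright> Braid C v y) \<star> ?i)"
    using assoc_nat[of "Ident C x" "Braid C v y" ?i] by simp
  also have "(x \<triangleright> Assoc C y v w) \<cdot> (Assoc C x (y \<boxtimes> v) w \<cdot> ((x \<triangleright> Braid C v y) \<star> ?i)) \<cdot> ((Assoc C x v y \<cdot> (Braid C v x \<star> Ident C y)) \<star> ?i) =
      (x \<triangleright> Assoc C y v w) \<cdot> Assoc C x (y \<boxtimes> v) w \<cdot> (((x \<triangleright> Braid C v y) \<cdot> Assoc C x v y \<cdot> (Braid C v x \<star> Ident C y)) \<star> ?i)"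
    by (simp add: fuse)
  also have "\<dots> = (x \<triangleright> Assoc C y v w) \<cdot> Assoc C x (y \<boxtimes> v) w \<cdot> ((Assoc C x y v \<cdot> Braid C v (x \<boxtimes> y) \<cdot> Assoc C v x y) \<star> ?i)"
    by (subst hexagon1) simp_all
  also have "\<dots> = ((x \<triangleright> Assoc C y v w) \<cdot> Assoc C x (y \<boxtimes> v) w \<cdot> (Assoc C x y v \<star> ?i)) \<cdot> ((Braid C v (x \<boxtimes> y) \<cdot> Assoc C v x y) \<star> ?i)"
    by (simp add: fuse)
  also have "\<dots> = Assoc C x y (v \<boxtimes> w) \<cdot> (Assoc C (x \<boxtimes> y) v w \<cdot> (Braid C v (x \<boxtimes> y) \<star> ?i)) \<cdot> (Assoc C v x y \<star> ?i)"
    by (subst pentagon[symmetric]) (simp_all add: fuse)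
  also have "\<dots> = ?L \<cdot> ?m"
    by (subst braid_at_assoc[symmetric]) simp_all
  finally show ?thesis
    by (subst (asm) iso_cancel_right) simp_all
qed

lemma braid_at_tensor_left:
  assumes [simp]: "v \<in> Obj C" "x \<in> Obj C" "y \<in> Obj C" "w \<in> Obj C"
  shows "(v \<triangleright> Assoc C x y w) \<cdot> braid_at (x \<boxtimes> y) v w =
    braid_at x v (y \<boxtimes> w) \<cdot> (x \<triangleright> braid_at y v w) \<cdot> Assoc C x y (v \<boxtimes> w)" (is "?L = ?R")
proof -
  let ?i = "Ident C w"
  let ?n = "Assoc C (x \<boxtimes> y) v w \<cdot> (inv_arr C (Assoc C x y v) \<star> ?i)"
  have pent: "Assoc C p q (r \<boxtimes> w) \<cdot> Assoc C (p \<boxtimes> q) r w \<cdot> (inv_arr C (Assoc C p q r) \<star> ?i) =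
      (p \<triangleright> Assoc C q r w) \<cdot> Assoc C p (q \<boxtimes> r) w" if [simp]: "p \<in> Obj C" "q \<in> Obj C" "r \<in> Obj C" for p q r
    by (subst pentagon) (simp_all add: fuse)
  have hex: "Braid C (x \<boxtimes> y) v \<cdot> inv_arr C (Assoc C x y v) =
      Assoc C v x y \<cdot> ((Braid C x v \<star> Ident C y) \<cdot> inv_arr C (Assoc C x v y) \<cdot> (x \<triangleright> Braid C y v))"
    by (subst hexagon2[symmetric]) simp_all
  have "?L \<cdot> ?n = (v \<triangleright> Assoc C x y w) \<cdot> (braid_at (x \<boxtimes> y) v w \<cdot> Assoc C (x \<boxtimes> y) v w) \<cdot> (inv_arr C (Assoc C x y v) \<star> ?i)"
    by simp
  also have "\<dots> = (v \<triangleright> Assoc C x y w) \<cdot> Assoc C v (x \<boxtimes> y) w \<cdot> ((Braid C (x \<boxtimes> y) v \<cdot> inv_arr C (Assoc C x y v)) \<star> ?i)"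
    by (subst braid_at_assoc) (simp_all add: fuse)
  also have "\<dots> = ((v \<triangleright> Assoc C x y w) \<cdot> Assoc C v (x \<boxtimes> y) w \<cdot> (Assoc C v x y \<star> ?i)) \<cdot>
      (((Braid C x v \<star> Ident C y) \<cdot> inv_arr C (Assoc C x v y) \<cdot> (x \<triangleright> Braid C y v)) \<star> ?i)"
    unfolding hex by (simp add: fuse)
  also have "\<dots> = Assoc C v x (y \<boxtimes> w) \<cdot> (Assoc C (v \<boxtimes> x) y w \<cdot> ((Braid C x v \<star> Ident C y) \<star> ?i)) \<cdot>
      ((inv_arr C (Assoc C x v y) \<cdot> (x \<triangleright> Braid C y v)) \<star> ?i)"
    by (subst pentagon[symmetric]) (simp_all add: fuse)
  also have "Assoc C (v \<boxtimes> x) y w \<cdot> ((Braid C x v \<star> Ident C y) \<star> ?i) = (Braid C x v \<star> Ident C (y \<boxtimes> w)) \<cdot> Assoc C (x \<boxtimes> v) y w"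
    using assoc_nat[of "Braid C x v" "Ident C y" ?i] by simp
  also have "Assoc C v x (y \<boxtimes> w) \<cdot> ((Braid C x v \<star> Ident C (y \<boxtimes> w)) \<cdot> Assoc C (x \<boxtimes> v) y w) \<cdot>
      ((inv_arr C (Assoc C x v y) \<cdot> (x \<triangleright> Braid C y v)) \<star> ?i) =
      (Assoc C v x (y \<boxtimes> w) \<cdot> (Braid C x v \<star> Ident C (y \<boxtimes> w))) \<cdot> Assoc C (x \<boxtimes> v) y w \<cdot>
      (inv_arr C (Assoc C x v y) \<star> ?i) \<cdot> ((x \<triangleright> Braid C y v) \<star> ?i)"
    by (simp add: fuse)
  also have "\<dots> = braid_at x v (y \<boxtimes> w) \<cdot> (Assoc C x v (y \<boxtimes> w) \<cdot> Assoc C (x \<boxtimes> v) y w \<cdot>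
      (inv_arr C (Assoc C x v y) \<star> ?i)) \<cdot> ((x \<triangleright> Braid C y v) \<star> ?i)"
    by (subst braid_at_assoc[symmetric]) simp_all
  also have "\<dots> = braid_at x v (y \<boxtimes> w) \<cdot> (x \<triangleright> Assoc C v y w) \<cdot> (Assoc C x (v \<boxtimes> y) w \<cdot> ((x \<triangleright> Braid C y v) \<star> ?i))"
    by (subst pent) simp_all
  also have "Assoc C x (v \<boxtimes> y) w \<cdot> ((x \<triangleright> Braid C y v) \<star> ?i) = (x \<triangleright> (Braid C y v \<star> ?i)) \<cdot> Assoc C x (y \<boxtimes> v) w"
    using assoc_nat[of "Ident C x" "Braid C y v" ?i] by simp
  also have "braid_at x v (y \<boxtimes> w) \<cdot> (x \<triangleright> Assoc C v y w) \<cdot> ((x \<triangleright> (Braid C y v \<star> ?i)) \<cdot> Assoc C x (y \<boxtimes> v) w) =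
      braid_at x v (y \<boxtimes> w) \<cdot> (x \<triangleright> (Assoc C v y w \<cdot> (Braid C y v \<star> ?i))) \<cdot> Assoc C x (y \<boxtimes> v) w"
    by (simp add: fuse)
  also have "\<dots> = braid_at x v (y \<boxtimes> w) \<cdot> (x \<triangleright> braid_at y v w) \<cdot> ((x \<triangleright> Assoc C y v w) \<cdot> Assoc C x (y \<boxtimes> v) w)"
    by (subst braid_at_assoc[symmetric]) (simp_all add: fuse)
  also have "\<dots> = ?R \<cdot> ?n"
    by (subst pent[symmetric]) simp_all
  finally show ?thesis
    by (subst (asm) iso_cancel_right) simp_all
qed

text \<open>By naturality along the isomorphism \<open>1 \<otimes> 1 \<rightarrow> 1\<close>, crossing the unit once equals crossing it twice;
  since the crossing is invertible, it is trivial.\<close>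

lemma braid_at_unit_right:
  assumes [simp]: "v \<in> Obj C" "w \<in> Obj C"
  shows "LUnit C (v \<boxtimes> w) \<cdot> braid_at v (TUnit C) w = v \<triangleright> LUnit C w"
proof -
  let ?I = "TUnit C"
  have t: "RUnit C ?I \<star> Ident C u = (?I \<triangleright> LUnit C u) \<cdot> Assoc C ?I ?I u" if "u \<in> Obj C" for u
    using triangle[of ?I u] that by simp
  have "braid_at v ?I w \<cdot> (v \<triangleright> ?I \<triangleright> LUnit C w) \<cdot> (v \<triangleright> Assoc C ?I ?I w) =
      braid_at v ?I w \<cdot> (v \<triangleright> (RUnit C ?I \<star> Ident C w))"
    by (simp add: t fuse)
  also have "\<dots> = (RUnit C ?I \<star> Ident C (v \<boxtimes> w)) \<cdot> braid_at v (?I \<boxtimes> ?I) w"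
    using braid_at_nat_right[of "RUnit C ?I" v w] by simp
  also have "\<dots> = (?I \<triangleright> LUnit C (v \<boxtimes> w)) \<cdot> (Assoc C ?I ?I (v \<boxtimes> w) \<cdot> braid_at v (?I \<boxtimes> ?I) w)"
    by (simp add: t)
  also have "\<dots> = (?I \<triangleright> (LUnit C (v \<boxtimes> w) \<cdot> braid_at v ?I w)) \<cdot> braid_at v ?I (?I \<boxtimes> w) \<cdot> (v \<triangleright> Assoc C ?I ?I w)"
    by (subst braid_at_tensor_right) (simp_all add: fuse)
  finally have "braid_at v ?I w \<cdot> (v \<triangleright> ?I \<triangleright> LUnit C w) =
      (?I \<triangleright> (LUnit C (v \<boxtimes> w) \<cdot> braid_at v ?I w)) \<cdot> braid_at v ?I (?I \<boxtimes> w)"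
    by (subst (asm) iso_cancel_right) simp_all
  moreover have "braid_at v ?I w \<cdot> (v \<triangleright> ?I \<triangleright> LUnit C w) = (?I \<triangleright> v \<triangleright> LUnit C w) \<cdot> braid_at v ?I (?I \<boxtimes> w)"
    using braid_at_nat[of v ?I "LUnit C w"] by simp
  ultimately have "(?I \<triangleright> (LUnit C (v \<boxtimes> w) \<cdot> braid_at v ?I w)) \<cdot> braid_at v ?I (?I \<boxtimes> w) =
      (?I \<triangleright> v \<triangleright> LUnit C w) \<cdot> braid_at v ?I (?I \<boxtimes> w)" by simp
  then have "?I \<triangleright> (LUnit C (v \<boxtimes> w) \<cdot> braid_at v ?I w) = ?I \<triangleright> v \<triangleright> LUnit C w"
    by (subst (asm) iso_cancel_right) simp_all
  then show ?thesis by (rule unit_whisker_faithful[rotated 4]) simp_all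
qed

lemma braid_at_unit_left:
  assumes [simp]: "v \<in> Obj C" "w \<in> Obj C"
  shows "(v \<triangleright> LUnit C w) \<cdot> braid_at (TUnit C) v w = LUnit C (v \<boxtimes> w)"
proof -
  let ?I = "TUnit C"
  have t: "RUnit C ?I \<star> Ident C u = (?I \<triangleright> LUnit C u) \<cdot> Assoc C ?I ?I u" if "u \<in> Obj C" for u
    using triangle[of ?I u] that by simp
  have "(braid_at ?I v w \<cdot> (?I \<triangleright> LUnit C (v \<boxtimes> w))) \<cdot> Assoc C ?I ?I (v \<boxtimes> w) =
      braid_at ?I v w \<cdot> (RUnit C ?I \<star> Ident C (v \<boxtimes> w))"
    by (simp add: t fuse)
  also have "\<dots> = (v \<triangleright> (RUnit C ?I \<star> Ident C w)) \<cdot> braid_at (?I \<boxtimes> ?I) v w"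
    using braid_at_nat_left[of "RUnit C ?I" v w] by simp
  also have "\<dots> = (v \<triangleright> ?I \<triangleright> LUnit C w) \<cdot> ((v \<triangleright> Assoc C ?I ?I w) \<cdot> braid_at (?I \<boxtimes> ?I) v w)"
    by (simp add: t fuse)
  also have "\<dots> = ((v \<triangleright> ?I \<triangleright> LUnit C w) \<cdot> braid_at ?I v (?I \<boxtimes> w)) \<cdot> (?I \<triangleright> braid_at ?I v w) \<cdot> Assoc C ?I ?I (v \<boxtimes> w)"
    by (subst braid_at_tensor_left) (simp_all add: fuse)
  also have "(v \<triangleright> ?I \<triangleright> LUnit C w) \<cdot> braid_at ?I v (?I \<boxtimes> w) = braid_at ?I v w \<cdot> (?I \<triangleright> v \<triangleright> LUnit C w)"
    using braid_at_nat[of ?I v "LUnit C w"] by simp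
  also have "(braid_at ?I v w \<cdot> (?I \<triangleright> v \<triangleright> LUnit C w)) \<cdot> (?I \<triangleright> braid_at ?I v w) \<cdot> Assoc C ?I ?I (v \<boxtimes> w) =
      (braid_at ?I v w \<cdot> (?I \<triangleright> ((v \<triangleright> LUnit C w) \<cdot> braid_at ?I v w))) \<cdot> Assoc C ?I ?I (v \<boxtimes> w)"
    by (simp add: fuse)
  finally have "braid_at ?I v w \<cdot> (?I \<triangleright> LUnit C (v \<boxtimes> w)) = braid_at ?I v w \<cdot> (?I \<triangleright> ((v \<triangleright> LUnit C w) \<cdot> braid_at ?I v w))"
    by (subst (asm) iso_cancel_right) simp_all
  then have "?I \<triangleright> LUnit C (v \<boxtimes> w) = ?I \<triangleright> ((v \<triangleright> LUnit C w) \<cdot> braid_at ?I v w)"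
    by (subst (asm) iso_cancel_left) simp_all
  then have "LUnit C (v \<boxtimes> w) = (v \<triangleright> LUnit C w) \<cdot> braid_at ?I v w"
    by (rule unit_whisker_faithful[rotated 4]) simp_all
  then show ?thesis by simp
qed

lemma coev_at_simps:
  assumes "h \<in> Hom C (TUnit C) (x \<boxtimes> y)" "x \<in> Obj C" "y \<in> Obj C" "w \<in> Obj C"
  shows "coev_at x y h w \<in> Arr C" "Dom C (coev_at x y h w) = w" "Cod C (coev_at x y h w) = x \<boxtimes> (y \<boxtimes> w)"
  using assms by (simp_all add: coev_at_def in_Hom)

text \<open>The strand \<open>v\<close> can be pulled across any arrow out of the unit, because it crosses the unit trivially.
  The arrow \<open>h\<close> need not be a coevaluation: a twisted one occurs in the proof of
  \<open>qdim_tensor\<close>.\<close>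

lemma slide_through_coev:
  assumes h: "h \<in> Hom C (TUnit C) (x \<boxtimes> y)" and [simp]: "x \<in> Obj C" "y \<in> Obj C" "v \<in> Obj C" "w \<in> Obj C"
  shows "(x \<triangleright> braid_at v y w) \<cdot> braid_at v x (y \<boxtimes> w) \<cdot> (v \<triangleright> coev_at x y h w) = coev_at x y h (v \<boxtimes> w)"
proof -
  let ?I = "TUnit C"
  have [simp]: "h \<in> Arr C" "Dom C h = ?I" "Cod C h = x \<boxtimes> y" using h by (auto simp: in_Hom)
  have u: "braid_at v ?I w \<cdot> (v \<triangleright> inv_arr C (LUnit C w)) = inv_arr C (LUnit C (v \<boxtimes> w))"
  proof -
    have "braid_at v ?I w \<cdot> (v \<triangleright> inv_arr C (LUnit C w)) =
        inv_arr C (LUnit C (v \<boxtimes> w)) \<cdot> (LUnit C (v \<boxtimes> w) \<cdot> braid_at v ?I w) \<cdot> (v \<triangleright> inv_arr C (LUnit C w))" by simp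
    also have "\<dots> = inv_arr C (LUnit C (v \<boxtimes> w))" by (subst braid_at_unit_right) (simp_all add: fuse)
    finally show ?thesis .
  qed
  have "(x \<triangleright> braid_at v y w) \<cdot> braid_at v x (y \<boxtimes> w) \<cdot> (v \<triangleright> coev_at x y h w) =
      ((x \<triangleright> braid_at v y w) \<cdot> braid_at v x (y \<boxtimes> w) \<cdot> (v \<triangleright> Assoc C x y w)) \<cdot> (v \<triangleright> (h \<star> Ident C w)) \<cdot> (v \<triangleright> inv_arr C (LUnit C w))"
    by (simp add: coev_at_def fuse)
  also have "\<dots> = Assoc C x y (v \<boxtimes> w) \<cdot> (braid_at v (x \<boxtimes> y) w \<cdot> (v \<triangleright> (h \<star> Ident C w))) \<cdot> (v \<triangleright> inv_arr C (LUnit C w))"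
    by (subst braid_at_tensor_right[symmetric]) simp_all
  also have "braid_at v (x \<boxtimes> y) w \<cdot> (v \<triangleright> (h \<star> Ident C w)) = (h \<star> Ident C (v \<boxtimes> w)) \<cdot> braid_at v ?I w"
    using braid_at_nat_right[of h v w] by simp
  also have "Assoc C x y (v \<boxtimes> w) \<cdot> ((h \<star> Ident C (v \<boxtimes> w)) \<cdot> braid_at v ?I w) \<cdot> (v \<triangleright> inv_arr C (LUnit C w)) =
      Assoc C x y (v \<boxtimes> w) \<cdot> (h \<star> Ident C (v \<boxtimes> w)) \<cdot> (braid_at v ?I w \<cdot> (v \<triangleright> inv_arr C (LUnit C w)))"
    by simp
  also have "\<dots> = coev_at x y h (v \<boxtimes> w)" unfolding u by (simp add: coev_at_def)
  finally show ?thesis .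
qed

lemma slide_through_ev:
  assumes d: "is_dual C x y ev coev" and [simp]: "v \<in> Obj C" "w \<in> Obj C"
  shows "ev_at x y ev (v \<boxtimes> w) \<cdot> (y \<triangleright> braid_at v x w) \<cdot> braid_at v y (x \<boxtimes> w) = v \<triangleright> ev_at x y ev w"
proof -
  note [simp] = dual_simps[OF d]
  let ?I = "TUnit C"
  have "((y \<triangleright> braid_at v x w) \<cdot> braid_at v y (x \<boxtimes> w)) \<cdot> (v \<triangleright> Assoc C y x w) = Assoc C y x (v \<boxtimes> w) \<cdot> braid_at v (y \<boxtimes> x) w"
    by (subst braid_at_tensor_right) simp_all
  then have "((y \<triangleright> braid_at v x w) \<cdot> braid_at v y (x \<boxtimes> w)) \<cdot> (v \<triangleright> Assoc C y x w) \<cdot> (v \<triangleright> inv_arr C (Assoc C y x w)) =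
      Assoc C y x (v \<boxtimes> w) \<cdot> braid_at v (y \<boxtimes> x) w \<cdot> (v \<triangleright> inv_arr C (Assoc C y x w))"
    by simp
  then have s: "(y \<triangleright> braid_at v x w) \<cdot> braid_at v y (x \<boxtimes> w) =
      Assoc C y x (v \<boxtimes> w) \<cdot> braid_at v (y \<boxtimes> x) w \<cdot> (v \<triangleright> inv_arr C (Assoc C y x w))"
    by (simp add: fuse)
  have "ev_at x y ev (v \<boxtimes> w) \<cdot> (y \<triangleright> braid_at v x w) \<cdot> braid_at v y (x \<boxtimes> w) =
      ev_at x y ev (v \<boxtimes> w) \<cdot> ((y \<triangleright> braid_at v x w) \<cdot> braid_at v y (x \<boxtimes> w))"
    using ev_at_simps[OF d] by simp
  also have "\<dots> = LUnit C (v \<boxtimes> w) \<cdot> ((ev \<star> Ident C (v \<boxtimes> w)) \<cdot> braid_at v (y \<boxtimes> x) w) \<cdot> (v \<triangleright> inv_arr C (Assoc C y x w))"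
    unfolding s by (simp add: ev_at_def)
  also have "(ev \<star> Ident C (v \<boxtimes> w)) \<cdot> braid_at v (y \<boxtimes> x) w = braid_at v ?I w \<cdot> (v \<triangleright> (ev \<star> Ident C w))"
    using braid_at_nat_right[of ev v w] by simp
  also have "LUnit C (v \<boxtimes> w) \<cdot> (braid_at v ?I w \<cdot> (v \<triangleright> (ev \<star> Ident C w))) \<cdot> (v \<triangleright> inv_arr C (Assoc C y x w)) =
      (LUnit C (v \<boxtimes> w) \<cdot> braid_at v ?I w) \<cdot> (v \<triangleright> (ev \<star> Ident C w)) \<cdot> (v \<triangleright> inv_arr C (Assoc C y x w))"
    by simp
  also have "\<dots> = v \<triangleright> ev_at x y ev w"
    by (subst braid_at_unit_right) (simp_all add: ev_at_def fuse)
  finally show ?thesis .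
qed

end

section \<open>Quantum traces\<close>

context fusion_category
begin

lemma tens_scale [simp]:
  assumes "f \<in> Arr C" "g \<in> Arr C"
  shows "Scale C a f \<star> g = Scale C a (f \<star> g)" "f \<star> Scale C a g = Scale C a (f \<star> g)"
  using tens_scale_left[of f "Dom C f" "Cod C f" g "Dom C g" "Cod C g" a]
    tens_scale_right[of f "Dom C f" "Cod C f" g "Dom C g" "Cod C g" a] assms
  by (auto simp: in_Hom)

end

context braided_fusion_category
begin

text \<open>A closed strand \<open>x\<close> carrying \<open>g\<close>, to the left of a strand \<open>w\<close>. For \<open>g\<close> the composite of the twist with
  \<open>f\<close> it is the quantum trace of \<open>f\<close> times the identity of \<open>w\<close>.\<close>

definition loop_at :: "'o \<Rightarrow> 'o \<Rightarrow> 'm \<Rightarrow> 'm \<Rightarrow> 'm \<Rightarrow> 'o \<Rightarrow> 'm" where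
  "loop_at x y ev coev g w =
    ev_at x y ev w \<cdot> braid_at x y w \<cdot> (g \<star> Ident C (y \<boxtimes> w)) \<cdot> coev_at x y coev w"

lemma loop_at_whisker:
  assumes d: "is_dual C x y ev coev" and g: "g \<in> Hom C x x" and [simp]: "w \<in> Obj C"
  shows "loop_at x y ev coev g w =
    LUnit C w \<cdot> ((ev \<cdot> Braid C x y \<cdot> (g \<star> Ident C y) \<cdot> coev) \<star> Ident C w) \<cdot> inv_arr C (LUnit C w)"
proof -
  note [simp] = dual_simps[OF d]
  have [simp]: "g \<in> Arr C" "Dom C g = x" "Cod C g = x" using g by (auto simp: in_Hom)
  have "loop_at x y ev coev g w = LUnit C w \<cdot> (ev \<star> Ident C w) \<cdot> (Braid C x y \<star> Ident C w) \<cdot>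
      (inv_arr C (Assoc C x y w) \<cdot> (g \<star> Ident C (y \<boxtimes> w))) \<cdot> Assoc C x y w \<cdot> (coev \<star> Ident C w) \<cdot> inv_arr C (LUnit C w)"
    by (simp add: loop_at_def ev_at_def braid_at_def coev_at_def)
  also have "inv_arr C (Assoc C x y w) \<cdot> (g \<star> Ident C (y \<boxtimes> w)) = ((g \<star> Ident C y) \<star> Ident C w) \<cdot> inv_arr C (Assoc C x y w)"
    using assoc_inv_nat[of g "Ident C y" "Ident C w"] by simp
  finally show ?thesis by (simp add: fuse)
qed

text \<open>A closed loop can be computed from any \<open>a\<close> and \<open>h\<close> that satisfy one zigzag identity in
  which a second strand \<open>z\<close> crosses the first leg of \<open>a\<close>. No dual object appears in that identity, so this
  gives the independence of the trace from the dual as well as the trace of a tensor product.\<close>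

lemma loop_at_eq:
  assumes d: "is_dual C z D ev coev" and g: "g \<in> Hom C z z"
    and a: "a \<in> Hom C w (z \<boxtimes> e)" and h: "h \<in> Hom C (z \<boxtimes> e) w" and e [simp]: "e \<in> Obj C"
    and zz: "(z \<triangleright> h) \<cdot> braid_at z z e \<cdot> (z \<triangleright> a) = Ident C (z \<boxtimes> w)"
  shows "loop_at z D ev coev g w = h \<cdot> (g \<star> Ident C e) \<cdot> a"
proof -
  note [simp] = dual_simps[OF d]
  have [simp]: "g \<in> Arr C" "Dom C g = z" "Cod C g = z" "a \<in> Arr C" "Dom C a = w" "Cod C a = z \<boxtimes> e"
    "h \<in> Arr C" "Dom C h = z \<boxtimes> e" "Cod C h = w" "w \<in> Obj C"
    using g a h Hom_objs[OF a] by (auto simp: in_Hom)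
  note [simp] = ev_at_simps[OF d]
  let ?ev = "ev_at z D ev" and ?co = "coev_at z D coev"
  let ?\<phi> = "?ev e \<cdot> (D \<triangleright> a)"
  have 1: "(z \<triangleright> ?\<phi>) \<cdot> ?co w = a"
  proof -
    have "(z \<triangleright> ?\<phi>) \<cdot> ?co w = (z \<triangleright> ?ev e) \<cdot> ((z \<triangleright> D \<triangleright> a) \<cdot> ?co w)" by (simp add: whisker_comp)
    also have "(z \<triangleright> D \<triangleright> a) \<cdot> ?co w = ?co (z \<boxtimes> e) \<cdot> a" using coev_at_nat[OF d, of a] by simp
    also have "(z \<triangleright> ?ev e) \<cdot> (?co (z \<boxtimes> e) \<cdot> a) = ((z \<triangleright> ?ev e) \<cdot> ?co (z \<boxtimes> e)) \<cdot> a" by simp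
    also have "\<dots> = a" by (subst zigzag_left[OF d]) simp_all
    finally show ?thesis .
  qed
  have 2: "h \<cdot> (z \<triangleright> ?\<phi>) = ?ev w \<cdot> braid_at z D w"
  proof -
    have "h \<cdot> (z \<triangleright> ?\<phi>) = h \<cdot> (z \<triangleright> ?ev e) \<cdot> (z \<triangleright> D \<triangleright> a)" by (simp add: whisker_comp)
    also have "\<dots> = h \<cdot> (?ev (z \<boxtimes> e) \<cdot> (D \<triangleright> braid_at z z e) \<cdot> braid_at z D (z \<boxtimes> e)) \<cdot> (z \<triangleright> D \<triangleright> a)"
      by (subst slide_through_ev[OF d]) simp_all
    also have "\<dots> = (h \<cdot> ?ev (z \<boxtimes> e)) \<cdot> (D \<triangleright> braid_at z z e) \<cdot> (braid_at z D (z \<boxtimes> e) \<cdot> (z \<triangleright> D \<triangleright> a))"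
      by simp
    also have "h \<cdot> ?ev (z \<boxtimes> e) = ?ev w \<cdot> (D \<triangleright> z \<triangleright> h)" using ev_at_nat[OF d, of h] by simp
    also have "braid_at z D (z \<boxtimes> e) \<cdot> (z \<triangleright> D \<triangleright> a) = (D \<triangleright> z \<triangleright> a) \<cdot> braid_at z D w"
      using braid_at_nat[of z D a] by simp
    also have "(?ev w \<cdot> (D \<triangleright> z \<triangleright> h)) \<cdot> (D \<triangleright> braid_at z z e) \<cdot> ((D \<triangleright> z \<triangleright> a) \<cdot> braid_at z D w) =
        ?ev w \<cdot> (D \<triangleright> ((z \<triangleright> h) \<cdot> braid_at z z e \<cdot> (z \<triangleright> a))) \<cdot> braid_at z D w"
      by (simp add: whisker_comp)
    also have "\<dots> = ?ev w \<cdot> braid_at z D w" unfolding zz by simp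
    finally show ?thesis .
  qed
  have "h \<cdot> (g \<star> Ident C e) \<cdot> a = h \<cdot> (g \<star> Ident C e) \<cdot> ((z \<triangleright> ?\<phi>) \<cdot> ?co w)" unfolding 1 ..
  also have "\<dots> = (h \<cdot> (z \<triangleright> ?\<phi>)) \<cdot> (g \<star> Ident C (D \<boxtimes> w)) \<cdot> ?co w" by (simp add: fuse)
  also have "\<dots> = loop_at z D ev coev g w" unfolding 2 by (simp add: loop_at_def)
  finally show ?thesis ..
qed

lemma loop_at_dual_independent:
  assumes d: "is_dual C z D ev coev" and d': "is_dual C z D' ev' coev'"
    and g: "g \<in> Hom C z z" and w [simp]: "w \<in> Obj C"
  shows "loop_at z D ev coev g w = loop_at z D' ev' coev' g w"
proof -
  note [simp] = dual_simps[OF d'] ev_at_simps[OF d']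
  let ?a = "coev_at z D' coev' w" and ?h = "ev_at z D' ev' w \<cdot> braid_at z D' w"
  have "(z \<triangleright> ?h) \<cdot> braid_at z z (D' \<boxtimes> w) \<cdot> (z \<triangleright> ?a) =
      (z \<triangleright> ev_at z D' ev' w) \<cdot> ((z \<triangleright> braid_at z D' w) \<cdot> braid_at z z (D' \<boxtimes> w) \<cdot> (z \<triangleright> ?a))"
    by (simp add: whisker_comp)
  also have "\<dots> = Ident C (z \<boxtimes> w)"
    by (subst slide_through_coev) (use d' in \<open>simp_all add: zigzag_left[OF d'] in_Hom\<close>)
  finally have "loop_at z D ev coev g w = ?h \<cdot> (g \<star> Ident C (D' \<boxtimes> w)) \<cdot> ?a"
    by (intro loop_at_eq[OF d g]) (auto simp: in_Hom)
  then show ?thesis using g by (auto simp: loop_at_def in_Hom)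
qed

end

context premodular_category
begin

lemma twist_simps [simp]:
  assumes "x \<in> Obj C"
  shows "Twist C x \<in> Arr C" "Dom C (Twist C x) = x" "Cod C (Twist C x) = x" "is_iso C (Twist C x)"
  using twist_hom[OF assms] twist_iso[OF assms] by (auto simp: in_Hom)

lemma unit_scalar_cancel: "Scale C a (Ident C (TUnit C)) = Scale C b (Ident C (TUnit C)) \<longleftrightarrow> a = b"
  using scale_cancel[of "Ident C (TUnit C)" a b] simple_ident_nonzero[OF unit_simple] by simp

lemma loop_scalar:
  assumes d: "is_dual C x y ev coev" and g: "g \<in> Hom C x x"
    and e: "ev \<cdot> Braid C x y \<cdot> (g \<star> Ident C y) \<cdot> coev = Scale C a (Ident C (TUnit C))" and w [simp]: "w \<in> Obj C"
  shows "loop_at x y ev coev g w = Scale C a (Ident C w)"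
  unfolding loop_at_whisker[OF d g w] e by simp

lemma qtrace_loop:
  assumes d: "is_dual C x y ev coev" and f: "f \<in> Hom C x x" and w: "w \<in> Obj C"
  shows "loop_at x y ev coev (Twist C x \<cdot> f) w = Scale C (qtrace C x f) (Ident C w)"
proof -
  let ?g = "Twist C x \<cdot> f"
  let ?P = "\<lambda>a y ev coev. is_dual C x y ev coev \<and>
     ev \<cdot> Braid C x y \<cdot> (?g \<star> Ident C y) \<cdot> coev = Scale C a (Ident C (TUnit C))"
  have g: "?g \<in> Hom C x x" using f dual_simps(1)[OF d] by (auto simp: in_Hom)
  have "ev \<cdot> Braid C x y \<cdot> (?g \<star> Ident C y) \<cdot> coev \<in> Hom C (TUnit C) (TUnit C)"
    using dual_simps[OF d] f by (auto simp: in_Hom)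
  then obtain a where a: "?P a y ev coev" using schur_scalar[OF unit_simple] d by blast
  have "qtrace C x f = a"
    unfolding qtrace_def
  proof (rule the_equality)
    show "\<exists>y ev coev. ?P a y ev coev" using a by blast
    fix a' assume "\<exists>y ev coev. ?P a' y ev coev"
    then obtain y' ev' coev' where a': "?P a' y' ev' coev'" by blast
    have "Scale C a (Ident C (TUnit C)) = Scale C a' (Ident C (TUnit C))"
      using loop_at_dual_independent[OF d _ g, of y' ev' coev' "TUnit C"] a a'
        loop_scalar[OF d g, of a "TUnit C"] loop_scalar[of x y' ev' coev' ?g a' "TUnit C"] g by simp
    then show "a' = a" by (simp add: unit_scalar_cancel)
  qed
  then show ?thesis using loop_scalar[OF d g _ w, of a] a by simp
qed

lemma qtrace_scale:
  assumes f: "f \<in> Hom C x x"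
  shows "qtrace C x (Scale C b f) = b * qtrace C x f"
proof -
  have x [simp]: "x \<in> Obj C" using f Hom_objs by blast
  obtain y ev coev where d: "is_dual C x y ev coev" using left_dual[OF x] by blast
  note [simp] = dual_simps[OF d] ev_at_simps[OF d]
  have fs [simp]: "f \<in> Arr C" "Dom C f = x" "Cod C f = x" using f by (auto simp: in_Hom)
  have sf: "Scale C b f \<in> Hom C x x" by (auto simp: in_Hom)
  have "loop_at x y ev coev (Twist C x \<cdot> Scale C b f) (TUnit C) = Scale C b (loop_at x y ev coev (Twist C x \<cdot> f) (TUnit C))"
    by (simp add: loop_at_def)
  then have "Scale C (qtrace C x (Scale C b f)) (Ident C (TUnit C)) = Scale C b (Scale C (qtrace C x f) (Ident C (TUnit C)))"
    unfolding qtrace_loop[OF d f tens_objs(2)] qtrace_loop[OF d sf tens_objs(2)] .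
  then show ?thesis by (simp add: unit_scalar_cancel)
qed

definition qdim :: "'o \<Rightarrow> 'k" where
  "qdim x = qtrace C x (Ident C x)"

lemma qdim_loop:
  assumes d: "is_dual C x y ev coev" and w: "w \<in> Obj C"
  shows "loop_at x y ev coev (Twist C x) w = Scale C (qdim x) (Ident C w)"
  using qtrace_loop[OF d _ w, of "Ident C x"] dual_simps(1)[OF d] by (simp add: qdim_def in_Hom)

text \<open>The closed loop of \<open>x \<otimes> y\<close> is evaluated by \<open>loop_at_eq\<close>, with \<open>a\<close> the coevaluation of \<open>y\<close> nested inside
  the one of \<open>x\<close> and \<open>b\<close> the corresponding nested evaluation. The twist of \<open>x \<otimes> y\<close> contributes the
  twists of \<open>x\<close> and \<open>y\<close> and two crossings. One crossing is used to pull the strand \<open>x\<close> out of the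
  coevaluation of \<open>y\<close>, the other one to pull the strand \<open>y\<close> out of the evaluation of \<open>x\<close>. What remains is the
  loop of \<open>x\<close> inside the loop of \<open>y\<close>.\<close>

lemma qdim_tensor:
  assumes x [simp]: "x \<in> Obj C" and y [simp]: "y \<in> Obj C"
  shows "qdim (x \<boxtimes> y) = qdim x * qdim y"
proof -
  obtain x' ex cx where dx: "is_dual C x x' ex cx" using left_dual[OF x] by blast
  obtain y' ey cy where dy: "is_dual C y y' ey cy" using left_dual[OF y] by blast
  obtain D e c where d: "is_dual C (x \<boxtimes> y) D e c" using left_dual[of "x \<boxtimes> y"] by auto
  note [simp] = dual_simps[OF dx] dual_simps[OF dy] ev_at_simps[OF dx] ev_at_simps[OF dy]
  let ?z = "x \<boxtimes> y" and ?w = "TUnit C"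
  let ?e = "y' \<boxtimes> (x' \<boxtimes> ?w)"
  let ?ex = "ev_at x x' ex" and ?cx = "coev_at x x' cx" and ?ey = "ev_at y y' ey" and ?cy = "coev_at y y' cy"
  have hx: "cx \<in> Hom C ?w (x \<boxtimes> x')" and hy: "cy \<in> Hom C ?w (y \<boxtimes> y')" by (simp_all add: in_Hom)
  define a where "a u = inv_arr C (Assoc C x y (y' \<boxtimes> (x' \<boxtimes> u))) \<cdot> (x \<triangleright> ?cy (x' \<boxtimes> u)) \<cdot> ?cx u" for u
  define s where "s v u = (y' \<triangleright> braid_at v x' u) \<cdot> braid_at v y' (x' \<boxtimes> u)" for v u
  define b where "b = ?ey ?w \<cdot> (y' \<triangleright> ?ex (y \<boxtimes> ?w)) \<cdot> (y' \<triangleright> x' \<triangleright> Assoc C x y ?w)"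
  have a_simps [simp]: "a u \<in> Arr C" "Dom C (a u) = u" "Cod C (a u) = ?z \<boxtimes> (y' \<boxtimes> (x' \<boxtimes> u))" if "u \<in> Obj C" for u
    using that by (simp_all add: a_def)
  have s_simps [simp]: "s v u \<in> Arr C" "Dom C (s v u) = v \<boxtimes> (y' \<boxtimes> (x' \<boxtimes> u))" "Cod C (s v u) = y' \<boxtimes> (x' \<boxtimes> (v \<boxtimes> u))"
    if "u \<in> Obj C" "v \<in> Obj C" for u v using that by (simp_all add: s_def)
  have b_simps [simp]: "b \<in> Arr C" "Dom C b = y' \<boxtimes> (x' \<boxtimes> (?z \<boxtimes> ?w))" "Cod C b = ?w"
    by (simp_all add: b_def)
  \<comment> \<open>A strand slides through the nested coevaluation, first past the inner and then past the
    outer pair.\<close>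
  have slide: "(?z \<triangleright> s v ?w) \<cdot> braid_at v ?z ?e \<cdot> (v \<triangleright> a ?w) = a (v \<boxtimes> ?w)" if [simp]: "v \<in> Obj C" for v
  proof -
    let ?A = "Assoc C x y"
    have "?A (y' \<boxtimes> (x' \<boxtimes> (v \<boxtimes> ?w))) \<cdot> ((?z \<triangleright> s v ?w) \<cdot> braid_at v ?z ?e \<cdot> (v \<triangleright> a ?w)) =
        (?A (y' \<boxtimes> (x' \<boxtimes> (v \<boxtimes> ?w))) \<cdot> (?z \<triangleright> s v ?w)) \<cdot> braid_at v ?z ?e \<cdot> (v \<triangleright> a ?w)" by simp
    also have "\<dots> = (x \<triangleright> y \<triangleright> s v ?w) \<cdot> (?A (v \<boxtimes> ?e) \<cdot> braid_at v ?z ?e) \<cdot> (v \<triangleright> a ?w)"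
      using assoc_whisker[of x y "s v ?w"] by simp
    also have "\<dots> = (x \<triangleright> y \<triangleright> s v ?w) \<cdot> (x \<triangleright> braid_at v y ?e) \<cdot> braid_at v x (y \<boxtimes> ?e) \<cdot> (v \<triangleright> (?A ?e \<cdot> a ?w))"
      by (subst braid_at_tensor_right) (simp_all add: whisker_comp)
    also have "\<dots> = (x \<triangleright> y \<triangleright> s v ?w) \<cdot> (x \<triangleright> braid_at v y ?e) \<cdot> (braid_at v x (y \<boxtimes> ?e) \<cdot> (v \<triangleright> x \<triangleright> ?cy (x' \<boxtimes> ?w))) \<cdot> (v \<triangleright> ?cx ?w)"
      by (simp add: a_def whisker_comp)
    also have "braid_at v x (y \<boxtimes> ?e) \<cdot> (v \<triangleright> x \<triangleright> ?cy (x' \<boxtimes> ?w)) = (x \<triangleright> v \<triangleright> ?cy (x' \<boxtimes> ?w)) \<cdot> braid_at v x (x' \<boxtimes> ?w)"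
      using braid_at_nat[of v x "?cy (x' \<boxtimes> ?w)"] by simp
    also have "(x \<triangleright> y \<triangleright> s v ?w) \<cdot> (x \<triangleright> braid_at v y ?e) \<cdot> ((x \<triangleright> v \<triangleright> ?cy (x' \<boxtimes> ?w)) \<cdot> braid_at v x (x' \<boxtimes> ?w)) \<cdot> (v \<triangleright> ?cx ?w) =
        (x \<triangleright> y \<triangleright> y' \<triangleright> braid_at v x' ?w) \<cdot> (x \<triangleright> ((y \<triangleright> braid_at v y' (x' \<boxtimes> ?w)) \<cdot> braid_at v y ?e \<cdot> (v \<triangleright> ?cy (x' \<boxtimes> ?w)))) \<cdot>
        braid_at v x (x' \<boxtimes> ?w) \<cdot> (v \<triangleright> ?cx ?w)"
      by (simp add: s_def whisker_comp)
    also have "\<dots> = (x \<triangleright> ((y \<triangleright> y' \<triangleright> braid_at v x' ?w) \<cdot> ?cy (v \<boxtimes> (x' \<boxtimes> ?w)))) \<cdot>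
        braid_at v x (x' \<boxtimes> ?w) \<cdot> (v \<triangleright> ?cx ?w)"
      by (subst slide_through_coev[OF hy]) (simp_all add: whisker_comp)
    also have "(y \<triangleright> y' \<triangleright> braid_at v x' ?w) \<cdot> ?cy (v \<boxtimes> (x' \<boxtimes> ?w)) = ?cy (x' \<boxtimes> (v \<boxtimes> ?w)) \<cdot> braid_at v x' ?w"
      using coev_at_nat[OF dy, of "braid_at v x' ?w"] by simp
    also have "(x \<triangleright> (?cy (x' \<boxtimes> (v \<boxtimes> ?w)) \<cdot> braid_at v x' ?w)) \<cdot> braid_at v x (x' \<boxtimes> ?w) \<cdot> (v \<triangleright> ?cx ?w) =
        (x \<triangleright> ?cy (x' \<boxtimes> (v \<boxtimes> ?w))) \<cdot> ((x \<triangleright> braid_at v x' ?w) \<cdot> braid_at v x (x' \<boxtimes> ?w) \<cdot> (v \<triangleright> ?cx ?w))"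
      by (simp add: whisker_comp)
    also have "\<dots> = ?A (y' \<boxtimes> (x' \<boxtimes> (v \<boxtimes> ?w))) \<cdot> a (v \<boxtimes> ?w)"
      by (subst slide_through_coev[OF hx]) (simp_all add: a_def)
    finally show ?thesis by (subst (asm) iso_cancel_left) simp_all
  qed
  have zig: "(?z \<triangleright> b) \<cdot> a (?z \<boxtimes> ?w) = Ident C (?z \<boxtimes> ?w)"
  proof -
    let ?A = "Assoc C x y ?w"
    let ?k = "?ex (y \<boxtimes> ?w) \<cdot> (x' \<triangleright> ?A)"
    have b: "b = ?ey ?w \<cdot> (y' \<triangleright> ?k)" by (simp add: b_def whisker_comp)
    have "?A \<cdot> ((?z \<triangleright> b) \<cdot> a (?z \<boxtimes> ?w)) = (?A \<cdot> (?z \<triangleright> b)) \<cdot> a (?z \<boxtimes> ?w)" by simp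
    also have "\<dots> = (x \<triangleright> y \<triangleright> b) \<cdot> (Assoc C x y (y' \<boxtimes> (x' \<boxtimes> (?z \<boxtimes> ?w))) \<cdot> a (?z \<boxtimes> ?w))"
      using assoc_whisker[of x y b] by simp
    also have "\<dots> = (x \<triangleright> ((y \<triangleright> ?ey ?w) \<cdot> ((y \<triangleright> y' \<triangleright> ?k) \<cdot> ?cy (x' \<boxtimes> (?z \<boxtimes> ?w))))) \<cdot> ?cx (?z \<boxtimes> ?w)"
      by (simp add: a_def b whisker_comp)
    also have "(y \<triangleright> y' \<triangleright> ?k) \<cdot> ?cy (x' \<boxtimes> (?z \<boxtimes> ?w)) = ?cy (y \<boxtimes> ?w) \<cdot> ?k"
      using coev_at_nat[OF dy, of ?k] by simp
    also have "(y \<triangleright> ?ey ?w) \<cdot> (?cy (y \<boxtimes> ?w) \<cdot> ?k) = ((y \<triangleright> ?ey ?w) \<cdot> ?cy (y \<boxtimes> ?w)) \<cdot> ?k" by simp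
    also have "\<dots> = ?k" by (subst zigzag_left[OF dy]) simp_all
    also have "(x \<triangleright> ?k) \<cdot> ?cx (?z \<boxtimes> ?w) = (x \<triangleright> ?ex (y \<boxtimes> ?w)) \<cdot> ((x \<triangleright> x' \<triangleright> ?A) \<cdot> ?cx (?z \<boxtimes> ?w))"
      by (simp add: whisker_comp)
    also have "(x \<triangleright> x' \<triangleright> ?A) \<cdot> ?cx (?z \<boxtimes> ?w) = ?cx (x \<boxtimes> (y \<boxtimes> ?w)) \<cdot> ?A"
      using coev_at_nat[OF dx, of ?A] by simp
    also have "(x \<triangleright> ?ex (y \<boxtimes> ?w)) \<cdot> (?cx (x \<boxtimes> (y \<boxtimes> ?w)) \<cdot> ?A) = ((x \<triangleright> ?ex (y \<boxtimes> ?w)) \<cdot> ?cx (x \<boxtimes> (y \<boxtimes> ?w))) \<cdot> ?A"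
      by simp
    also have "\<dots> = ?A \<cdot> Ident C (?z \<boxtimes> ?w)" by (subst zigzag_left[OF dx]) simp_all
    finally show ?thesis by (subst (asm) iso_cancel_left) simp_all
  qed
  let ?h = "b \<cdot> s ?z ?w"
  have "(?z \<triangleright> ?h) \<cdot> braid_at ?z ?z ?e \<cdot> (?z \<triangleright> a ?w) = (?z \<triangleright> b) \<cdot> ((?z \<triangleright> s ?z ?w) \<cdot> braid_at ?z ?z ?e \<cdot> (?z \<triangleright> a ?w))"
    by (simp add: whisker_comp)
  also have "\<dots> = Ident C (?z \<boxtimes> ?w)" by (subst slide) (simp_all add: zig)
  finally have loop: "loop_at ?z D e c (Twist C ?z) ?w = ?h \<cdot> (Twist C ?z \<star> Ident C ?e) \<cdot> a ?w"
    by (intro loop_at_eq[OF d]) (auto simp: in_Hom)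
  let ?cc = "Braid C x y" and ?cc' = "Braid C y x" and ?th = "Twist C x \<star> Twist C y"
  let ?z' = "y \<boxtimes> x"
  \<comment> \<open>One of the two crossings in the twist of the tensor product moves to the other side of the
    nested loop.\<close>
  have nat_s: "s ?z ?w \<cdot> (?cc' \<star> Ident C ?e) = (y' \<triangleright> x' \<triangleright> (?cc' \<star> Ident C ?w)) \<cdot> s ?z' ?w"
  proof -
    have "s ?z ?w \<cdot> (?cc' \<star> Ident C ?e) = (y' \<triangleright> braid_at ?z x' ?w) \<cdot> (braid_at ?z y' (x' \<boxtimes> ?w) \<cdot> (?cc' \<star> Ident C ?e))"
      by (simp add: s_def)
    also have "braid_at ?z y' (x' \<boxtimes> ?w) \<cdot> (?cc' \<star> Ident C ?e) = (y' \<triangleright> (?cc' \<star> Ident C (x' \<boxtimes> ?w))) \<cdot> braid_at ?z' y' (x' \<boxtimes> ?w)"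
      using braid_at_nat_left[of ?cc' y' "x' \<boxtimes> ?w"] by simp
    also have "(y' \<triangleright> braid_at ?z x' ?w) \<cdot> ((y' \<triangleright> (?cc' \<star> Ident C (x' \<boxtimes> ?w))) \<cdot> braid_at ?z' y' (x' \<boxtimes> ?w)) =
        (y' \<triangleright> (braid_at ?z x' ?w \<cdot> (?cc' \<star> Ident C (x' \<boxtimes> ?w)))) \<cdot> braid_at ?z' y' (x' \<boxtimes> ?w)"
      by (simp add: whisker_comp)
    also have "braid_at ?z x' ?w \<cdot> (?cc' \<star> Ident C (x' \<boxtimes> ?w)) = (x' \<triangleright> (?cc' \<star> Ident C ?w)) \<cdot> braid_at ?z' x' ?w"
      using braid_at_nat_left[of ?cc' x' ?w] by simp
    finally show ?thesis by (simp add: s_def whisker_comp)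
  qed
  \<comment> \<open>The strands \<open>y\<close> and \<open>x\<close> cross the two dual strands one after the other.\<close>
  have s_split: "(y' \<triangleright> x' \<triangleright> Assoc C y x ?w) \<cdot> s ?z' ?w =
      (y' \<triangleright> (braid_at y x' (x \<boxtimes> ?w) \<cdot> (y \<triangleright> braid_at x x' ?w))) \<cdot> braid_at y y' (x \<boxtimes> (x' \<boxtimes> ?w)) \<cdot> (y \<triangleright> braid_at x y' (x' \<boxtimes> ?w)) \<cdot> Assoc C y x ?e"
  proof -
    have "(y' \<triangleright> x' \<triangleright> Assoc C y x ?w) \<cdot> s ?z' ?w =
        (y' \<triangleright> ((x' \<triangleright> Assoc C y x ?w) \<cdot> braid_at ?z' x' ?w)) \<cdot> braid_at ?z' y' (x' \<boxtimes> ?w)"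
      by (simp add: s_def whisker_comp)
    also have "\<dots> = (y' \<triangleright> (braid_at y x' (x \<boxtimes> ?w) \<cdot> (y \<triangleright> braid_at x x' ?w))) \<cdot>
        ((y' \<triangleright> Assoc C y x (x' \<boxtimes> ?w)) \<cdot> braid_at ?z' y' (x' \<boxtimes> ?w))"
      by (subst braid_at_tensor_left) (simp_all add: whisker_comp)
    also have "\<dots> = (y' \<triangleright> (braid_at y x' (x \<boxtimes> ?w) \<cdot> (y \<triangleright> braid_at x x' ?w))) \<cdot> braid_at y y' (x \<boxtimes> (x' \<boxtimes> ?w)) \<cdot> (y \<triangleright> braid_at x y' (x' \<boxtimes> ?w)) \<cdot> Assoc C y x ?e"
      by (subst braid_at_tensor_left) simp_all
    finally show ?thesis .
  qed
  define px where "px = (Twist C x \<star> Ident C (x' \<boxtimes> ?w)) \<cdot> ?cx ?w"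
  define hy' where "hy' = (Twist C y \<star> Ident C y') \<cdot> cy"
  have hy': "hy' \<in> Hom C ?w (y \<boxtimes> y')" by (simp add: hy'_def in_Hom)
  have [simp]: "px \<in> Arr C" "Dom C px = ?w" "Cod C px = x \<boxtimes> (x' \<boxtimes> ?w)" by (simp_all add: px_def)
  \<comment> \<open>The coevaluation of \<open>y\<close> with the twist on it comes from a single arrow out of the unit, so
    strands can slide through it.\<close>
  have qy: "coev_at y y' hy' u = (Twist C y \<star> Ident C (y' \<boxtimes> u)) \<cdot> ?cy u" if [simp]: "u \<in> Obj C" for u
  proof -
    have "coev_at y y' hy' u = (Assoc C y y' u \<cdot> ((Twist C y \<star> Ident C y') \<star> Ident C u)) \<cdot> (cy \<star> Ident C u) \<cdot> inv_arr C (LUnit C u)"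
      by (simp add: coev_at_def hy'_def fuse)
    also have "Assoc C y y' u \<cdot> ((Twist C y \<star> Ident C y') \<star> Ident C u) = (Twist C y \<star> Ident C (y' \<boxtimes> u)) \<cdot> Assoc C y y' u"
      using assoc_nat[of "Twist C y" "Ident C y'" "Ident C u"] by simp
    finally show ?thesis by (simp add: coev_at_def)
  qed
  note qy_simps [simp] = coev_at_simps[OF hy']
  let ?q = "coev_at y y' hy'"
  have qy_nat: "?q (Cod C k) \<cdot> k = (y \<triangleright> y' \<triangleright> k) \<cdot> ?q (Dom C k)" if [simp]: "k \<in> Arr C" for k
  proof -
    have "?q (Cod C k) \<cdot> k = (Twist C y \<star> Ident C (y' \<boxtimes> Cod C k)) \<cdot> (?cy (Cod C k) \<cdot> k)" by (simp add: qy)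
    also have "\<dots> = (y \<triangleright> y' \<triangleright> k) \<cdot> ?q (Dom C k)" unfolding coev_at_nat[OF dy that] by (simp add: qy fuse)
    finally show ?thesis .
  qed
  have right: "Assoc C y x ?e \<cdot> (?cc \<star> Ident C ?e) \<cdot> (?th \<star> Ident C ?e) \<cdot> a ?w = braid_at x y ?e \<cdot> (x \<triangleright> ?q (x' \<boxtimes> ?w)) \<cdot> px"
  proof -
    have "(?th \<star> Ident C ?e) \<cdot> a ?w = (?th \<star> Ident C ?e) \<cdot> inv_arr C (Assoc C x y ?e) \<cdot> (x \<triangleright> ?cy (x' \<boxtimes> ?w)) \<cdot> ?cx ?w"
      by (simp add: a_def)
    also have "(?th \<star> Ident C ?e) \<cdot> inv_arr C (Assoc C x y ?e) = inv_arr C (Assoc C x y ?e) \<cdot> (Twist C x \<star> (Twist C y \<star> Ident C ?e))"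
      using assoc_inv_nat[of "Twist C x" "Twist C y" "Ident C ?e"] by simp
    also have "inv_arr C (Assoc C x y ?e) \<cdot> (Twist C x \<star> (Twist C y \<star> Ident C ?e)) \<cdot> (x \<triangleright> ?cy (x' \<boxtimes> ?w)) \<cdot> ?cx ?w =
        inv_arr C (Assoc C x y ?e) \<cdot> (x \<triangleright> ?q (x' \<boxtimes> ?w)) \<cdot> px"
      by (simp add: qy px_def fuse)
    finally show ?thesis by (simp add: braid_at_def)
  qed
  have left: "b \<cdot> (y' \<triangleright> x' \<triangleright> (?cc' \<star> Ident C ?w)) = ?ey ?w \<cdot> (y' \<triangleright> (?ex (y \<boxtimes> ?w) \<cdot> (x' \<triangleright> braid_at y x ?w))) \<cdot> (y' \<triangleright> x' \<triangleright> Assoc C y x ?w)"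
  proof -
    have "b \<cdot> (y' \<triangleright> x' \<triangleright> (?cc' \<star> Ident C ?w)) = ?ey ?w \<cdot> (y' \<triangleright> ?ex (y \<boxtimes> ?w)) \<cdot> (y' \<triangleright> x' \<triangleright> (Assoc C x y ?w \<cdot> (?cc' \<star> Ident C ?w)))"
      by (simp add: b_def whisker_comp)
    also have "\<dots> = ?ey ?w \<cdot> (y' \<triangleright> ?ex (y \<boxtimes> ?w)) \<cdot> (y' \<triangleright> x' \<triangleright> (braid_at y x ?w \<cdot> Assoc C y x ?w))"
      by (subst braid_at_assoc) simp_all
    finally show ?thesis by (simp add: whisker_comp)
  qed
  have "Scale C (qdim ?z) (Ident C ?w) = b \<cdot> s ?z ?w \<cdot> ((?cc' \<cdot> ?cc \<cdot> ?th) \<star> Ident C ?e) \<cdot> a ?w"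
    using loop qdim_loop[OF d, of ?w] twist_tens[of x y] by simp
  also have "\<dots> = b \<cdot> (s ?z ?w \<cdot> (?cc' \<star> Ident C ?e)) \<cdot> (?cc \<star> Ident C ?e) \<cdot> (?th \<star> Ident C ?e) \<cdot> a ?w"
    by (simp add: fuse)
  also have "\<dots> = (b \<cdot> (y' \<triangleright> x' \<triangleright> (?cc' \<star> Ident C ?w))) \<cdot> s ?z' ?w \<cdot> (?cc \<star> Ident C ?e) \<cdot> (?th \<star> Ident C ?e) \<cdot> a ?w"
    unfolding nat_s by simp
  also have "\<dots> = ?ey ?w \<cdot> (y' \<triangleright> (?ex (y \<boxtimes> ?w) \<cdot> (x' \<triangleright> braid_at y x ?w))) \<cdot> ((y' \<triangleright> x' \<triangleright> Assoc C y x ?w) \<cdot> s ?z' ?w) \<cdot>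
      (?cc \<star> Ident C ?e) \<cdot> (?th \<star> Ident C ?e) \<cdot> a ?w"
    unfolding left by simp
  also have "\<dots> = ?ey ?w \<cdot> (y' \<triangleright> (?ex (y \<boxtimes> ?w) \<cdot> (x' \<triangleright> braid_at y x ?w))) \<cdot>
      (y' \<triangleright> (braid_at y x' (x \<boxtimes> ?w) \<cdot> (y \<triangleright> braid_at x x' ?w))) \<cdot> braid_at y y' (x \<boxtimes> (x' \<boxtimes> ?w)) \<cdot> (y \<triangleright> braid_at x y' (x' \<boxtimes> ?w)) \<cdot>
      (Assoc C y x ?e \<cdot> (?cc \<star> Ident C ?e) \<cdot> (?th \<star> Ident C ?e) \<cdot> a ?w)"
    unfolding s_split by simp
  also have "\<dots> = ?ey ?w \<cdot> (y' \<triangleright> ((?ex (y \<boxtimes> ?w) \<cdot> (x' \<triangleright> braid_at y x ?w) \<cdot> braid_at y x' (x \<boxtimes> ?w)) \<cdot> (y \<triangleright> braid_at x x' ?w))) \<cdot>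
      braid_at y y' (x \<boxtimes> (x' \<boxtimes> ?w)) \<cdot> ((y \<triangleright> braid_at x y' (x' \<boxtimes> ?w)) \<cdot> braid_at x y ?e \<cdot> (x \<triangleright> ?q (x' \<boxtimes> ?w))) \<cdot> px"
    unfolding right by (simp add: whisker_comp)
  also have "\<dots> = ?ey ?w \<cdot> (y' \<triangleright> ((y \<triangleright> ?ex ?w) \<cdot> (y \<triangleright> braid_at x x' ?w))) \<cdot>
      braid_at y y' (x \<boxtimes> (x' \<boxtimes> ?w)) \<cdot> (?q (x \<boxtimes> (x' \<boxtimes> ?w)) \<cdot> px)"
    by (subst slide_through_ev[OF dx], simp, simp, subst slide_through_coev[OF hy']) simp_all
  also have "?q (x \<boxtimes> (x' \<boxtimes> ?w)) \<cdot> px = (y \<triangleright> y' \<triangleright> px) \<cdot> ?q ?w" using qy_nat[of px] by simp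
  also have "?ey ?w \<cdot> (y' \<triangleright> ((y \<triangleright> ?ex ?w) \<cdot> (y \<triangleright> braid_at x x' ?w))) \<cdot> braid_at y y' (x \<boxtimes> (x' \<boxtimes> ?w)) \<cdot> ((y \<triangleright> y' \<triangleright> px) \<cdot> ?q ?w) =
      ?ey ?w \<cdot> (y' \<triangleright> ((y \<triangleright> ?ex ?w) \<cdot> (y \<triangleright> braid_at x x' ?w))) \<cdot> (braid_at y y' (x \<boxtimes> (x' \<boxtimes> ?w)) \<cdot> (y \<triangleright> y' \<triangleright> px)) \<cdot> ?q ?w"
    by simp
  also have "braid_at y y' (x \<boxtimes> (x' \<boxtimes> ?w)) \<cdot> (y \<triangleright> y' \<triangleright> px) = (y' \<triangleright> y \<triangleright> px) \<cdot> braid_at y y' ?w"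
    using braid_at_nat[of y y' px] by simp
  also have "?ey ?w \<cdot> (y' \<triangleright> ((y \<triangleright> ?ex ?w) \<cdot> (y \<triangleright> braid_at x x' ?w))) \<cdot> ((y' \<triangleright> y \<triangleright> px) \<cdot> braid_at y y' ?w) \<cdot> ?q ?w =
      ?ey ?w \<cdot> (y' \<triangleright> y \<triangleright> (?ex ?w \<cdot> braid_at x x' ?w \<cdot> px)) \<cdot> braid_at y y' ?w \<cdot> ?q ?w"
    by (simp add: whisker_comp)
  also have "?ex ?w \<cdot> braid_at x x' ?w \<cdot> px = loop_at x x' ex cx (Twist C x) ?w" by (simp add: loop_at_def px_def)
  also have "\<dots> = Scale C (qdim x) (Ident C ?w)" by (simp add: qdim_loop[OF dx])
  also have "?ey ?w \<cdot> (y' \<triangleright> y \<triangleright> (Scale C (qdim x) (Ident C ?w))) \<cdot> braid_at y y' ?w \<cdot> ?q ?w =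
      Scale C (qdim x) (loop_at y y' ey cy (Twist C y) ?w)"
    by (simp add: loop_at_def qy)
  also have "\<dots> = Scale C (qdim x * qdim y) (Ident C ?w)" by (simp add: qdim_loop[OF dy])
  finally show ?thesis by (simp add: unit_scalar_cancel)
qed

end

section \<open>Tensor products of simple objects\<close>

context fusion_category
begin

declare isomorphic_trans [trans]

lemma tens_zero:
  assumes "x \<in> Obj C" "y \<in> Obj C" "f \<in> Arr C"
  shows "f \<star> Zero C x y = Zero C (Dom C f \<boxtimes> x) (Cod C f \<boxtimes> y)" "Zero C x y \<star> f = Zero C (x \<boxtimes> Dom C f) (y \<boxtimes> Cod C f)"
  using tens_scale_right[of f "Dom C f" "Cod C f" "Zero C x y" x y 0]
    tens_scale_left[of "Zero C x y" x y f "Dom C f" "Cod C f" 0] assms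
  by (auto simp: in_Hom)

lemma tens_zero_object:
  assumes "zero_object C x" "y \<in> Obj C"
  shows "zero_object C (y \<boxtimes> x)" "zero_object C (x \<boxtimes> y)"
proof -
  have x: "x \<in> Obj C" "Ident C x = Zero C x x" using assms(1) by (auto simp: zero_object_def)
  show "zero_object C (y \<boxtimes> x)" "zero_object C (x \<boxtimes> y)"
    unfolding zero_object_def using x assms(2) tens_ident[of y x] tens_ident[of x y]
    by (simp_all add: tens_zero flip: tens_ident)
qed

lemma biproduct_tensor_left:
  assumes b: "biproduct C I x z \<iota> \<pi>" and w [simp]: "w \<in> Obj C"
  shows "biproduct C I (\<lambda>i. w \<boxtimes> x i) (w \<boxtimes> z) (\<lambda>i. w \<triangleright> \<iota> i) (\<lambda>i. w \<triangleright> \<pi> i)"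
proof -
  note [simp] = biproduct_simps[OF b]
  have "w \<triangleright> hsum z z (\<lambda>i. \<iota> i \<cdot> \<pi> i) I = hsum (w \<boxtimes> z) (w \<boxtimes> z) (\<lambda>i. w \<triangleright> (\<iota> i \<cdot> \<pi> i)) I"
    using linear_category_axioms tens_add_right[of "Ident C w" w w]
    by (intro hsum_additive[where T = "\<lambda>h. w \<triangleright> h" and D = C]) (auto simp: in_Hom tens_zero)
  also have "\<dots> = hsum (w \<boxtimes> z) (w \<boxtimes> z) (\<lambda>i. (w \<triangleright> \<iota> i) \<cdot> (w \<triangleright> \<pi> i)) I"
    by (intro hsum_cong) (auto simp: in_Hom fuse)
  finally show ?thesis by (auto simp: biproduct_def in_Hom fuse tens_zero)
qed

lemma biproduct_tensor_right:
  assumes b: "biproduct C I x z \<iota> \<pi>" and w [simp]: "w \<in> Obj C"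
  shows "biproduct C I (\<lambda>i. x i \<boxtimes> w) (z \<boxtimes> w) (\<lambda>i. \<iota> i \<star> Ident C w) (\<lambda>i. \<pi> i \<star> Ident C w)"
proof -
  note [simp] = biproduct_simps[OF b]
  have "hsum z z (\<lambda>i. \<iota> i \<cdot> \<pi> i) I \<star> Ident C w = hsum (z \<boxtimes> w) (z \<boxtimes> w) (\<lambda>i. (\<iota> i \<cdot> \<pi> i) \<star> Ident C w) I"
    using linear_category_axioms tens_add_left[of _ z z _ "Ident C w" w w]
    by (intro hsum_additive[where T = "\<lambda>h. h \<star> Ident C w" and D = C]) (auto simp: in_Hom tens_zero)
  also have "\<dots> = hsum (z \<boxtimes> w) (z \<boxtimes> w) (\<lambda>i. (\<iota> i \<star> Ident C w) \<cdot> (\<pi> i \<star> Ident C w)) I"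
    by (intro hsum_cong) (auto simp: in_Hom fuse)
  finally show ?thesis by (auto simp: biproduct_def in_Hom fuse tens_zero)
qed

lemma biproduct_tensor:
  assumes b: "biproduct C I x z \<iota> \<pi>" and c: "biproduct C J y w \<kappa> \<rho>"
  shows "\<exists>\<alpha> \<beta>. biproduct C (I \<times> J) (\<lambda>(i, j). x i \<boxtimes> y j) (z \<boxtimes> w) \<alpha> \<beta>"
proof -
  have w: "w \<in> Obj C" using biproductD(2)[OF c] .
  show ?thesis
    using biproduct_Sigma[OF biproduct_tensor_right[OF b w] biproduct_tensor_left[OF c biproductD(3)[OF b]]]
    by blast
qed

lemma isomorphic_tensor:
  assumes "isomorphic C x x'" "isomorphic C y y'"
  shows "isomorphic C (x \<boxtimes> y) (x' \<boxtimes> y')"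
proof -
  obtain f g where "f \<in> Hom C x x'" "is_iso C f" "g \<in> Hom C y y'" "is_iso C g"
    using assms by (auto simp: isomorphic_def)
  then show ?thesis by (intro isomorphicI[of "f \<star> g"]) (auto simp: in_Hom)
qed

lemma isomorphic_assoc: "\<lbrakk>x \<in> Obj C; y \<in> Obj C; z \<in> Obj C\<rbrakk> \<Longrightarrow> isomorphic C ((x \<boxtimes> y) \<boxtimes> z) (x \<boxtimes> (y \<boxtimes> z))"
  by (rule isomorphicI[of "Assoc C x y z"]) (auto simp: in_Hom)

lemma isomorphic_lunit: "x \<in> Obj C \<Longrightarrow> isomorphic C (TUnit C \<boxtimes> x) x"
  by (rule isomorphicI[of "LUnit C x"]) (auto simp: in_Hom)

lemma isomorphic_runit: "x \<in> Obj C \<Longrightarrow> isomorphic C (x \<boxtimes> TUnit C) x"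
  by (rule isomorphicI[of "RUnit C x"]) (auto simp: in_Hom)

lemma thin_iso_invariant:
  assumes "isomorphic C x x'" "isomorphic C y y'" "thin x y"
  shows "thin x' y'"
proof -
  obtain u v where uv: "u \<in> Hom C x x'" "is_iso C u" "v \<in> Hom C y y'" "is_iso C v"
    using assms by (auto simp: isomorphic_def)
  have [simp]: "Dom C u = x" "Cod C u = x'" "Dom C v = y" "Cod C v = y'" "is_iso C u" "is_iso C v"
    "x \<in> Obj C" "y \<in> Obj C" "x' \<in> Obj C" "y' \<in> Obj C"
    using uv isomorphic_objs[OF assms(1)] isomorphic_objs[OF assms(2)] by (auto simp: in_Hom)
  show ?thesis
  proof (rule thin_transfer[where T = "\<lambda>f. inv_arr C v \<cdot> (f \<cdot> u)", OF assms(3)])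
    fix f assume f: "f \<in> Hom C x' y'" "inv_arr C v \<cdot> (f \<cdot> u) = Zero C x y"
    have [simp]: "f \<in> Arr C" "Dom C f = x'" "Cod C f = y'" using f by (auto simp: in_Hom)
    have "f = v \<cdot> ((inv_arr C v \<cdot> (f \<cdot> u)) \<cdot> inv_arr C u)" by simp
    also have "\<dots> = Zero C x' y'" unfolding f(2) by simp
    finally show "f = Zero C x' y'" .
  qed (auto simp: in_Hom comp_add)
qed

subsection \<open>Duality as an adjunction\<close>

text \<open>Tensoring with the left dual \<open>y\<close> is left adjoint to tensoring with \<open>x\<close>.\<close>

lemma dual_transpose:
  assumes d: "is_dual C x y ev coev" and [simp]: "w \<in> Obj C" "t \<in> Obj C"
  shows "f \<in> Hom C (y \<boxtimes> w) t \<Longrightarrow> ev_at x y ev t \<cdot> (y \<triangleright> ((x \<triangleright> f) \<cdot> coev_at x y coev w)) = f"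
    and "g \<in> Hom C w (x \<boxtimes> t) \<Longrightarrow> (x \<triangleright> (ev_at x y ev t \<cdot> (y \<triangleright> g))) \<cdot> coev_at x y coev w = g"
proof -
  note [simp] = dual_simps[OF d] ev_at_simps[OF d]
  show "ev_at x y ev t \<cdot> (y \<triangleright> ((x \<triangleright> f) \<cdot> coev_at x y coev w)) = f" if "f \<in> Hom C (y \<boxtimes> w) t"
  proof -
    have [simp]: "f \<in> Arr C" "Dom C f = y \<boxtimes> w" "Cod C f = t" using that by (auto simp: in_Hom)
    have "ev_at x y ev t \<cdot> (y \<triangleright> ((x \<triangleright> f) \<cdot> coev_at x y coev w)) = (ev_at x y ev t \<cdot> (y \<triangleright> x \<triangleright> f)) \<cdot> (y \<triangleright> coev_at x y coev w)"
      by (simp add: whisker_comp)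
    also have "ev_at x y ev t \<cdot> (y \<triangleright> x \<triangleright> f) = f \<cdot> ev_at x y ev (y \<boxtimes> w)" using ev_at_nat[OF d, of f] by simp
    also have "(f \<cdot> ev_at x y ev (y \<boxtimes> w)) \<cdot> (y \<triangleright> coev_at x y coev w) = f \<cdot> (ev_at x y ev (y \<boxtimes> w) \<cdot> (y \<triangleright> coev_at x y coev w))"
      by simp
    also have "\<dots> = f" by (subst zigzag_right[OF d]) simp_all
    finally show ?thesis .
  qed
  show "(x \<triangleright> (ev_at x y ev t \<cdot> (y \<triangleright> g))) \<cdot> coev_at x y coev w = g" if "g \<in> Hom C w (x \<boxtimes> t)"
  proof -
    have [simp]: "g \<in> Arr C" "Dom C g = w" "Cod C g = x \<boxtimes> t" using that by (auto simp: in_Hom)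
    have "(x \<triangleright> (ev_at x y ev t \<cdot> (y \<triangleright> g))) \<cdot> coev_at x y coev w = (x \<triangleright> ev_at x y ev t) \<cdot> ((x \<triangleright> y \<triangleright> g) \<cdot> coev_at x y coev w)"
      by (simp add: whisker_comp)
    also have "(x \<triangleright> y \<triangleright> g) \<cdot> coev_at x y coev w = coev_at x y coev (x \<boxtimes> t) \<cdot> g" using coev_at_nat[OF d, of g] by simp
    also have "(x \<triangleright> ev_at x y ev t) \<cdot> (coev_at x y coev (x \<boxtimes> t) \<cdot> g) = ((x \<triangleright> ev_at x y ev t) \<cdot> coev_at x y coev (x \<boxtimes> t)) \<cdot> g"
      by simp
    also have "\<dots> = g" by (subst zigzag_left[OF d]) simp_all
    finally show ?thesis .
  qed
qed

lemma tens_add: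
  assumes "x \<in> Obj C" "f \<in> Arr C" "g \<in> Arr C" "Dom C f = Dom C g" "Cod C f = Cod C g"
  shows "x \<triangleright> Add C f g = Add C (x \<triangleright> f) (x \<triangleright> g)"
  using tens_add_right[of "Ident C x" x x f "Dom C f" "Cod C f" g] assms by (auto simp: in_Hom)

lemma thin_transpose:
  assumes d: "is_dual C x y ev coev" and o [simp]: "w \<in> Obj C" "t \<in> Obj C"
  shows "thin (y \<boxtimes> w) t \<longleftrightarrow> thin w (x \<boxtimes> t)"
proof
  note [simp] = dual_simps[OF d] ev_at_simps[OF d]
  show "thin w (x \<boxtimes> t)" if "thin (y \<boxtimes> w) t"
  proof (rule thin_transfer[where T = "\<lambda>g. ev_at x y ev t \<cdot> (y \<triangleright> g)", OF that])
    show "f = Zero C w (x \<boxtimes> t)" if "f \<in> Hom C w (x \<boxtimes> t)" "ev_at x y ev t \<cdot> (y \<triangleright> f) = Zero C (y \<boxtimes> w) t" for f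
      using dual_transpose(2)[OF d o that(1)] unfolding that(2) by (simp add: tens_zero)
  qed (auto simp: in_Hom tens_add comp_add)
  show "thin (y \<boxtimes> w) t" if "thin w (x \<boxtimes> t)"
  proof (rule thin_transfer[where T = "\<lambda>f. (x \<triangleright> f) \<cdot> coev_at x y coev w", OF that])
    show "f = Zero C (y \<boxtimes> w) t" if "f \<in> Hom C (y \<boxtimes> w) t" "(x \<triangleright> f) \<cdot> coev_at x y coev w = Zero C w (x \<boxtimes> t)" for f
      using dual_transpose(1)[OF d o that(1)] unfolding that(2) by (simp add: tens_zero)
  qed (auto simp: in_Hom tens_add comp_add)
qed

lemma nonzero_transpose:
  assumes d: "is_dual C x y ev coev" and o [simp]: "w \<in> Obj C" "t \<in> Obj C"
  shows "(\<exists>f \<in> Hom C (y \<boxtimes> w) t. f \<noteq> Zero C (y \<boxtimes> w) t) \<longleftrightarrow> (\<exists>g \<in> Hom C w (x \<boxtimes> t). g \<noteq> Zero C w (x \<boxtimes> t))"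
proof
  note [simp] = dual_simps[OF d] ev_at_simps[OF d]
  assume "\<exists>f \<in> Hom C (y \<boxtimes> w) t. f \<noteq> Zero C (y \<boxtimes> w) t"
  then obtain f where f: "f \<in> Hom C (y \<boxtimes> w) t" "f \<noteq> Zero C (y \<boxtimes> w) t" by blast
  show "\<exists>g \<in> Hom C w (x \<boxtimes> t). g \<noteq> Zero C w (x \<boxtimes> t)"
  proof (intro bexI notI)
    assume z: "(x \<triangleright> f) \<cdot> coev_at x y coev w = Zero C w (x \<boxtimes> t)"
    show False using f(2) dual_transpose(1)[OF d o f(1)] unfolding z by (simp add: tens_zero)
  qed (use f in \<open>simp add: in_Hom\<close>)
next
  note [simp] = dual_simps[OF d] ev_at_simps[OF d]
  assume "\<exists>g \<in> Hom C w (x \<boxtimes> t). g \<noteq> Zero C w (x \<boxtimes> t)"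
  then obtain g where g: "g \<in> Hom C w (x \<boxtimes> t)" "g \<noteq> Zero C w (x \<boxtimes> t)" by blast
  show "\<exists>f \<in> Hom C (y \<boxtimes> w) t. f \<noteq> Zero C (y \<boxtimes> w) t"
  proof (intro bexI notI)
    assume z: "ev_at x y ev t \<cdot> (y \<triangleright> g) = Zero C (y \<boxtimes> w) t"
    show False using g(2) dual_transpose(2)[OF d o g(1)] unfolding z by (simp add: tens_zero)
  qed (use g in \<open>simp add: in_Hom\<close>)
qed

lemma ev_nonzero:
  assumes d: "is_dual C x y ev coev" and x: "\<not> zero_object C x"
  shows "ev \<noteq> Zero C (y \<boxtimes> x) (TUnit C)"
proof
  note [simp] = dual_simps[OF d] ev_at_simps[OF d]
  let ?w = "TUnit C"
  assume "ev = Zero C (y \<boxtimes> x) ?w"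
  then have "ev_at x y ev ?w = Zero C (y \<boxtimes> (x \<boxtimes> ?w)) ?w" by (simp add: ev_at_def tens_zero)
  then have "Ident C (x \<boxtimes> ?w) = Zero C (x \<boxtimes> ?w) (x \<boxtimes> ?w)"
    using zigzag_left[OF d, of ?w] by (simp add: tens_zero)
  then have "zero_object C (x \<boxtimes> ?w)" by (simp add: zero_object_def)
  then show False using x zero_object_iso[OF isomorphic_runit[OF dual_simps(1)[OF d]]] by blast
qed

lemma coev_nonzero:
  assumes d: "is_dual C x y ev coev" and x: "\<not> zero_object C x"
  shows "coev \<noteq> Zero C (TUnit C) (x \<boxtimes> y)"
proof
  note [simp] = dual_simps[OF d] ev_at_simps[OF d]
  let ?w = "TUnit C"
  assume "coev = Zero C ?w (x \<boxtimes> y)"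
  then have "coev_at x y coev (x \<boxtimes> ?w) = Zero C (x \<boxtimes> ?w) (x \<boxtimes> (y \<boxtimes> (x \<boxtimes> ?w)))" by (simp add: coev_at_def tens_zero)
  then have "Ident C (x \<boxtimes> ?w) = Zero C (x \<boxtimes> ?w) (x \<boxtimes> ?w)"
    using zigzag_left[OF d, of ?w] by (simp add: tens_zero)
  then have "zero_object C (x \<boxtimes> ?w)" by (simp add: zero_object_def)
  then show False using x zero_object_iso[OF isomorphic_runit[OF dual_simps(1)[OF d]]] by blast
qed

text \<open>The unit is a retract of \<open>x' \<otimes> x\<close>, hence \<open>y\<close> is a retract of \<open>x' \<otimes> (x \<otimes> y)\<close>.\<close>

lemma tensor_nonzero:
  assumes x: "x \<in> Obj C" "\<not> zero_object C x" and y: "y \<in> Obj C" "\<not> zero_object C y"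
  shows "\<not> zero_object C (x \<boxtimes> y)"
proof
  assume z: "zero_object C (x \<boxtimes> y)"
  let ?I = "TUnit C"
  obtain x' ev coev where d: "is_dual C x x' ev coev" using left_dual[OF x(1)] by blast
  note [simp] = dual_simps[OF d] y(1)
  obtain s where s: "s \<in> Hom C ?I (x' \<boxtimes> x)" "ev \<cdot> s = Ident C ?I"
    using hom_to_simple_section[OF unit_simple, of ev "x' \<boxtimes> x"] ev_nonzero[OF d x(2)] by (auto simp: in_Hom)
  have [simp]: "s \<in> Arr C" "Dom C s = ?I" "Cod C s = x' \<boxtimes> x" using s(1) by (auto simp: in_Hom)
  have "zero_object C (x' \<boxtimes> (x \<boxtimes> y))" using tens_zero_object(1)[OF z] by simp
  then have "zero_object C ((x' \<boxtimes> x) \<boxtimes> y)"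
    using zero_object_iso[OF isomorphic_sym[OF isomorphic_assoc]] by simp
  then have "s \<star> Ident C y = Zero C (?I \<boxtimes> y) ((x' \<boxtimes> x) \<boxtimes> y)"
    using zero_object_from(2)[of _ "s \<star> Ident C y"] by simp
  then have "(ev \<star> Ident C y) \<cdot> (s \<star> Ident C y) = Zero C (?I \<boxtimes> y) (?I \<boxtimes> y)" by simp
  then have "Ident C (?I \<boxtimes> y) = Zero C (?I \<boxtimes> y) (?I \<boxtimes> y)" by (simp add: fuse s(2))
  then have "zero_object C (?I \<boxtimes> y)" by (simp add: zero_object_def)
  then show False using y zero_object_iso[OF isomorphic_lunit[OF y(1)]] by blast
qed

lemma simple_nonzero: "simple_object C x \<Longrightarrow> \<not> zero_object C x"
  unfolding simple_object_def by blast

lemma nonzero_constituent: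
  assumes "z \<in> Obj C" "\<not> zero_object C z"
  obtains s f where "simple_object C s" "f \<in> Hom C s z" "f \<noteq> Zero C s z"
proof -
  obtain n :: nat and x \<iota> \<pi> where b: "biproduct C {..<n} x z \<iota> \<pi>" and xs: "\<And>i. i < n \<Longrightarrow> simple_object C (x i)"
    using semisimple_biproduct[OF assms(1)] by metis
  note [simp] = biproduct_simps[OF b]
  have "n \<noteq> 0"
  proof
    assume "n = 0"
    then have "Ident C z = Zero C z z" using biproductD(12)[OF b] assms by simp
    then show False using assms by (simp add: zero_object_def)
  qed
  show ?thesis
  proof (rule that)
    show "simple_object C (x 0)" using xs \<open>n \<noteq> 0\<close> by simp
    show "\<iota> 0 \<in> Hom C (x 0) z" using \<open>n \<noteq> 0\<close> by (simp add: in_Hom)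
    show "\<iota> 0 \<noteq> Zero C (x 0) z"
    proof
      assume "\<iota> 0 = Zero C (x 0) z"
      then have "\<pi> 0 \<cdot> \<iota> 0 = Zero C (x 0) (x 0)" using \<open>n \<noteq> 0\<close> assms(1) by simp
      then show False using simple_ident_nonzero[OF xs, of 0] \<open>n \<noteq> 0\<close> by simp
    qed
  qed
qed

end

context braided_fusion_category
begin

declare isomorphic_trans [trans]

lemma isomorphic_braid: "\<lbrakk>x \<in> Obj C; y \<in> Obj C\<rbrakk> \<Longrightarrow> isomorphic C (x \<boxtimes> y) (y \<boxtimes> x)"
  by (rule isomorphicI[of "Braid C x y"]) (auto simp: in_Hom)

subsection \<open>Invertible objects\<close>

lemma invertible_iff: "invertible_object C x \<longleftrightarrow> x \<in> Obj C \<and> (\<exists>y \<in> Obj C. isomorphic C (x \<boxtimes> y) (TUnit C))"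
  unfolding invertible_object_def using isomorphic_braid isomorphic_trans by blast

lemma invertible_obj [simp]: "invertible_object C x \<Longrightarrow> x \<in> Obj C"
  by (simp add: invertible_object_def)

lemma invertible_iso_invariant:
  assumes "isomorphic C x y" "invertible_object C x"
  shows "invertible_object C y"
proof -
  obtain z where z: "z \<in> Obj C" "isomorphic C (x \<boxtimes> z) (TUnit C)" using assms(2) unfolding invertible_iff by blast
  have "isomorphic C (y \<boxtimes> z) (x \<boxtimes> z)" using assms(1) z isomorphic_tensor isomorphic_sym isomorphic_refl by blast
  then show ?thesis unfolding invertible_iff using z isomorphic_trans isomorphic_objs[OF assms(1)] by blast
qed

lemma invertible_unit: "invertible_object C (TUnit C)"
  unfolding invertible_iff using isomorphic_lunit[of "TUnit C"] by auto

lemma invertible_tensor: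
  assumes "invertible_object C x" "invertible_object C y"
  shows "invertible_object C (x \<boxtimes> y)"
proof -
  obtain a where a: "a \<in> Obj C" "isomorphic C (x \<boxtimes> a) (TUnit C)" using assms(1) unfolding invertible_iff by blast
  obtain b where b: "b \<in> Obj C" "isomorphic C (y \<boxtimes> b) (TUnit C)" using assms(2) unfolding invertible_iff by blast
  have [simp]: "x \<in> Obj C" "y \<in> Obj C" using assms by auto
  have "isomorphic C ((x \<boxtimes> y) \<boxtimes> (b \<boxtimes> a)) (x \<boxtimes> (y \<boxtimes> (b \<boxtimes> a)))" using a b by (intro isomorphic_assoc) auto
  also have "isomorphic C (x \<boxtimes> (y \<boxtimes> (b \<boxtimes> a))) (x \<boxtimes> ((y \<boxtimes> b) \<boxtimes> a))"
    using a b by (intro isomorphic_tensor isomorphic_refl isomorphic_sym[OF isomorphic_assoc]) auto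
  also have "isomorphic C (x \<boxtimes> ((y \<boxtimes> b) \<boxtimes> a)) (x \<boxtimes> (TUnit C \<boxtimes> a))"
    using a b by (intro isomorphic_tensor isomorphic_refl) auto
  also have "isomorphic C (x \<boxtimes> (TUnit C \<boxtimes> a)) (x \<boxtimes> a)"
    using a by (intro isomorphic_tensor isomorphic_refl isomorphic_lunit) auto
  also note a(2)
  finally show ?thesis unfolding invertible_iff using a b by auto
qed

lemma invertible_factor:
  assumes "invertible_object C (x \<boxtimes> y)" "x \<in> Obj C" "y \<in> Obj C"
  shows "invertible_object C x" "invertible_object C y"
proof -
  have *: "invertible_object C u" if uv: "invertible_object C (u \<boxtimes> v)" "u \<in> Obj C" "v \<in> Obj C" for u v
  proof -
    obtain a where a: "a \<in> Obj C" "isomorphic C ((u \<boxtimes> v) \<boxtimes> a) (TUnit C)" using uv(1) unfolding invertible_iff by blast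
    then have "isomorphic C (u \<boxtimes> (v \<boxtimes> a)) (TUnit C)"
      using isomorphic_trans isomorphic_sym isomorphic_assoc uv by blast
    then show ?thesis unfolding invertible_iff using uv a by auto
  qed
  show "invertible_object C x" using *[OF assms] .
  have "invertible_object C (y \<boxtimes> x)"
    using invertible_iso_invariant[OF isomorphic_braid assms(1)] assms by simp
  then show "invertible_object C y" using * assms by blast
qed

lemma invertible_cancel:
  assumes g: "invertible_object C g" and o: "x \<in> Obj C" "y \<in> Obj C" and i: "isomorphic C (g \<boxtimes> x) (g \<boxtimes> y)"
  shows "isomorphic C x y"
proof -
  obtain h where h: "h \<in> Obj C" "isomorphic C (g \<boxtimes> h) (TUnit C)" using g unfolding invertible_iff by blast
  have go: "g \<in> Obj C" using g by simp
  have c: "isomorphic C (h \<boxtimes> (g \<boxtimes> z)) z" if z: "z \<in> Obj C" for z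
  proof -
    have "isomorphic C (h \<boxtimes> (g \<boxtimes> z)) ((h \<boxtimes> g) \<boxtimes> z)"
      using h go z by (intro isomorphic_sym[OF isomorphic_assoc]) auto
    also have "isomorphic C ((h \<boxtimes> g) \<boxtimes> z) ((g \<boxtimes> h) \<boxtimes> z)"
      using h go z by (intro isomorphic_tensor isomorphic_braid isomorphic_refl) auto
    also have "isomorphic C ((g \<boxtimes> h) \<boxtimes> z) (TUnit C \<boxtimes> z)"
      using h z by (intro isomorphic_tensor isomorphic_refl) auto
    also have "isomorphic C (TUnit C \<boxtimes> z) z" using z by (rule isomorphic_lunit)
    finally show ?thesis .
  qed
  have "isomorphic C (h \<boxtimes> (g \<boxtimes> x)) (h \<boxtimes> (g \<boxtimes> y))" by (rule isomorphic_tensor[OF isomorphic_refl[OF h(1)] i])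
  then show ?thesis using c[OF o(1)] c[OF o(2)] isomorphic_trans isomorphic_sym by blast
qed

text \<open>Tensoring a decomposition of \<open>g \<otimes> x\<close> with an inverse of \<open>g\<close> decomposes \<open>x\<close>.\<close>

lemma invertible_tensor_simple:
  assumes g: "invertible_object C g" and x: "simple_object C x"
  shows "simple_object C (g \<boxtimes> x)"
proof -
  obtain h where h: "h \<in> Obj C" "isomorphic C (g \<boxtimes> h) (TUnit C)" using g unfolding invertible_iff by blast
  have go [simp]: "g \<in> Obj C" using g by simp
  have xo [simp]: "x \<in> Obj C" using x by simp
  have hg: "isomorphic C (h \<boxtimes> g) (TUnit C)" using h isomorphic_braid isomorphic_trans go by blast
  have "isomorphic C (h \<boxtimes> (g \<boxtimes> x)) ((h \<boxtimes> g) \<boxtimes> x)"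
    using h by (intro isomorphic_sym[OF isomorphic_assoc]) auto
  also have "isomorphic C ((h \<boxtimes> g) \<boxtimes> x) (TUnit C \<boxtimes> x)"
    using hg by (intro isomorphic_tensor isomorphic_refl) auto
  also have "isomorphic C (TUnit C \<boxtimes> x) x" by (rule isomorphic_lunit) simp
  finally have hgx: "simple_object C (h \<boxtimes> (g \<boxtimes> x))"
    using simple_iso_invariant[OF isomorphic_sym x] by blast
  obtain n :: nat and y \<iota> \<pi> where b: "biproduct C {..<n} y (g \<boxtimes> x) \<iota> \<pi>" and ys: "\<And>i. i < n \<Longrightarrow> simple_object C (y i)"
    using semisimple_biproduct[OF tens_objs(1)[OF go xo]] by metis
  have hz: "\<not> zero_object C h"
    using tens_zero_object(1)[of h g] zero_object_iso[OF h(2)] simple_nonzero[OF unit_simple] by auto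
  obtain i where i: "{..<n} = {i}"
    using biproduct_of_simple_singleton[OF biproduct_tensor_left[OF b h(1)] _ hgx]
      tensor_nonzero[OF h(1) hz] simple_nonzero[OF ys] ys by auto
  then have "isomorphic C (y i) (g \<boxtimes> x)" using biproduct_unique_summand_iso b by metis
  then show ?thesis using simple_iso_invariant ys i by blast
qed

lemma invertible_simple: "invertible_object C g \<Longrightarrow> simple_object C g"
  using simple_iso_invariant[OF isomorphic_runit invertible_tensor_simple[OF _ unit_simple]] by simp

text \<open>Duality identifies the endomorphisms of \<open>x\<close> with the arrows from \<open>y \<otimes> x\<close> to the unit, and the
  endomorphisms of \<open>y\<close> with the arrows from the unit to \<open>x \<otimes> y\<close>. By semisimplicity and the
  braiding, both spaces have as dimension the multiplicity of the unit in \<open>y \<otimes> x\<close>.\<close>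

lemma dual_of_simple:
  assumes d: "is_dual C x y ev coev" and x: "simple_object C x"
  shows "simple_object C y"
proof (rule thin_self_simple)
  note [simp] = dual_simps[OF d]
  let ?I = "TUnit C"
  show "y \<in> Obj C" by simp
  show "\<not> zero_object C y"
  proof
    assume "zero_object C y"
    then have "zero_object C (y \<boxtimes> x)" by (rule tens_zero_object) simp
    then show False
      using zero_object_from(1)[of "y \<boxtimes> x" ev] ev_nonzero[OF d simple_nonzero[OF x]] by simp
  qed
  have "thin x (x \<boxtimes> ?I)"
    using thin_iso_invariant[OF _ isomorphic_sym[OF isomorphic_runit] thin_simple[OF x x]] by simp
  then have t: "thin (y \<boxtimes> x) ?I" using thin_transpose[OF d, of x ?I] by simp
  obtain n :: nat and w \<iota> \<pi> where b: "biproduct C {..<n} w (y \<boxtimes> x) \<iota> \<pi>" and ws: "\<And>i. i < n \<Longrightarrow> simple_object C (w i)"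
    using semisimple_biproduct[OF tens_objs(1)[OF dual_simps(2)[OF d] dual_simps(1)[OF d]]] by metis
  have "thin ?I (y \<boxtimes> x)"
    using ws thin_distinct_constituents[OF b _ unit_simple] t
    by (intro thin_from_distinct_constituents[OF b _ unit_simple]) auto
  then have "thin ?I (x \<boxtimes> y)" using thin_iso_invariant[OF isomorphic_refl[of ?I] isomorphic_braid[of y x]] by simp
  then have "thin (y \<boxtimes> ?I) y" using thin_transpose[OF d, of ?I y] by simp
  then show "thin y y" using thin_iso_invariant[OF isomorphic_runit[of y] isomorphic_refl[of y]] by simp
qed

subsection \<open>Double braidings\<close>

definition double_braid :: "'o \<Rightarrow> 'o \<Rightarrow> 'm" where
  "double_braid x y = Braid C y x \<cdot> Braid C x y"

definition braid_scalar :: "'o \<Rightarrow> 'o \<Rightarrow> 'k \<Rightarrow> bool" where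
  "braid_scalar x y b \<longleftrightarrow> x \<in> Obj C \<and> y \<in> Obj C \<and> double_braid x y = Scale C b (Ident C (x \<boxtimes> y))"

lemma double_braid_simps [simp]:
  assumes "x \<in> Obj C" "y \<in> Obj C"
  shows "double_braid x y \<in> Arr C" "Dom C (double_braid x y) = x \<boxtimes> y" "Cod C (double_braid x y) = x \<boxtimes> y"
  using assms by (simp_all add: double_braid_def)

lemma double_braid_nat:
  assumes "f \<in> Arr C" "g \<in> Arr C"
  shows "double_braid (Cod C f) (Cod C g) \<cdot> (f \<star> g) = (f \<star> g) \<cdot> double_braid (Dom C f) (Dom C g)"
proof -
  have "double_braid (Cod C f) (Cod C g) \<cdot> (f \<star> g) = Braid C (Cod C g) (Cod C f) \<cdot> (Braid C (Cod C f) (Cod C g) \<cdot> (f \<star> g))"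
    using assms by (simp add: double_braid_def)
  also have "\<dots> = (Braid C (Cod C g) (Cod C f) \<cdot> (g \<star> f)) \<cdot> Braid C (Dom C f) (Dom C g)"
    unfolding braid_nat[OF assms] using assms by simp
  also have "\<dots> = (f \<star> g) \<cdot> double_braid (Dom C f) (Dom C g)"
    unfolding braid_nat[OF assms(2,1)] using assms by (simp add: double_braid_def)
  finally show ?thesis .
qed

text \<open>Naturality: the double braiding restricts to retracts in both arguments.\<close>

lemma braid_scalar_retract:
  assumes b: "braid_scalar x z b" and f: "f \<in> Hom C x' x" "r \<in> Hom C x x'" "r \<cdot> f = Ident C x'"
    and g: "g \<in> Hom C z' z" "q \<in> Hom C z z'" "q \<cdot> g = Ident C z'"
  shows "braid_scalar x' z' b"
proof -
  have [simp]: "f \<in> Arr C" "Dom C f = x'" "Cod C f = x" "r \<in> Arr C" "Dom C r = x" "Cod C r = x'"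
    "g \<in> Arr C" "Dom C g = z'" "Cod C g = z" "q \<in> Arr C" "Dom C q = z" "Cod C q = z'"
    "x \<in> Obj C" "z \<in> Obj C" "x' \<in> Obj C" "z' \<in> Obj C"
    using f g Hom_objs[OF f(1)] Hom_objs[OF g(1)] by (auto simp: in_Hom)
  have "double_braid x' z' = ((r \<star> q) \<cdot> (f \<star> g)) \<cdot> double_braid x' z'" by (subst interchange) (simp_all add: f(3) g(3))
  also have "\<dots> = (r \<star> q) \<cdot> (double_braid x z \<cdot> (f \<star> g))" using double_braid_nat[of f g] by simp
  also have "\<dots> = Scale C b (Ident C (x' \<boxtimes> z'))"
    using b by (simp add: braid_scalar_def fuse f(3) g(3))
  finally show ?thesis by (simp add: braid_scalar_def)
qed

lemma braid_scalar_iso: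
  assumes "braid_scalar x y b" "isomorphic C x x'" "isomorphic C y y'"
  shows "braid_scalar x' y' b"
proof -
  obtain u v where uv: "u \<in> Hom C x x'" "is_iso C u" "v \<in> Hom C y y'" "is_iso C v"
    using assms by (auto simp: isomorphic_def)
  show ?thesis
    by (rule braid_scalar_retract[OF assms(1), of "inv_arr C u" x' u "inv_arr C v" y' v])
      (use uv in \<open>auto simp: in_Hom\<close>)
qed

lemma braid_scalar_at:
  assumes b: "braid_scalar x y b" and w: "w \<in> Obj C"
  shows "braid_at y x w \<cdot> braid_at x y w = Scale C b (Ident C (x \<boxtimes> (y \<boxtimes> w)))"
proof -
  have [simp]: "x \<in> Obj C" "y \<in> Obj C" "w \<in> Obj C" using b w by (auto simp: braid_scalar_def)
  have "braid_at y x w \<cdot> braid_at x y w = Assoc C x y w \<cdot> (double_braid x y \<star> Ident C w) \<cdot> inv_arr C (Assoc C x y w)"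
    by (simp add: braid_at_def double_braid_def fuse)
  then show ?thesis using b by (simp add: braid_scalar_def)
qed

lemma braid_scalar_from_at:
  assumes o [simp]: "x \<in> Obj C" "y \<in> Obj C"
    and b: "braid_at y x (TUnit C) \<cdot> braid_at x y (TUnit C) = Scale C b (Ident C (x \<boxtimes> (y \<boxtimes> TUnit C)))"
  shows "braid_scalar x y b"
proof -
  let ?w = "TUnit C"
  have "double_braid x y \<star> Ident C ?w = inv_arr C (Assoc C x y ?w) \<cdot> (braid_at y x ?w \<cdot> braid_at x y ?w) \<cdot> Assoc C x y ?w"
    by (simp add: braid_at_def double_braid_def fuse)
  also have "\<dots> = Scale C b (Ident C (x \<boxtimes> y)) \<star> Ident C ?w" unfolding b by simp
  finally have "double_braid x y = Scale C b (Ident C (x \<boxtimes> y))"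
    by (rule whisker_unit_faithful[rotated 4]) simp_all
  then show ?thesis by (simp add: braid_scalar_def)
qed

text \<open>By the hexagons, the double braiding with \<open>y \<otimes> z\<close> is the one with \<open>z\<close> placed between the two
  crossings of \<open>g\<close> and \<open>y\<close>. As it is a scalar, it can be taken out.\<close>

lemma braid_scalar_tensor:
  assumes b: "braid_scalar g y b" and c: "braid_scalar g z c"
  shows "braid_scalar g (y \<boxtimes> z) (b * c)"
proof (rule braid_scalar_from_at)
  let ?w = "TUnit C"
  show [simp]: "g \<in> Obj C" using b by (simp add: braid_scalar_def)
  have [simp]: "y \<in> Obj C" "z \<in> Obj C" using b c by (auto simp: braid_scalar_def)
  show "y \<boxtimes> z \<in> Obj C" by simp
  let ?A = "Assoc C y z"
  have "(g \<triangleright> ?A ?w) \<cdot> (braid_at (y \<boxtimes> z) g ?w \<cdot> braid_at g (y \<boxtimes> z) ?w) =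
      ((g \<triangleright> ?A ?w) \<cdot> braid_at (y \<boxtimes> z) g ?w) \<cdot> braid_at g (y \<boxtimes> z) ?w" by simp
  also have "\<dots> = braid_at y g (z \<boxtimes> ?w) \<cdot> (y \<triangleright> braid_at z g ?w) \<cdot> (?A (g \<boxtimes> ?w) \<cdot> braid_at g (y \<boxtimes> z) ?w)"
    by (subst braid_at_tensor_left) simp_all
  also have "\<dots> = braid_at y g (z \<boxtimes> ?w) \<cdot> (y \<triangleright> (braid_at z g ?w \<cdot> braid_at g z ?w)) \<cdot> braid_at g y (z \<boxtimes> ?w) \<cdot> (g \<triangleright> ?A ?w)"
    by (subst braid_at_tensor_right) (simp_all add: whisker_comp)
  also have "\<dots> = Scale C c ((braid_at y g (z \<boxtimes> ?w) \<cdot> braid_at g y (z \<boxtimes> ?w)) \<cdot> (g \<triangleright> ?A ?w))"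
    by (subst braid_scalar_at[OF c]) simp_all
  also have "\<dots> = (g \<triangleright> ?A ?w) \<cdot> Scale C (b * c) (Ident C (g \<boxtimes> ((y \<boxtimes> z) \<boxtimes> ?w)))"
    by (subst braid_scalar_at[OF b]) (simp_all add: mult.commute)
  finally show "braid_at (y \<boxtimes> z) g ?w \<cdot> braid_at g (y \<boxtimes> z) ?w = Scale C (b * c) (Ident C (g \<boxtimes> ((y \<boxtimes> z) \<boxtimes> ?w)))"
    by (subst (asm) iso_cancel_left) simp_all
qed

lemma braid_scalar_unit:
  assumes [simp]: "g \<in> Obj C"
  shows "braid_scalar g (TUnit C) 1"
proof (rule braid_scalar_from_at)
  let ?w = "TUnit C"
  have "(g \<triangleright> LUnit C ?w) \<cdot> (braid_at ?w g ?w \<cdot> braid_at g ?w ?w) = ((g \<triangleright> LUnit C ?w) \<cdot> braid_at ?w g ?w) \<cdot> braid_at g ?w ?w"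
    by simp
  also have "\<dots> = LUnit C (g \<boxtimes> ?w) \<cdot> braid_at g ?w ?w" by (subst braid_at_unit_left) simp_all
  also have "\<dots> = (g \<triangleright> LUnit C ?w) \<cdot> Scale C 1 (Ident C (g \<boxtimes> (?w \<boxtimes> ?w)))"
    by (subst braid_at_unit_right) simp_all
  finally show "braid_at ?w g ?w \<cdot> braid_at g ?w ?w = Scale C 1 (Ident C (g \<boxtimes> (?w \<boxtimes> ?w)))"
    by (subst (asm) iso_cancel_left) simp_all
qed simp_all

lemma braid_scalar_unique:
  assumes "braid_scalar x y a" "braid_scalar x y b" "\<not> zero_object C (x \<boxtimes> y)"
  shows "a = b"
  using assms scale_cancel[of "Ident C (x \<boxtimes> y)" a b] by (auto simp: braid_scalar_def zero_object_def)

end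

section \<open>Modular categories generated by a square root of a pointed object\<close>

context modular_category
begin

text \<open>If the double braiding of \<open>k\<close> with \<open>s j\<close> is the scalar \<open>b j\<close>, then the row of \<open>k\<close> in the S-matrix
  has the entries \<open>b j * qdim k * qdim (s j)\<close>. So the rows of \<open>k\<close> and \<open>k'\<close> are proportional, and different rows
  of an invertible matrix are not.\<close>

lemma modular_separates:
  assumes k: "simple_object C k" "simple_object C k'"
    and same: "\<And>s. simple_object C s \<Longrightarrow> \<exists>b. braid_scalar k s b \<and> braid_scalar k' s b"
  shows "isomorphic C k k'"
proof (rule ccontr)
  assume ni: "\<not> isomorphic C k k'"
  define s where "s = simple_reps C"
  define n where "n = length s"
  have reps: "iso_reps C (simple_object C) s"
    unfolding s_def simple_reps_def using finitely_many_simples by (rule someI_ex)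
  have simple: "simple_object C (s ! j)" if "j < n" for j
    using reps that by (auto simp: iso_reps_def n_def)
  have find: "\<exists>i < n. isomorphic C t (s ! i)" if t: "simple_object C t" for t
  proof -
    have "t \<in> Obj C" using t by simp
    then obtain x where "x \<in> set s" "isomorphic C t x" using reps t unfolding iso_reps_def by blast
    then show ?thesis by (auto simp: in_set_conv_nth n_def)
  qed
  obtain i where i: "i < n" "isomorphic C k (s ! i)" using find[OF k(1)] by blast
  obtain i' where i': "i' < n" "isomorphic C k' (s ! i')" using find[OF k(2)] by blast
  have ii: "i \<noteq> i'" using ni i i' isomorphic_trans isomorphic_sym by metis
  let ?S = "S_matrix C"
  have dimS: "?S \<in> carrier_mat n n" by (simp add: S_matrix_def Let_def s_def n_def)
  have entry: "?S $$ (p, j) = b * (qdim (s ! p) * qdim (s ! j))"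
    if "p < n" "j < n" "braid_scalar (s ! p) (s ! j) b" for p j b
  proof -
    have o: "s ! p \<in> Obj C" "s ! j \<in> Obj C" using simple that by auto
    have "?S $$ (p, j) = qtrace C (s ! p \<boxtimes> s ! j) (double_braid (s ! p) (s ! j))"
      using that by (simp add: S_matrix_def Let_def s_def n_def double_braid_def)
    also have "\<dots> = b * qtrace C (s ! p \<boxtimes> s ! j) (Ident C (s ! p \<boxtimes> s ! j))"
      using that(3) o qtrace_scale[of "Ident C (s ! p \<boxtimes> s ! j)" "s ! p \<boxtimes> s ! j" b]
      by (simp add: braid_scalar_def in_Hom)
    also have "\<dots> = b * (qdim (s ! p) * qdim (s ! j))"
      using qdim_tensor[OF o] by (simp add: qdim_def)
    finally show ?thesis .
  qed
  have rows: "qdim (s ! i') * ?S $$ (i, j) = qdim (s ! i) * ?S $$ (i', j)" if j: "j < n" for j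
  proof -
    obtain b where b: "braid_scalar k (s ! j) b" "braid_scalar k' (s ! j) b" using same[OF simple[OF j]] by blast
    have "braid_scalar (s ! i) (s ! j) b" "braid_scalar (s ! i') (s ! j) b"
      using braid_scalar_iso[OF b(1) i(2)] braid_scalar_iso[OF b(2) i'(2)] simple[OF j] by simp_all
    then show ?thesis using entry i(1) i'(1) j by simp
  qed
  obtain B where B: "inverts_mat ?S B" "inverts_mat B ?S"
    using S_matrix_invertible by (auto simp: invertible_mat_def)
  have SB: "?S * B = 1\<^sub>m n" using B(1) dimS by (auto simp: inverts_mat_def)
  have "B * ?S = 1\<^sub>m (dim_row B)" using B(2) by (auto simp: inverts_mat_def)
  then have "dim_row B = n" using dimS by (metis carrier_matD(2) index_mult_mat(3) index_one_mat(3))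
  moreover have "dim_col B = n" using SB by (metis index_mult_mat(3) index_one_mat(3))
  ultimately have dimB: "B \<in> carrier_mat n n" by blast
  have mult: "(1\<^sub>m n :: 'k mat) $$ (p, l) = (\<Sum>j<n. ?S $$ (p, j) * B $$ (j, l))" if "p < n" "l < n" for p l
    unfolding SB[symmetric] using that dimS dimB
    by (auto simp: scalar_prod_def atLeast0LessThan intro!: sum.cong)
  have "qdim (s ! i') = qdim (s ! i') * (\<Sum>j<n. ?S $$ (i, j) * B $$ (j, i))"
    using mult[of i i] i(1) by simp
  also have "\<dots> = (\<Sum>j<n. (qdim (s ! i') * ?S $$ (i, j)) * B $$ (j, i))"
    by (simp add: sum_distrib_left mult.assoc)
  also have "\<dots> = (\<Sum>j<n. (qdim (s ! i) * ?S $$ (i', j)) * B $$ (j, i))"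
    by (intro sum.cong refl) (simp add: rows)
  also have "\<dots> = qdim (s ! i) * (\<Sum>j<n. ?S $$ (i', j) * B $$ (j, i))"
    by (simp add: sum_distrib_left mult.assoc)
  also have "\<dots> = 0" using mult[of i' i] i(1) i'(1) ii by simp
  finally have z: "qdim (s ! i') = 0" .
  have "?S $$ (i', j) = 0" if j: "j < n" for j
  proof -
    obtain b where b: "braid_scalar k' (s ! j) b" using same[OF simple[OF j]] by blast
    have "braid_scalar (s ! i') (s ! j) b" using braid_scalar_iso[OF b i'(2)] simple[OF j] by simp
    then show ?thesis using entry[OF i'(1) j] z by simp
  qed
  then have "(\<Sum>j<n. ?S $$ (i', j) * B $$ (j, i')) = 0" by simp
  then show False using mult[of i' i'] i'(1) by simp
qed

end

text \<open>What the modularization remembers of a Tambara-Yamagami category: \<open>P\<close> is the image of the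
  non-invertible simple object, and \<open>ks\<close> lists the images of the invertible objects, where
  isomorphic objects can occur several times.\<close>

locale modular_square = modular_category C
  for C :: "('o, 'm, 'k::{alg_closed_field, field_char_0}, 'x) ribbon_cat_scheme" (structure) +
  fixes P :: 'o and ks :: "'o list"
  assumes P_obj: "P \<in> Obj C"
    and square: "direct_sum C ks (P \<boxtimes> P)"
    and ks_invertible: "k \<in> set ks \<Longrightarrow> invertible_object C k"
    and unit_in_ks: "\<exists>k \<in> set ks. isomorphic C k (TUnit C)"
    and cover: "simple_object C s \<Longrightarrow> (\<exists>k \<in> set ks. isomorphic C s k) \<or> (\<exists>f \<in> Hom C s P. f \<noteq> Zero C s P)"
    and ks_scalar: "k \<in> set ks \<Longrightarrow> \<exists>b. braid_scalar k P b"
begin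

lemma ks_simple: "k \<in> set ks \<Longrightarrow> simple_object C k"
  using ks_invertible invertible_simple by blast

lemma ks_obj [simp]: "k \<in> set ks \<Longrightarrow> k \<in> Obj C"
  using ks_simple by simp

text \<open>The double braiding of \<open>k\<close> with \<open>P \<otimes> P\<close> is the scalar \<open>b * b\<close>, and by naturality it is the same scalar
  on every summand. One summand is the unit, with which every object braids trivially.\<close>

lemma ks_double_braid:
  assumes k: "k \<in> set ks" and b: "braid_scalar k P b"
  shows "b * b = 1" and "k' \<in> set ks \<Longrightarrow> braid_scalar k k' 1"
proof -
  obtain \<iota> \<pi> where bp: "biproduct C {..<length ks} ((!) ks) (P \<boxtimes> P) \<iota> \<pi>"
    using square unfolding direct_sum_iff_biproduct by blast
  have bb: "braid_scalar k k' (b * b)" if k': "k' \<in> set ks" for k'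
  proof -
    obtain i where i: "i < length ks" "k' = ks ! i" using k' by (auto simp: in_set_conv_nth)
    show ?thesis
      by (rule braid_scalar_retract[OF braid_scalar_tensor[OF b b], of "Ident C k" k "Ident C k" "\<iota> i" k' "\<pi> i"])
        (use i k biproductD[OF bp] in \<open>auto simp: in_Hom\<close>)
  qed
  obtain k0 where k0: "k0 \<in> set ks" "isomorphic C k0 (TUnit C)" using unit_in_ks by blast
  have "braid_scalar k (TUnit C) (b * b)"
    using braid_scalar_iso[OF bb[OF k0(1)] isomorphic_refl k0(2)] k by simp
  moreover have "\<not> zero_object C (k \<boxtimes> TUnit C)"
    using tensor_nonzero simple_nonzero[OF ks_simple[OF k]] simple_nonzero[OF unit_simple] k by simp
  ultimately show b1: "b * b = 1" using braid_scalar_unique braid_scalar_unit k by (metis ks_obj)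
  show "k' \<in> set ks \<Longrightarrow> braid_scalar k k' 1" using bb b1 by simp
qed

lemma ks_separated:
  assumes k: "k \<in> set ks" "k' \<in> set ks" and b: "braid_scalar k P b" "braid_scalar k' P b"
  shows "isomorphic C k k'"
proof (rule modular_separates[OF ks_simple[OF k(1)] ks_simple[OF k(2)]])
  fix s assume s: "simple_object C s"
  from cover[OF s] show "\<exists>b. braid_scalar k s b \<and> braid_scalar k' s b"
  proof
    assume "\<exists>k \<in> set ks. isomorphic C s k"
    then obtain k'' where k'': "k'' \<in> set ks" "isomorphic C k'' s" using isomorphic_sym by blast
    then show ?thesis
      using braid_scalar_iso[OF ks_double_braid(2)[OF k(1) b(1) k''(1)] isomorphic_refl k''(2)]
        braid_scalar_iso[OF ks_double_braid(2)[OF k(2) b(2) k''(1)] isomorphic_refl k''(2)] k by auto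
  next
    assume "\<exists>f \<in> Hom C s P. f \<noteq> Zero C s P"
    then obtain f where f: "f \<in> Hom C s P" "f \<noteq> Zero C s P" by blast
    obtain r where r: "r \<in> Hom C P s" "r \<cdot> f = Ident C s" using hom_from_simple_retraction[OF s f] by blast
    have "braid_scalar k s b"
      by (rule braid_scalar_retract[OF b(1) _ _ _ f(1) r, of "Ident C k" k "Ident C k"]) (use k in \<open>auto simp: in_Hom\<close>)
    moreover have "braid_scalar k' s b"
      by (rule braid_scalar_retract[OF b(2) _ _ _ f(1) r, of "Ident C k'" k' "Ident C k'"]) (use k in \<open>auto simp: in_Hom\<close>)
    ultimately show ?thesis by blast
  qed
qed

text \<open>The double braiding with \<open>P\<close> is a sign and separates the classes in \<open>ks\<close>.\<close>

lemma ks_at_most_two: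
  assumes "k1 \<in> set ks" "k2 \<in> set ks" "k3 \<in> set ks"
  shows "isomorphic C k1 k2 \<or> isomorphic C k1 k3 \<or> isomorphic C k2 k3"
proof -
  obtain b1 b2 b3 where b: "braid_scalar k1 P b1" "braid_scalar k2 P b2" "braid_scalar k3 P b3"
    using ks_scalar assms by metis
  have "b1 = 1 \<or> b1 = -1" "b2 = 1 \<or> b2 = -1" "b3 = 1 \<or> b3 = -1"
    using ks_double_braid(1)[OF assms(1) b(1)] ks_double_braid(1)[OF assms(2) b(2)]
      ks_double_braid(1)[OF assms(3) b(3)] by (simp_all add: square_eq_1_iff)
  then have "b1 = b2 \<or> b1 = b3 \<or> b2 = b3" by auto
  then show ?thesis using ks_separated assms b by blast
qed

definition constituent :: "'o \<Rightarrow> bool" where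
  "constituent s \<longleftrightarrow> simple_object C s \<and> (\<exists>f \<in> Hom C s P. f \<noteq> Zero C s P)"

lemma constituent_simple: "constituent s \<Longrightarrow> simple_object C s"
  by (simp add: constituent_def)

text \<open>The object \<open>U \<otimes> V\<close> is a retract of \<open>P \<otimes> P\<close>.\<close>

lemma product_constituent_in_ks:
  assumes U: "constituent U" and V: "constituent V"
    and s: "simple_object C s" "g \<in> Hom C s (U \<boxtimes> V)" "g \<noteq> Zero C s (U \<boxtimes> V)"
  shows "\<exists>k \<in> set ks. isomorphic C s k"
proof -
  obtain \<iota> \<pi> where bp: "biproduct C {..<length ks} ((!) ks) (P \<boxtimes> P) \<iota> \<pi>"
    using square unfolding direct_sum_iff_biproduct by blast
  obtain f r where f: "f \<in> Hom C U P" and r: "r \<in> Hom C P U" "r \<cdot> f = Ident C U"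
    using hom_from_simple_retraction[OF constituent_simple[OF U]] U unfolding constituent_def by metis
  obtain f' r' where f': "f' \<in> Hom C V P" and r': "r' \<in> Hom C P V" "r' \<cdot> f' = Ident C V"
    using hom_from_simple_retraction[OF constituent_simple[OF V]] V unfolding constituent_def by metis
  have [simp]: "f \<in> Arr C" "Dom C f = U" "Cod C f = P" "r \<in> Arr C" "Dom C r = P" "Cod C r = U"
    "f' \<in> Arr C" "Dom C f' = V" "Cod C f' = P" "r' \<in> Arr C" "Dom C r' = P" "Cod C r' = V"
    "g \<in> Arr C" "Dom C g = s" "Cod C g = U \<boxtimes> V" "U \<in> Obj C" "V \<in> Obj C" "P \<in> Obj C" "s \<in> Obj C"
    using f r(1) f' r'(1) s constituent_simple[OF U] constituent_simple[OF V] P_obj by (auto simp: in_Hom)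
  let ?h = "(f \<star> f') \<cdot> g"
  have "?h \<noteq> Zero C s (P \<boxtimes> P)"
  proof
    assume z: "?h = Zero C s (P \<boxtimes> P)"
    have "g = (r \<star> r') \<cdot> ?h" by (simp add: fuse r(2) r'(2))
    then show False unfolding z using s(3) by simp
  qed
  then obtain i where "i < length ks" "isomorphic C s (ks ! i)"
    using simple_constituent[OF bp _ s(1), of ?h] ks_simple by (auto simp: in_Hom)
  then show ?thesis by (metis nth_mem)
qed

lemma P_decomposition:
  obtains m :: nat and p \<iota> \<pi> where "biproduct C {..<m} p P \<iota> \<pi>" "\<And>i. i < m \<Longrightarrow> constituent (p i)"
proof -
  obtain m :: nat and p \<iota> \<pi> where b: "biproduct C {..<m} p P \<iota> \<pi>" and ps: "\<And>i. i < m \<Longrightarrow> simple_object C (p i)"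
    using semisimple_biproduct[OF P_obj] by metis
  note [simp] = biproduct_simps[OF b]
  have "constituent (p i)" if i: "i < m" for i
    unfolding constituent_def
  proof (intro conjI bexI notI)
    assume "\<iota> i = Zero C (p i) P"
    then have "\<pi> i \<cdot> \<iota> i = Zero C (p i) (p i)" using i P_obj by simp
    then show False using simple_ident_nonzero[OF ps[OF i]] i by simp
  qed (use i ps in \<open>auto simp: in_Hom\<close>)
  then show ?thesis using that b by blast
qed

text \<open>Products of invertible objects are simple, so a decomposition of \<open>P\<close> into \<open>m\<close> invertible objects gives
  one of \<open>P \<otimes> P\<close> into \<open>m * m\<close> simple objects.\<close>

theorem pointed_square:
  assumes "pointed_category C"
  shows "\<exists>m. length ks = m * m"
proof -
  obtain \<iota> \<pi> where bp: "biproduct C {..<length ks} ((!) ks) (P \<boxtimes> P) \<iota> \<pi>"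
    using square unfolding direct_sum_iff_biproduct by blast
  obtain m :: nat and p \<kappa> \<rho> where b: "biproduct C {..<m} p P \<kappa> \<rho>" and ps: "\<And>i. i < m \<Longrightarrow> constituent (p i)"
    using P_decomposition by metis
  obtain \<alpha> \<beta> where ab: "biproduct C ({..<m} \<times> {..<m}) (\<lambda>(i, j). p i \<boxtimes> p j) (P \<boxtimes> P) \<alpha> \<beta>"
    using biproduct_tensor[OF b b] by blast
  have "invertible_object C (p i)" if "i < m" for i
    using assms constituent_simple[OF ps[OF that]] by (simp add: pointed_category_def)
  then have "simple_object C (case q of (i, j) \<Rightarrow> p i \<boxtimes> p j)" if "q \<in> {..<m} \<times> {..<m}" for q
    using invertible_simple invertible_tensor that by auto
  then have "card {..<length ks} = card ({..<m} \<times> {..<m})"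
    by (intro biproduct_simple_card_unique[OF bp _ ab]) (auto simp: ks_simple)
  then show ?thesis by auto
qed

text \<open>Let \<open>Y\<close> be simple and not invertible, with left dual \<open>Y'\<close>. By duality the multiplicity of an object
  \<open>k\<close> in \<open>Y \<otimes> Z\<close> is the one of \<open>Y' \<otimes> k\<close> in \<open>Z\<close>. For \<open>Z = Y'\<close> it is at most one, so the sum
  \<open>Y \<otimes> Y'\<close> of objects of \<open>ks\<close> has at most two terms. One term would make \<open>Y\<close> invertible; so there are two,
  one of them the unit, and tensoring with the other one, \<open>a\<close>, fixes \<open>Y'\<close>. For any other non-invertible simple \<open>Z\<close> it
  follows that \<open>Z\<close> is isomorphic to \<open>Y' \<otimes> 1\<close> or to \<open>Y' \<otimes> a\<close>, hence to \<open>Y'\<close>.\<close>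

theorem not_pointed_ising:
  assumes np: "\<not> pointed_category C"
  shows "\<exists>a x. iso_reps C (simple_object C) [TUnit C, a, x] \<and>
      invertible_object C a \<and> \<not> invertible_object C x \<and>
      isomorphic C (a \<boxtimes> a) (TUnit C) \<and> direct_sum C [TUnit C, a] (x \<boxtimes> x)" (is ?ising)
    and "\<exists>m. length ks = 2 * (m * m)"
proof -
  let ?I = "TUnit C"
  obtain \<iota> \<pi> where bp: "biproduct C {..<length ks} ((!) ks) (P \<boxtimes> P) \<iota> \<pi>"
    using square unfolding direct_sum_iff_biproduct by blast
  obtain Y where Y: "simple_object C Y" "\<not> invertible_object C Y"
    using np by (auto simp: pointed_category_def)
  have Yo [simp]: "Y \<in> Obj C" using Y by simp
  have noninv: "constituent Z" if "simple_object C Z" "\<not> invertible_object C Z" for Z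
    using cover[OF that(1)] that ks_invertible invertible_iso_invariant isomorphic_sym
    unfolding constituent_def by blast
  \<comment> \<open>If \<open>W\<close> were invertible, \<open>Y \<otimes> W\<close> would be simple, hence one of the invertible objects in \<open>ks\<close>.\<close>
  have all_noninv: "\<not> invertible_object C W" if W: "constituent W" for W
  proof
    assume i: "invertible_object C W"
    have Wo: "W \<in> Obj C" using i by simp
    have s: "simple_object C (Y \<boxtimes> W)"
      using invertible_tensor_simple[OF i Y(1)] simple_iso_invariant isomorphic_braid Wo Yo by blast
    obtain k where "k \<in> set ks" "isomorphic C (Y \<boxtimes> W) k"
      using product_constituent_in_ks[OF noninv[OF Y] W s, of "Ident C (Y \<boxtimes> W)"] simple_ident_nonzero[OF s] Wo
      by (auto simp: in_Hom)
    then have "invertible_object C (Y \<boxtimes> W)" using ks_invertible invertible_iso_invariant isomorphic_sym by blast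
    then show False using invertible_factor Wo Y(2) Yo by blast
  qed
  obtain Y' ev coev where d: "is_dual C Y Y' ev coev" using left_dual[OF Yo] by blast
  note [simp] = dual_simps[OF d]
  have Y's: "simple_object C Y'" by (rule dual_of_simple[OF d Y(1)])
  have Y'n: "\<not> invertible_object C Y'"
  proof
    assume i: "invertible_object C Y'"
    have s: "simple_object C (Y \<boxtimes> Y')"
      using invertible_tensor_simple[OF i Y(1)] simple_iso_invariant isomorphic_braid[of Y' Y] by simp
    have "isomorphic C ?I (Y \<boxtimes> Y')"
      by (rule simple_isomorphicI[OF unit_simple s, of coev]) (simp_all add: in_Hom coev_nonzero[OF d simple_nonzero[OF Y(1)]])
    then have "invertible_object C (Y \<boxtimes> Y')" using invertible_iso_invariant invertible_unit by blast
    then show False using invertible_factor(1) Y(2) by simp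
  qed
  obtain n :: nat and z \<kappa> \<rho> where bz: "biproduct C {..<n} z (Y \<boxtimes> Y') \<kappa> \<rho>" and zs: "\<And>i. i < n \<Longrightarrow> simple_object C (z i)"
    using semisimple_biproduct[OF tens_objs(1)[OF Yo dual_simps(2)[OF d]]] by metis
  have z_nonzero: "\<exists>f \<in> Hom C (z i) (Y \<boxtimes> Y'). f \<noteq> Zero C (z i) (Y \<boxtimes> Y')" if i: "i < n" for i
  proof (intro bexI notI)
    assume "\<kappa> i = Zero C (z i) (Y \<boxtimes> Y')"
    then have "\<rho> i \<cdot> \<kappa> i = Zero C (z i) (z i)" using i biproductD[OF bz] by simp
    then show False using simple_ident_nonzero[OF zs[OF i]] i biproductD(10)[OF bz] by simp
  qed (use i biproductD[OF bz] in \<open>auto simp: in_Hom\<close>)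
  have z_ks: "\<exists>k \<in> set ks. isomorphic C (z i) k" if i: "i < n" for i
    using z_nonzero[OF i] product_constituent_in_ks[OF noninv[OF Y] noninv[OF Y's Y'n] zs[OF i]] by blast
  have z_inv: "invertible_object C (z i)" if i: "i < n" for i
    using z_ks[OF i] ks_invertible invertible_iso_invariant isomorphic_sym by blast
  have Y'z: "simple_object C (Y' \<boxtimes> s)" if "invertible_object C s" for s
    using invertible_tensor_simple[OF that Y's] simple_iso_invariant[OF isomorphic_braid] that by simp
  have z_dist: "i = j" if ij: "i < n" "j < n" "isomorphic C (z i) (z j)" for i j
  proof -
    have "thin (Y' \<boxtimes> z i) Y'" by (rule thin_simple[OF Y'z[OF z_inv[OF ij(1)]] Y's])
    then have "thin (z i) (Y \<boxtimes> Y')" using thin_transpose[OF d, of "z i" Y'] zs[OF ij(1)] by simp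
    then show ?thesis
      using thin_distinct_constituents[OF bz _ zs[OF ij(1)], of i j] ij zs[OF ij(1)] by simp
  qed
  have n0: "n \<noteq> 0"
  proof
    assume "n = 0"
    then have "Ident C (Y \<boxtimes> Y') = Zero C (Y \<boxtimes> Y') (Y \<boxtimes> Y')" using biproductD(12)[OF bz] by simp
    then have "zero_object C (Y \<boxtimes> Y')" by (simp add: zero_object_def)
    then show False using tensor_nonzero simple_nonzero[OF Y(1)] simple_nonzero[OF Y's] by simp
  qed
  have n1: "n \<noteq> 1"
  proof
    assume n: "n = 1"
    then have "{..<n} = {0}" by auto
    then have "isomorphic C (z 0) (Y \<boxtimes> Y')" using biproduct_unique_summand_iso[of 0 z] bz by simp
    then have "invertible_object C (Y \<boxtimes> Y')" using z_inv[of 0] n invertible_iso_invariant by simp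
    then show False using invertible_factor(1) Y(2) by simp
  qed
  \<comment> \<open>Three summands would be pairwise non-isomorphic objects of \<open>ks\<close>.\<close>
  have n2: "n = 2"
  proof (rule ccontr)
    assume "n \<noteq> 2"
    then have n: "0 < n" "1 < n" "2 < n" using n0 n1 by auto
    obtain k0 k1 k2 where k: "k0 \<in> set ks" "isomorphic C (z 0) k0" "k1 \<in> set ks" "isomorphic C (z 1) k1"
      "k2 \<in> set ks" "isomorphic C (z 2) k2" using z_ks n by meson
    have "isomorphic C (z 0) (z 1) \<or> isomorphic C (z 0) (z 2) \<or> isomorphic C (z 1) (z 2)"
      using ks_at_most_two[OF k(1,3,5)] k isomorphic_trans isomorphic_sym by meson
    then show False using z_dist[OF n(1,2)] z_dist[OF n(1,3)] z_dist[OF n(2,3)] by auto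
  qed
  obtain i where i: "i < 2" "isomorphic C ?I (z i)"
    using simple_constituent[OF bz _ unit_simple, of coev] zs coev_nonzero[OF d simple_nonzero[OF Y(1)]] n2
    by (auto simp: in_Hom)
  define a where "a = z (1 - i)"
  have ai: "1 - i < 2" "i \<noteq> 1 - i" using i(1) by arith+
  have ao [simp]: "a \<in> Obj C" and a_simple: "simple_object C a" and a_inv: "invertible_object C a"
    using zs[of "1 - i"] z_inv[of "1 - i"] n2 ai by (auto simp: a_def)
  have a1: "\<not> isomorphic C ?I a"
  proof
    assume "isomorphic C ?I a"
    then have "isomorphic C (z i) (z (1 - i))" using i isomorphic_trans isomorphic_sym unfolding a_def by blast
    then show False using z_dist[of i "1 - i"] i(1) n2 ai by simp
  qed
  have ks_two: "isomorphic C k ?I \<or> isomorphic C k a" if k: "k \<in> set ks" for k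
  proof -
    obtain k0 k1 where k': "k0 \<in> set ks" "isomorphic C (z i) k0" "k1 \<in> set ks" "isomorphic C a k1"
      using z_ks i(1) ai n2 unfolding a_def by meson
    have "\<not> isomorphic C k0 k1"
      using a1 k' i(2) isomorphic_trans isomorphic_sym by meson
    then have "isomorphic C k k0 \<or> isomorphic C k k1" using ks_at_most_two[OF k k'(1,3)] by blast
    then show ?thesis using k' i(2) isomorphic_trans isomorphic_sym by meson
  qed
  have simple_hom_iso: "isomorphic C (Y' \<boxtimes> s) Z"
    if s: "invertible_object C s" and Z: "simple_object C Z" and f: "\<exists>f \<in> Hom C s (Y \<boxtimes> Z). f \<noteq> Zero C s (Y \<boxtimes> Z)" for s Z
  proof -
    obtain g where "g \<in> Hom C (Y' \<boxtimes> s) Z" "g \<noteq> Zero C (Y' \<boxtimes> s) Z"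
      using nonzero_transpose[OF d, of s Z] f s Z by auto
    then show ?thesis using simple_isomorphicI[OF Y'z[OF s] Z] by blast
  qed
  have Y'a: "isomorphic C (Y' \<boxtimes> a) Y'"
    using simple_hom_iso[OF a_inv Y's] z_nonzero[of "1 - i"] n2 ai by (simp add: a_def)
  have unique: "isomorphic C Z Y'" if Z: "simple_object C Z" "\<not> invertible_object C Z" for Z
  proof -
    have Zo [simp]: "Z \<in> Obj C" using Z by simp
    obtain s f where sf: "simple_object C s" "f \<in> Hom C s (Y \<boxtimes> Z)" "f \<noteq> Zero C s (Y \<boxtimes> Z)"
      using nonzero_constituent[of "Y \<boxtimes> Z"] tensor_nonzero[OF Yo simple_nonzero[OF Y(1)] Zo simple_nonzero[OF Z(1)]]
      by (metis Yo Zo tens_objs(1))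
    obtain k where k: "k \<in> set ks" "isomorphic C s k"
      using product_constituent_in_ks[OF noninv[OF Y] noninv[OF Z] sf] by blast
    have s_inv: "invertible_object C s" using k ks_invertible invertible_iso_invariant isomorphic_sym by blast
    have 1: "isomorphic C (Y' \<boxtimes> s) Z" using simple_hom_iso[OF s_inv Z(1)] sf by blast
    have "isomorphic C s ?I \<or> isomorphic C s a" using ks_two[OF k(1)] k(2) isomorphic_trans by blast
    then have "isomorphic C (Y' \<boxtimes> s) Y'"
    proof
      assume "isomorphic C s ?I"
      then have "isomorphic C (Y' \<boxtimes> s) (Y' \<boxtimes> ?I)" by (intro isomorphic_tensor isomorphic_refl) simp
      then show ?thesis using isomorphic_runit[of Y'] isomorphic_trans by simp
    next
      assume "isomorphic C s a"
      then have "isomorphic C (Y' \<boxtimes> s) (Y' \<boxtimes> a)" by (intro isomorphic_tensor isomorphic_refl) simp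
      then show ?thesis using Y'a isomorphic_trans by blast
    qed
    then show ?thesis using 1 isomorphic_trans isomorphic_sym by blast
  qed
  have YY': "isomorphic C Y Y'" using unique Y by blast
  have prod: "\<exists>\<alpha> \<beta>. biproduct C {..<2} ((!) [?I, a]) (U \<boxtimes> V) \<alpha> \<beta>"
    if UV: "simple_object C U" "\<not> invertible_object C U" "simple_object C V" "\<not> invertible_object C V" for U V
  proof -
    have "isomorphic C (Y \<boxtimes> Y') (U \<boxtimes> V)"
      using isomorphic_tensor YY' unique[OF UV(1,2)] unique[OF UV(3,4)] isomorphic_trans isomorphic_sym by meson
    then obtain u where u: "u \<in> Hom C (Y \<boxtimes> Y') (U \<boxtimes> V)" "is_iso C u" by (auto simp: isomorphic_def)
    \<comment> \<open>The reindexing puts the unit first.\<close>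
    define h where "h j = (if j = 0 then i else 1 - i)" for j :: nat
    have "bij_betw h {..<2} {..<n}"
    proof -
      have "{..<2::nat} = {0, 1}" by auto
      moreover have "h ` {0, 1} = {0, 1}" using i(1) by (auto simp: h_def image_iff less_2_cases_iff)
      moreover have "inj_on h {0, 1}" using ai(2) by (auto simp: h_def inj_on_def)
      ultimately show ?thesis using n2 by (simp add: bij_betw_def)
    qed
    from biproduct_reindex[OF biproduct_iso_target[OF bz u] this]
    obtain \<alpha> \<beta> where ab: "biproduct C {..<2} (\<lambda>j. z (h j)) (U \<boxtimes> V) \<alpha> \<beta>" by blast
    have "isomorphic C (z (h j)) ([?I, a] ! j)" if "j \<in> {..<2}" for j
    proof (cases "j = 0")
      case True
      then show ?thesis using isomorphic_sym[OF i(2)] by (simp add: h_def)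
    next
      case False
      then have "j = 1" using that by auto
      then show ?thesis using isomorphic_refl[OF ao] by (simp add: h_def a_def)
    qed
    then show ?thesis using biproduct_iso_summands[OF ab] by blast
  qed
  have inv_two: "isomorphic C g ?I \<or> isomorphic C g a" if g: "invertible_object C g" for g
  proof -
    have gs: "simple_object C g" by (rule invertible_simple[OF g])
    have "\<not> constituent g" using all_noninv g by blast
    then obtain k where "k \<in> set ks" "isomorphic C g k" using cover[OF gs] gs unfolding constituent_def by blast
    then show ?thesis using ks_two isomorphic_trans by blast
  qed
  have aa: "isomorphic C (a \<boxtimes> a) ?I"
  proof -
    have "\<not> isomorphic C (a \<boxtimes> a) a"
    proof
      assume "isomorphic C (a \<boxtimes> a) a"
      then have "isomorphic C (a \<boxtimes> a) (a \<boxtimes> ?I)"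
        by (rule isomorphic_trans[OF _ isomorphic_sym[OF isomorphic_runit[OF ao]]])
      then have "isomorphic C a ?I" using invertible_cancel[OF a_inv] by simp
      then show False using a1 isomorphic_sym by blast
    qed
    then show ?thesis using inv_two[OF invertible_tensor[OF a_inv a_inv]] by blast
  qed
  have "iso_reps C (simple_object C) [?I, a, Y]"
    unfolding iso_reps_def
  proof (intro conjI allI ballI impI)
    show "x \<in> Obj C" "simple_object C x" if "x \<in> set [?I, a, Y]" for x
      using that unit_simple a_simple Y(1) by auto
    have nY: "\<not> isomorphic C g Y" "\<not> isomorphic C Y g" if "invertible_object C g" for g
      using that Y(2) invertible_iso_invariant isomorphic_sym by blast+
    fix p q assume pq: "p < length [?I, a, Y]" "q < length [?I, a, Y]" "isomorphic C ([?I, a, Y] ! p) ([?I, a, Y] ! q)"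
    have p: "p = 0 \<or> p = 1 \<or> p = 2" and q: "q = 0 \<or> q = 1 \<or> q = 2" using pq by auto
    have "\<not> isomorphic C a ?I" using a1 isomorphic_sym by blast
    then show "p = q"
      using pq(3) p q a1 nY[OF invertible_unit] nY[OF a_inv] by (elim disjE) simp_all
  next
    fix y assume y: "y \<in> Obj C" "simple_object C y"
    show "\<exists>x \<in> set [?I, a, Y]. isomorphic C y x"
    proof (cases "invertible_object C y")
      case True
      then show ?thesis using inv_two by auto
    next
      case False
      then show ?thesis using unique[OF y(2)] YY' isomorphic_trans isomorphic_sym by (metis list.set_intros)
    qed
  qed
  moreover have "direct_sum C [?I, a] (Y \<boxtimes> Y)"
    unfolding direct_sum_iff_biproduct using prod[OF Y Y] by (simp add: numeral_2_eq_2)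
  ultimately show ?ising using a_inv Y(2) aa by blast
  obtain m :: nat and p \<gamma> \<delta> where b: "biproduct C {..<m} p P \<gamma> \<delta>" and ps: "\<And>i. i < m \<Longrightarrow> constituent (p i)"
    using P_decomposition by metis
  obtain \<alpha> \<beta> where ab: "biproduct C ({..<m} \<times> {..<m}) (\<lambda>(i, j). p i \<boxtimes> p j) (P \<boxtimes> P) \<alpha> \<beta>"
    using biproduct_tensor[OF b b] by blast
  have "\<forall>q \<in> {..<m} \<times> {..<m}. \<exists>e. biproduct C {..<2} ((!) [?I, a]) (case q of (i, j) \<Rightarrow> p i \<boxtimes> p j) (fst e) (snd e)"
  proof
    fix q assume "q \<in> {..<m} \<times> {..<m}"
    then obtain u v where q: "q = (u, v)" "u < m" "v < m" by auto
    obtain \<epsilon> \<zeta> where "biproduct C {..<2} ((!) [?I, a]) (p u \<boxtimes> p v) \<epsilon> \<zeta>"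
      using prod constituent_simple[OF ps] all_noninv[OF ps] q by meson
    then show "\<exists>e. biproduct C {..<2} ((!) [?I, a]) (case q of (i, j) \<Rightarrow> p i \<boxtimes> p j) (fst e) (snd e)"
      using q by (intro exI[of _ "(\<epsilon>, \<zeta>)"]) simp
  qed
  then obtain e where e: "\<And>q. q \<in> {..<m} \<times> {..<m} \<Longrightarrow>
      biproduct C {..<2} ((!) [?I, a]) (case q of (i, j) \<Rightarrow> p i \<boxtimes> p j) (fst (e q)) (snd (e q))"
    using bchoice by metis
  have "card {..<length ks} = card (({..<m} \<times> {..<m}) \<times> {..<2::nat})"
  proof (rule biproduct_simple_card_unique[OF bp _ biproduct_Sigma[OF ab e]])
    show "simple_object C (ks ! i)" if "i \<in> {..<length ks}" for i using that ks_simple by simp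
    show "simple_object C (case q of (i, j) \<Rightarrow> [?I, a] ! j)" if "q \<in> ({..<m} \<times> {..<m}) \<times> {..<2}" for q
      using that unit_simple a_simple by (auto simp: less_2_cases_iff)
  qed
  then show "\<exists>m. length ks = 2 * (m * m)" by (auto simp: card_cartesian_product)
qed

end

section \<open>Dominant functors\<close>

context is_functor
begin

lemma farr_simps:
  assumes "category C" "f \<in> Arr C"
  shows "FArr F f \<in> Arr D" "Dom D (FArr F f) = FObj F (Dom C f)" "Cod D (FArr F f) = FObj F (Cod C f)"
  using farr[of f "Dom C f" "Cod C f"] assms by (auto simp: Hom_def)

lemma farr_comp':
  assumes "category C" "f \<in> Arr C" "g \<in> Arr C" "Cod C f = Dom C g"
  shows "FArr F (Comp C g f) = Comp D (FArr F g) (FArr F f)"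
  using farr_comp[of f "Dom C f" "Cod C f" g "Cod C g"] assms by (auto simp: Hom_def)

end

context modularization
begin

lemmas fsimps = farr_simps[OF source.category_axioms] farr_comp'[OF source.category_axioms] fobj farr_ident

lemma functor_isomorphic:
  assumes "isomorphic C x y"
  shows "isomorphic D (FObj F x) (FObj F y)"
proof -
  obtain f where f: "f \<in> Hom C x y" "is_iso C f" using assms by (auto simp: isomorphic_def)
  have fs: "f \<in> Arr C" "Dom C f = x" "Cod C f = y" using f by (auto simp: source.in_Hom)
  have o: "x \<in> Obj C" "y \<in> Obj C" using source.isomorphic_objs[OF assms] by auto
  have 1: "Comp D (FArr F (inv_arr C f)) (FArr F f) = Ident D (FObj F x)"
    using fsimps(4)[of f "inv_arr C f"] f(2) fs o farr_ident by simp
  have 2: "Comp D (FArr F f) (FArr F (inv_arr C f)) = Ident D (FObj F y)"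
    using fsimps(4)[of "inv_arr C f" f] f(2) fs o farr_ident by simp
  show ?thesis
    by (rule target.isomorphicI[OF _ target.isoI(1)[OF _ _ 1 2]])
      (use f(2) fs in \<open>auto simp: target.in_Hom fsimps\<close>)
qed

lemma functor_zero:
  assumes "x \<in> Obj C" "y \<in> Obj C"
  shows "FArr F (Zero C x y) = Zero D (FObj F x) (FObj F y)"
proof -
  have z: "Zero C x y \<in> Hom C x y" using assms by (simp add: source.in_Hom)
  have "FArr F (Zero C x y) = FArr F (Scale C 0 (Zero C x y))" using assms by simp
  also have "\<dots> = Scale D 0 (FArr F (Zero C x y))" by (rule farr_scale[OF z])
  also have "\<dots> = Zero D (FObj F x) (FObj F y)" using assms by (simp add: fsimps)
  finally show ?thesis .
qed

lemma functor_biproduct: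
  assumes b: "biproduct C I x z \<iota> \<pi>"
  shows "biproduct D I (\<lambda>i. FObj F (x i)) (FObj F z) (\<lambda>i. FArr F (\<iota> i)) (\<lambda>i. FArr F (\<pi> i))"
proof -
  note [simp] = source.biproduct_simps[OF b]
  have "FArr F (source.hsum z z (\<lambda>i. Comp C (\<iota> i) (\<pi> i)) I) =
      target.hsum (FObj F z) (FObj F z) (\<lambda>i. FArr F (Comp C (\<iota> i) (\<pi> i))) I"
    by (rule source.hsum_additive[where T = "FArr F" and D = D])
      (use target.linear_category_axioms farr_add functor_zero in \<open>auto simp: source.in_Hom target.in_Hom fsimps\<close>)
  also have "\<dots> = target.hsum (FObj F z) (FObj F z) (\<lambda>i. Comp D (FArr F (\<iota> i)) (FArr F (\<pi> i))) I"
    by (rule target.hsum_cong) (auto simp: target.in_Hom fsimps)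
  finally have sum: "target.hsum (FObj F z) (FObj F z) (\<lambda>i. Comp D (FArr F (\<iota> i)) (FArr F (\<pi> i))) I = Ident D (FObj F z)"
    by (simp add: fsimps)
  have "Comp D (FArr F (\<pi> j)) (FArr F (\<iota> i)) = (if i = j then Ident D (FObj F (x i)) else Zero D (FObj F (x i)) (FObj F (x j)))"
    if "i \<in> I" "j \<in> I" for i j
    using that fsimps(4)[of "\<iota> i" "\<pi> j"] functor_zero by (cases "i = j") (auto simp: fsimps)
  then show ?thesis unfolding biproduct_def using sum by (auto simp: target.in_Hom fsimps)
qed

lemma functor_tensor: "\<lbrakk>x \<in> Obj C; y \<in> Obj C\<rbrakk> \<Longrightarrow>
    isomorphic D (TensO D (FObj F x) (FObj F y)) (FObj F (TensO C x y))"
  using target.isomorphicI ftens_hom ftens_iso by blast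

lemma functor_unit: "isomorphic D (TUnit D) (FObj F (TUnit C))"
  using target.isomorphicI funit_hom funit_iso by blast

lemma functor_invertible:
  assumes "invertible_object C g"
  shows "invertible_object D (FObj F g)"
proof -
  obtain h where h: "h \<in> Obj C" "isomorphic C (TensO C g h) (TUnit C)" using assms unfolding source.invertible_iff by blast
  have g: "g \<in> Obj C" using assms by simp
  have "isomorphic D (TensO D (FObj F g) (FObj F h)) (TUnit D)"
    using functor_tensor[OF g h(1)] functor_isomorphic[OF h(2)] functor_unit target.isomorphic_trans target.isomorphic_sym
    by blast
  then show ?thesis unfolding target.invertible_iff using g h fobj by blast
qed

lemma functor_braid_scalar:
  assumes b: "source.braid_scalar x y b"
  shows "target.braid_scalar (FObj F x) (FObj F y) b"
proof -
  have o: "x \<in> Obj C" "y \<in> Obj C" and e: "source.double_braid x y = Scale C b (Ident C (TensO C x y))"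
    using b by (auto simp: source.braid_scalar_def)
  let ?x = "FObj F x" and ?y = "FObj F y"
  have [simp]: "?x \<in> Obj D" "?y \<in> Obj D" using o fobj by auto
  have t: "FTens F x y \<in> Arr D" "Dom D (FTens F x y) = TensO D ?x ?y" "Cod D (FTens F x y) = FObj F (TensO C x y)"
    "is_iso D (FTens F x y)" "FTens F y x \<in> Arr D" "Dom D (FTens F y x) = TensO D ?y ?x" "Cod D (FTens F y x) = FObj F (TensO C y x)"
    using ftens_hom[OF o] ftens_hom[OF o(2,1)] ftens_iso[OF o] by (auto simp: target.in_Hom)
  note [simp] = t o fsimps
  have "Comp D (FTens F x y) (target.double_braid ?x ?y) = Comp D (Comp D (FTens F x y) (Braid D ?y ?x)) (Braid D ?x ?y)"
    by (simp add: target.double_braid_def)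
  also have "\<dots> = Comp D (FArr F (Braid C y x)) (Comp D (FTens F y x) (Braid D ?x ?y))"
    unfolding ftens_braid[OF o(2,1), symmetric] by simp
  also have "\<dots> = Comp D (Comp D (FArr F (Braid C y x)) (FArr F (Braid C x y))) (FTens F x y)"
    unfolding ftens_braid[OF o, symmetric] by simp
  also have "Comp D (FArr F (Braid C y x)) (FArr F (Braid C x y)) = FArr F (source.double_braid x y)"
    by (simp add: source.double_braid_def)
  also have "\<dots> = Scale D b (Ident D (FObj F (TensO C x y)))"
    unfolding e using farr_scale[of "Ident C (TensO C x y)" "TensO C x y" "TensO C x y" b] by (simp add: source.in_Hom)
  also have "Comp D \<dots> (FTens F x y) = Comp D (FTens F x y) (Scale D b (Ident D (TensO D ?x ?y)))" by simp
  finally have "target.double_braid ?x ?y = Scale D b (Ident D (TensO D ?x ?y))"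
    by (subst (asm) target.iso_cancel_left) simp_all
  then show ?thesis by (simp add: target.braid_scalar_def)
qed

lemma dominant_constituent:
  assumes s: "simple_object D s"
  obtains t f where "simple_object C t" "f \<in> Hom D s (FObj F t)" "f \<noteq> Zero D s (FObj F t)"
proof -
  have so: "s \<in> Obj D" using s by simp
  obtain x f where x: "x \<in> Obj C" and f: "f \<in> Hom D s (FObj F x)" "is_mono D f"
    using dominant so unfolding dominant_def by blast
  have "f \<noteq> Zero D s (FObj F x)"
  proof
    assume z: "f = Zero D s (FObj F x)"
    have "Comp D f (Ident D s) = Comp D f (Zero D s s)" using z so x fobj by simp
    then have "Ident D s = Zero D s s"
      using f so unfolding is_mono_def by (auto simp: target.in_Hom)
    then show False using target.simple_ident_nonzero[OF s] by simp
  qed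
  moreover obtain n :: nat and t \<iota> \<pi> where b: "biproduct C {..<n} t x \<iota> \<pi>" and ts: "\<And>i. i < n \<Longrightarrow> simple_object C (t i)"
    using source.semisimple_biproduct[OF x] by metis
  ultimately obtain i where i: "i \<in> {..<n}" "Comp D (FArr F (\<pi> i)) f \<noteq> Zero D s (FObj F (t i))"
    using target.hom_from_simple_nonzero[OF functor_biproduct[OF b] s f(1)] by blast
  show ?thesis
    by (rule that[of "t i" "Comp D (FArr F (\<pi> i)) f"])
      (use i f ts source.biproduct_simps[OF b] in \<open>auto simp: target.in_Hom fsimps\<close>)
qed

text \<open>A simple object \<open>s\<close> of the modularization has a non-zero arrow to some \<open>F t\<close> with \<open>t\<close> simple. If \<open>t\<close> is
  invertible, so is \<open>F t\<close>, and the arrow is an isomorphism; otherwise \<open>F t\<close> is isomorphic to \<open>P\<close>. The double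
  braiding of \<open>g\<close> with \<open>X\<close> is a scalar because \<open>g \<otimes> X\<close> is simple, and \<open>F\<close> transports it.\<close>

theorem modular_square_image:
  assumes X: "simple_object C X" "\<And>y. \<lbrakk>simple_object C y; \<not> invertible_object C y\<rbrakk> \<Longrightarrow> isomorphic C y X"
    and gs: "iso_reps C (invertible_object C) gs" "direct_sum C gs (TensO C X X)"
  shows "modular_square D (FObj F X) (map (FObj F) gs)"
proof
  have Xo: "X \<in> Obj C" using X(1) by simp
  have gsD: "invertible_object C g" if "g \<in> set gs" for g using gs(1) that by (simp add: iso_reps_def)
  have gsE: "\<exists>h \<in> set gs. isomorphic C g h" if "invertible_object C g" for g
    using gs(1) that source.invertible_obj[OF that] unfolding iso_reps_def by blast
  show "FObj F X \<in> Obj D" using Xo fobj by simp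
  obtain \<iota> \<pi> where b: "biproduct C {..<length gs} ((!) gs) (TensO C X X) \<iota> \<pi>"
    using gs(2) unfolding source.direct_sum_iff_biproduct by blast
  obtain u where u: "u \<in> Hom D (FObj F (TensO C X X)) (TensO D (FObj F X) (FObj F X))" "is_iso D u"
    using target.isomorphic_sym[OF functor_tensor[OF Xo Xo]] by (auto simp: isomorphic_def)
  obtain \<alpha> \<beta> where "biproduct D {..<length gs} (\<lambda>i. FObj F (gs ! i)) (TensO D (FObj F X) (FObj F X)) \<alpha> \<beta>"
    using target.biproduct_iso_target[OF functor_biproduct[OF b] u] by blast
  then have "\<exists>\<iota> \<pi>. biproduct D {..<length gs} ((!) (map (FObj F) gs)) (TensO D (FObj F X) (FObj F X)) \<iota> \<pi>"
    by (rule target.biproduct_iso_summands) (use gsD fobj in \<open>auto intro!: target.isomorphic_refl\<close>)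
  then show "direct_sum D (map (FObj F) gs) (TensO D (FObj F X) (FObj F X))"
    unfolding target.direct_sum_iff_biproduct by simp
  show "invertible_object D k" if "k \<in> set (map (FObj F) gs)" for k
    using that gsD functor_invertible by auto
  show "\<exists>k \<in> set (map (FObj F) gs). isomorphic D k (TUnit D)"
  proof -
    obtain h where h: "h \<in> set gs" "isomorphic C (TUnit C) h" using gsE source.invertible_unit by blast
    have "isomorphic D (FObj F h) (TUnit D)"
      using target.isomorphic_sym[OF target.isomorphic_trans[OF functor_unit functor_isomorphic[OF h(2)]]] .
    then show ?thesis using h(1) by auto
  qed
  show "(\<exists>k \<in> set (map (FObj F) gs). isomorphic D s k) \<or> (\<exists>f \<in> Hom D s (FObj F X). f \<noteq> Zero D s (FObj F X))"
    if s: "simple_object D s" for s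
  proof -
    obtain t f where t: "simple_object C t" and f: "f \<in> Hom D s (FObj F t)" "f \<noteq> Zero D s (FObj F t)"
      using dominant_constituent[OF s] by blast
    show ?thesis
    proof (cases "invertible_object C t")
      case True
      then obtain h where h: "h \<in> set gs" "isomorphic C t h" using gsE by blast
      have "isomorphic D s (FObj F t)"
        using target.simple_isomorphicI[OF s target.invertible_simple[OF functor_invertible[OF True]] f] .
      then have "isomorphic D s (FObj F h)" using functor_isomorphic[OF h(2)] target.isomorphic_trans by blast
      then show ?thesis using h(1) by auto
    next
      case False
      obtain u where u: "u \<in> Hom D (FObj F t) (FObj F X)" "is_iso D u"
        using functor_isomorphic[OF X(2)[OF t False]] by (auto simp: isomorphic_def)
      have us: "u \<in> Arr D" "Dom D u = FObj F t" "Cod D u = FObj F X" "f \<in> Arr D" "Dom D f = s" "Cod D f = FObj F t"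
        "s \<in> Obj D" "FObj F X \<in> Obj D"
        using u(1) f(1) s Xo fobj by (auto simp: target.in_Hom)
      have "Comp D u f \<noteq> Zero D s (FObj F X)"
      proof
        assume z: "Comp D u f = Zero D s (FObj F X)"
        have "f = Comp D (inv_arr D u) (Comp D u f)" using u(2) us by simp
        then show False unfolding z using f(2) u(2) us by simp
      qed
      then show ?thesis using us by (auto simp: target.in_Hom)
    qed
  qed
  show "\<exists>b. target.braid_scalar k (FObj F X) b" if k: "k \<in> set (map (FObj F) gs)" for k
  proof -
    obtain g where g: "g \<in> set gs" "k = FObj F g" using k by auto
    have go: "g \<in> Obj C" using gsD[OF g(1)] by simp
    have "\<exists>b. source.double_braid g X = Scale C b (Ident C (TensO C g X))"
      using source.schur_scalar[OF source.invertible_tensor_simple[OF gsD[OF g(1)] X(1)]] go Xo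
      by (simp add: source.in_Hom)
    then obtain b where "source.braid_scalar g X b" using go Xo by (auto simp: source.braid_scalar_def)
    then show ?thesis using functor_braid_scalar g(2) by blast
  qed
qed

end

section \<open>Frobenius-Perron dimensions\<close>

lemma finite_eigenvalues:
  fixes A :: "real mat"
  assumes "A \<in> carrier_mat n n"
  shows "finite {r. eigenvalue A r}"
proof -
  have "char_poly A \<noteq> 0" using degree_monic_char_poly[OF assms] by auto
  then have "finite {r. poly (char_poly A) r = 0}" by (rule poly_roots_finite)
  then show ?thesis using eigenvalue_root_char_poly[OF assms] by simp
qed

lemma eigenvalue_mat_iff:
  fixes M :: "nat \<Rightarrow> nat \<Rightarrow> real"
  shows "eigenvalue (mat n n (\<lambda>(i, j). M i j)) r \<longleftrightarrow>
    (\<exists>v. (\<exists>i < n. v i \<noteq> 0) \<and> (\<forall>i < n. (\<Sum>j<n. M i j * v j) = r * v i))" (is "?l \<longleftrightarrow> ?r")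
proof
  let ?A = "mat n n (\<lambda>(i, j). M i j)"
  assume ?l
  then obtain v where v: "v \<in> carrier_vec n" "v \<noteq> 0\<^sub>v n" "?A *\<^sub>v v = r \<cdot>\<^sub>v v"
    by (auto simp: eigenvalue_def eigenvector_def)
  have "\<exists>i < n. v $ i \<noteq> 0" using v(1,2) by (metis carrier_vecD eq_vecI index_zero_vec)
  moreover have "(\<Sum>j<n. M i j * v $ j) = r * v $ i" if "i < n" for i
  proof -
    have "(?A *\<^sub>v v) $ i = (\<Sum>j<n. M i j * v $ j)"
      using that v(1) by (auto simp: scalar_prod_def atLeast0LessThan intro!: sum.cong)
    moreover have "(?A *\<^sub>v v) $ i = r * v $ i" unfolding v(3) using that v(1) by simp
    ultimately show ?thesis by simp
  qed
  ultimately show ?r by (intro exI[of _ "\<lambda>i. v $ i"]) blast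
next
  let ?A = "mat n n (\<lambda>(i, j). M i j)"
  assume ?r
  then obtain v where v: "\<exists>i < n. v i \<noteq> 0" "\<And>i. i < n \<Longrightarrow> (\<Sum>j<n. M i j * v j) = r * v i" by blast
  have "vec n v \<noteq> 0\<^sub>v n" using v(1) by (metis index_vec index_zero_vec(1))
  moreover have "?A *\<^sub>v vec n v = r \<cdot>\<^sub>v vec n v"
  proof (rule eq_vecI)
    fix i assume "i < dim_vec (r \<cdot>\<^sub>v vec n v)"
    then have i: "i < n" by simp
    have "(?A *\<^sub>v vec n v) $ i = (\<Sum>j<n. M i j * v j)"
      using i by (auto simp: scalar_prod_def atLeast0LessThan intro!: sum.cong)
    then show "(?A *\<^sub>v vec n v) $ i = (r \<cdot>\<^sub>v vec n v) $ i" using v(2)[OF i] i by simp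
  qed simp
  ultimately show ?l by (auto simp: eigenvalue_def eigenvector_def intro!: exI[of _ "vec n v"])
qed

text \<open>The defining equation of an eigenvector, read at an index of largest absolute value, bounds the
  eigenvalue by 1. The constant vector attains the bound.\<close>

lemma Max_eigenvalue_selfmap:
  fixes h :: "nat \<Rightarrow> nat"
  assumes n: "n > 0" and h: "\<And>i. i < n \<Longrightarrow> h i < n"
  shows "Max {r :: real. 0 \<le> r \<and> eigenvalue (mat n n (\<lambda>(i, j). if j = h i then 1 else 0)) r} = 1"
proof (rule Max_eqI)
  let ?M = "\<lambda>i j. if j = h i then 1 else 0 :: real"
  have sum: "(\<Sum>j<n. ?M i j * v j) = v (h i)" if "i < n" for i and v :: "nat \<Rightarrow> real"
  proof -
    have "(\<Sum>j<n. ?M i j * v j) = (\<Sum>j<n. if j = h i then v j else 0)" by (intro sum.cong) auto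
    then show ?thesis using h[OF that] by simp
  qed
  show "finite {r. 0 \<le> r \<and> eigenvalue (mat n n (\<lambda>(i, j). ?M i j)) r}"
    by (rule finite_subset[OF _ finite_eigenvalues[of "mat n n (\<lambda>(i, j). ?M i j)" n]]) auto
  show "1 \<in> {r. 0 \<le> r \<and> eigenvalue (mat n n (\<lambda>(i, j). ?M i j)) r}"
    unfolding eigenvalue_mat_iff using n by (auto simp: sum intro!: exI[of _ "\<lambda>_. 1"])
  fix r assume "r \<in> {r. 0 \<le> r \<and> eigenvalue (mat n n (\<lambda>(i, j). ?M i j)) r}"
  then obtain v where r: "0 \<le> r" and v: "\<exists>i < n. v i \<noteq> 0" "\<And>i. i < n \<Longrightarrow> v (h i) = r * v i"
    unfolding eigenvalue_mat_iff using sum by auto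
  let ?a = "\<lambda>i. \<bar>v i\<bar>"
  have fin: "finite (?a ` {..<n})" "?a ` {..<n} \<noteq> {}" using n by auto
  obtain i where i: "i < n" "?a i = Max (?a ` {..<n})" using Max_in[OF fin] by auto
  have mx: "?a j \<le> ?a i" if "j < n" for j unfolding i(2) using fin that by (intro Max_ge) auto
  have "?a i > 0" using v(1) mx by fastforce
  moreover have "r * ?a i \<le> ?a i" using mx[OF h[OF i(1)]] v(2)[OF i(1)] r by (simp add: abs_mult)
  ultimately show "r \<le> 1" by (simp add: mult_le_cancel_right1)
qed

text \<open>The adjacency matrix of a star with \<open>n - 1\<close> leaves and centre \<open>t\<close>.\<close>

lemma Max_eigenvalue_star:
  assumes t: "t < n" and n: "n > 1"
  shows "Max {r :: real. 0 \<le> r \<and> eigenvalue (mat n n (\<lambda>(i, j). if (i = t) \<noteq> (j = t) then 1 else 0)) r} = sqrt (n - 1)"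
proof (rule Max_eqI)
  let ?M = "\<lambda>i j. if (i = t) \<noteq> (j = t) then 1 else 0 :: real"
  let ?K = "{..<n} - {t}"
  have card: "card ?K = n - 1" using t by simp
  have split: "(\<Sum>j<n. f j) = f t + sum f ?K" for f :: "nat \<Rightarrow> real" using t by (subst sum.remove[of _ t]) auto
  have leaf: "(\<Sum>j<n. ?M i j * v j) = v t" if "i < n" "i \<noteq> t" for i v
    unfolding split using that by (simp add: sum.neutral)
  have centre: "(\<Sum>j<n. ?M t j * v j) = sum v ?K" for v
    unfolding split by (auto intro!: sum.cong)
  have eig: "r * r = n - 1" if ev: "eigenvalue (mat n n (\<lambda>(i, j). ?M i j)) r" "r \<noteq> 0" for r
  proof -
    obtain v where v: "\<exists>i < n. v i \<noteq> 0" "\<And>i. i < n \<Longrightarrow> (\<Sum>j<n. ?M i j * v j) = r * v i"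
      using ev(1) unfolding eigenvalue_mat_iff by blast
    have l: "v t = r * v i" if "i < n" "i \<noteq> t" for i using v(2)[OF that(1)] leaf[OF that] by simp
    have c: "sum v ?K = r * v t" using v(2)[OF t] unfolding centre by simp
    have vt: "v t \<noteq> 0" using v(1) l ev(2) by force
    have "r * r * v t = r * sum v ?K" using c by simp
    also have "\<dots> = (\<Sum>i\<in>?K. v t)" unfolding sum_distrib_left by (intro sum.cong refl l[symmetric]) auto
    also have "\<dots> = (n - 1) * v t" using card by simp
    finally show ?thesis using vt by simp
  qed
  show "finite {r. 0 \<le> r \<and> eigenvalue (mat n n (\<lambda>(i, j). ?M i j)) r}"
    by (rule finite_subset[OF _ finite_eigenvalues[of "mat n n (\<lambda>(i, j). ?M i j)" n]]) auto
  show "r \<le> sqrt (n - 1)" if "r \<in> {r. 0 \<le> r \<and> eigenvalue (mat n n (\<lambda>(i, j). ?M i j)) r}" for r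
  proof (cases "r = 0")
    case False
    then have "r * r = n - 1" using eig that by blast
    then show ?thesis by (metis order_refl real_le_rsqrt power2_eq_square)
  qed (use n in simp)
  show "sqrt (n - 1) \<in> {r. 0 \<le> r \<and> eigenvalue (mat n n (\<lambda>(i, j). ?M i j)) r}"
  proof -
    let ?v = "\<lambda>i. if i = t then sqrt (n - 1) else 1 :: real"
    have "(\<Sum>j<n. ?M i j * ?v j) = sqrt (n - 1) * ?v i" if "i < n" for i
    proof (cases "i = t")
      case True
      have "sum ?v ?K = n - 1" using card by (simp add: sum.If_cases)
      then show ?thesis unfolding True centre using n by simp
    next
      case False
      then show ?thesis using leaf[OF that False, of ?v] by simp
    qed
    then show ?thesis unfolding eigenvalue_mat_iff using t n by (auto intro!: exI[of _ ?v] exI[of _ t])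
  qed
qed

context braided_fusion_category
begin

lemma simple_reps: "iso_reps C (simple_object C) (simple_reps C)"
  unfolding simple_reps_def using finitely_many_simples by (rule someI_ex)

lemma simple_reps_nth: "i < length (simple_reps C) \<Longrightarrow> simple_object C (simple_reps C ! i)"
  using simple_reps by (auto simp: iso_reps_def)

lemma simple_reps_inj:
  "\<lbrakk>i < length (simple_reps C); j < length (simple_reps C); isomorphic C (simple_reps C ! i) (simple_reps C ! j)\<rbrakk> \<Longrightarrow> i = j"
  using simple_reps by (auto simp: iso_reps_def)

lemma simple_reps_find:
  assumes "simple_object C t"
  obtains i where "i < length (simple_reps C)" "isomorphic C t (simple_reps C ! i)"
proof -
  have "t \<in> Obj C" using assms by simp
  then obtain x where "x \<in> set (simple_reps C)" "isomorphic C t x" using simple_reps assms unfolding iso_reps_def by blast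
  then show ?thesis using that by (auto simp: in_set_conv_nth)
qed

lemma hom_dim_simple:
  assumes "simple_object C s" "simple_object C z"
  shows "hom_dim C s z = (if isomorphic C s z then 1 else 0)"
  using hom_dim_biproduct[OF biproduct_single[of z "()"], of s] assms by simp

text \<open>Tensoring with \<open>g\<close> permutes the isomorphism classes of simple objects.\<close>

lemma FPdim_invertible:
  assumes g: "invertible_object C g"
  shows "FPdim C g = 1"
proof -
  let ?s = "simple_reps C"
  let ?n = "length ?s"
  have go: "g \<in> Obj C" using g by simp
  obtain h where h: "h \<in> Obj C" "isomorphic C (g \<boxtimes> h) (TUnit C)" using g unfolding invertible_iff by blast
  have h_inv: "invertible_object C h"
    using invertible_iso_invariant[OF isomorphic_sym[OF h(2)] invertible_unit] invertible_factor(2) go h(1) by blast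
  have ex: "\<exists>j. j < ?n \<and> isomorphic C (?s ! i) (g \<boxtimes> ?s ! j)" if i: "i < ?n" for i
  proof -
    have si: "simple_object C (?s ! i)" "?s ! i \<in> Obj C" using simple_reps_nth[OF i] by auto
    obtain j where j: "j < ?n" "isomorphic C (h \<boxtimes> ?s ! i) (?s ! j)"
      using simple_reps_find[OF invertible_tensor_simple[OF h_inv si(1)]] by blast
    have "isomorphic C (g \<boxtimes> ?s ! j) (g \<boxtimes> (h \<boxtimes> ?s ! i))"
      by (rule isomorphic_tensor[OF isomorphic_refl[OF go] isomorphic_sym[OF j(2)]])
    also have "isomorphic C (g \<boxtimes> (h \<boxtimes> ?s ! i)) ((g \<boxtimes> h) \<boxtimes> ?s ! i)"
      using go h(1) si(2) by (rule isomorphic_sym[OF isomorphic_assoc])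
    also have "isomorphic C ((g \<boxtimes> h) \<boxtimes> ?s ! i) (TUnit C \<boxtimes> ?s ! i)"
      by (rule isomorphic_tensor[OF h(2) isomorphic_refl[OF si(2)]])
    also have "isomorphic C (TUnit C \<boxtimes> ?s ! i) (?s ! i)" using si(2) by (rule isomorphic_lunit)
    finally show ?thesis using j(1) isomorphic_sym by blast
  qed
  then obtain p where p: "\<And>i. i < ?n \<Longrightarrow> p i < ?n \<and> isomorphic C (?s ! i) (g \<boxtimes> ?s ! p i)" by metis
  have "fusion_matrix C g = mat ?n ?n (\<lambda>(i, j). if j = p i then 1 else 0)"
  proof (rule eq_matI)
    fix i j assume "i < dim_row (mat ?n ?n (\<lambda>(i, j). if j = p i then 1 else 0 :: real))"
      "j < dim_col (mat ?n ?n (\<lambda>(i, j). if j = p i then 1 else 0 :: real))"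
    then have ij: "i < ?n" "j < ?n" by auto
    have "isomorphic C (?s ! i) (g \<boxtimes> ?s ! j) \<longleftrightarrow> j = p i"
    proof
      assume "isomorphic C (?s ! i) (g \<boxtimes> ?s ! j)"
      then have "isomorphic C (g \<boxtimes> ?s ! j) (g \<boxtimes> ?s ! p i)" using p[OF ij(1)] isomorphic_sym isomorphic_trans by blast
      then have "isomorphic C (?s ! j) (?s ! p i)"
        using invertible_cancel[OF g] simple_reps_nth[OF ij(2)] simple_reps_nth[of "p i"] p[OF ij(1)] by simp
      then show "j = p i" using simple_reps_inj ij p by blast
    qed (use p[OF ij(1)] in simp)
    then show "fusion_matrix C g $$ (i, j) = mat ?n ?n (\<lambda>(i, j). if j = p i then 1 else 0) $$ (i, j)"
      using ij hom_dim_simple[OF simple_reps_nth[OF ij(1)] invertible_tensor_simple[OF g simple_reps_nth[OF ij(2)]]]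
      by (simp add: fusion_matrix_def Let_def)
  qed (auto simp: fusion_matrix_def Let_def)
  moreover have "?n > 0" using simple_reps_find[OF unit_simple] by fastforce
  ultimately show ?thesis unfolding FPdim_def using Max_eigenvalue_selfmap[of ?n p] p by simp
qed

text \<open>Tensoring with \<open>x\<close> sends every invertible object to \<open>x\<close>, and \<open>x\<close> to the sum of all invertible
  objects. So the fusion matrix is the adjacency matrix of a star whose leaves are the invertible
  objects.\<close>

lemma FPdim_noninvertible:
  assumes X: "simple_object C X" "\<And>y. \<lbrakk>simple_object C y; \<not> invertible_object C y\<rbrakk> \<Longrightarrow> isomorphic C y X"
    and gs: "iso_reps C (invertible_object C) gs" "direct_sum C gs (X \<boxtimes> X)"
    and x: "simple_object C x" "\<not> invertible_object C x"
  shows "FPdim C x = sqrt (length gs)"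
proof -
  let ?s = "simple_reps C"
  let ?n = "length ?s"
  have xo [simp]: "x \<in> Obj C" using x by simp
  obtain t where t: "t < ?n" "isomorphic C x (?s ! t)" using simple_reps_find[OF x(1)] by blast
  have st: "\<not> invertible_object C (?s ! t)" using x(2) t(2) invertible_iso_invariant isomorphic_sym by blast
  have inv: "invertible_object C (?s ! i)" if i: "i < ?n" "i \<noteq> t" for i
  proof (rule ccontr)
    assume "\<not> invertible_object C (?s ! i)"
    then have "isomorphic C (?s ! i) (?s ! t)"
      using X(2) simple_reps_nth i(1) t(1) st isomorphic_trans isomorphic_sym by meson
    then show False using simple_reps_inj i t(1) by blast
  qed
  have gsD: "invertible_object C (gs ! l)" if "l < length gs" for l using gs(1) that by (simp add: iso_reps_def)
  have gs_inj: "l = m" if "l < length gs" "m < length gs" "isomorphic C (gs ! l) (gs ! m)" for l m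
    using gs(1) that by (simp add: iso_reps_def)
  have gs_find: "\<exists>l. l < length gs \<and> isomorphic C g (gs ! l)" if g: "invertible_object C g" for g
  proof -
    have "g \<in> Obj C" using g by simp
    then obtain k where "k \<in> set gs" "isomorphic C g k" using gs(1) g unfolding iso_reps_def by blast
    then show ?thesis by (auto simp: in_set_conv_nth)
  qed
  let ?K = "{..<?n} - {t}"
  have "\<forall>i \<in> ?K. \<exists>l. l < length gs \<and> isomorphic C (?s ! i) (gs ! l)" using gs_find inv by auto
  then obtain p where p: "\<And>i. i \<in> ?K \<Longrightarrow> p i < length gs \<and> isomorphic C (?s ! i) (gs ! p i)"
    using bchoice by metis
  have "\<exists>i. i \<in> ?K \<and> isomorphic C (gs ! l) (?s ! i)" if l: "l < length gs" for l
  proof -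
    obtain i where i: "i < ?n" "isomorphic C (gs ! l) (?s ! i)"
      using simple_reps_find[OF invertible_simple[OF gsD[OF l]]] by blast
    then have "i \<noteq> t" using st gsD[OF l] invertible_iso_invariant by blast
    then show ?thesis using i by auto
  qed
  then obtain q where q: "\<And>l. l < length gs \<Longrightarrow> q l \<in> ?K \<and> isomorphic C (gs ! l) (?s ! q l)" by metis
  have "card ?K = card {..<length gs}"
  proof (rule card_bij_eq[of p _ _ q])
    show "inj_on p ?K"
    proof (rule inj_onI)
      fix i j assume ij: "i \<in> ?K" "j \<in> ?K" "p i = p j"
      then have "isomorphic C (?s ! i) (?s ! j)" using p isomorphic_trans isomorphic_sym by metis
      then show "i = j" using simple_reps_inj ij by auto
    qed
    show "inj_on q {..<length gs}"
    proof (rule inj_onI)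
      fix l m assume lm: "l \<in> {..<length gs}" "m \<in> {..<length gs}" "q l = q m"
      then have "isomorphic C (gs ! l) (gs ! m)" using q isomorphic_trans isomorphic_sym by (metis lessThan_iff)
      then show "l = m" using gs_inj lm by auto
    qed
  qed (use p q in auto)
  then have n: "?n - 1 = length gs" using t(1) by simp
  obtain u where "u < length gs" using gs_find[OF invertible_unit] by blast
  then have n1: "?n > 1" using n by simp
  have st_x: "isomorphic C (X \<boxtimes> X) (x \<boxtimes> ?s ! t)"
    using isomorphic_tensor X(2)[OF x] X(2)[OF simple_reps_nth[OF t(1)] st] isomorphic_sym by blast
  obtain \<iota> \<pi> where b0: "biproduct C {..<length gs} ((!) gs) (X \<boxtimes> X) \<iota> \<pi>"
    using gs(2) unfolding direct_sum_iff_biproduct by blast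
  obtain v where v: "v \<in> Hom C (X \<boxtimes> X) (x \<boxtimes> ?s ! t)" "is_iso C v" using st_x by (auto simp: isomorphic_def)
  have b: "biproduct C {..<length gs} ((!) gs) (x \<boxtimes> ?s ! t) (\<lambda>i. v \<cdot> \<iota> i) (\<lambda>i. \<pi> i \<cdot> inv_arr C v)"
    by (rule biproduct_iso_target[OF b0 v])
  have "fusion_matrix C x = mat ?n ?n (\<lambda>(i, j). if (i = t) \<noteq> (j = t) then 1 else 0)"
  proof (rule eq_matI)
    let ?M = "mat ?n ?n (\<lambda>(i, j). if (i = t) \<noteq> (j = t) then 1 else 0 :: real)"
    fix i j assume "i < dim_row ?M" "j < dim_col ?M"
    then have ij: "i < ?n" "j < ?n" by auto
    have "hom_dim C (?s ! i) (x \<boxtimes> ?s ! j) = (if (i = t) \<noteq> (j = t) then 1 else 0)"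
    proof (cases "j = t")
      case True
      have "hom_dim C (?s ! i) (x \<boxtimes> ?s ! t) = card {l \<in> {..<length gs}. isomorphic C (?s ! i) (gs ! l)}"
        using gsD invertible_simple by (intro hom_dim_biproduct[OF b _ simple_reps_nth[OF ij(1)]]) auto
      also have "\<dots> = (if i = t then 0 else 1)"
      proof (cases "i = t")
        case True
        have "{l \<in> {..<length gs}. isomorphic C (?s ! i) (gs ! l)} = {}"
          using st gsD invertible_iso_invariant isomorphic_sym unfolding True by blast
        then show ?thesis using True by simp
      next
        case False
        then have i: "i \<in> ?K" using ij by simp
        have "{l \<in> {..<length gs}. isomorphic C (?s ! i) (gs ! l)} = {p i}"
        proof (intro equalityI subsetI)
          fix l assume "l \<in> {l \<in> {..<length gs}. isomorphic C (?s ! i) (gs ! l)}"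
          then have l: "l < length gs" "isomorphic C (?s ! i) (gs ! l)" by auto
          then have "isomorphic C (gs ! l) (gs ! p i)" using p[OF i] isomorphic_trans isomorphic_sym by blast
          then show "l \<in> {p i}" using gs_inj l(1) p[OF i] by auto
        qed (use p[OF i] in auto)
        then show ?thesis using False by simp
      qed
      finally show ?thesis using True by simp
    next
      case False
      have j: "invertible_object C (?s ! j)" "?s ! j \<in> Obj C" using inv[OF ij(2) False] by auto
      have xs: "simple_object C (x \<boxtimes> ?s ! j)"
        using simple_iso_invariant[OF isomorphic_braid[OF j(2) xo] invertible_tensor_simple[OF j(1) x(1)]] .
      have xn: "\<not> invertible_object C (x \<boxtimes> ?s ! j)" using x(2) invertible_factor(1) xo j(2) by blast
      have "isomorphic C (?s ! i) (x \<boxtimes> ?s ! j) \<longleftrightarrow> i = t"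
      proof
        assume "isomorphic C (?s ! i) (x \<boxtimes> ?s ! j)"
        then have "\<not> invertible_object C (?s ! i)" using xn invertible_iso_invariant by blast
        then show "i = t" using inv ij(1) by blast
      next
        assume "i = t"
        then show "isomorphic C (?s ! i) (x \<boxtimes> ?s ! j)"
          using X(2)[OF simple_reps_nth[OF t(1)] st] X(2)[OF xs xn] isomorphic_trans isomorphic_sym by blast
      qed
      then show ?thesis using hom_dim_simple[OF simple_reps_nth[OF ij(1)] xs] False by simp
    qed
    then show "fusion_matrix C x $$ (i, j) = ?M $$ (i, j)" using ij by (simp add: fusion_matrix_def Let_def)
  qed (auto simp: fusion_matrix_def Let_def)
  then show ?thesis unfolding FPdim_def using Max_eigenvalue_star[OF t(1) n1] n by (simp add: of_nat_diff)
qed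

lemma integral_iff_sqrt:
  assumes X: "simple_object C X" "\<not> invertible_object C X"
      "\<And>y. \<lbrakk>simple_object C y; \<not> invertible_object C y\<rbrakk> \<Longrightarrow> isomorphic C y X"
    and gs: "iso_reps C (invertible_object C) gs" "direct_sum C gs (X \<boxtimes> X)"
  shows "integral_category C \<longleftrightarrow> sqrt (length gs) \<in> \<int>"
proof
  show "integral_category C \<Longrightarrow> sqrt (length gs) \<in> \<int>"
    using FPdim_noninvertible[OF X(1,3) gs X(1,2)] X(1) unfolding integral_category_def by metis
  assume i: "sqrt (length gs) \<in> \<int>"
  show "integral_category C"
    unfolding integral_category_def
  proof (intro allI impI)
    fix x assume x: "simple_object C x"
    show "FPdim C x \<in> \<int>"
      using FPdim_invertible[of x] FPdim_noninvertible[OF X(1,3) gs x] i by (cases "invertible_object C x") auto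
  qed
qed

end

section \<open>Forgetting the twist\<close>

text \<open>The twist has no counterpart in a braided category, so the Ising category equivalent to the
  modularization is its underlying braided category.\<close>

definition forget_twist :: "('o, 'm, 'k, 'x) ribbon_cat_scheme \<Rightarrow> ('o, 'm, 'k) braided_cat" where
  "forget_twist C = \<lparr>Obj = Obj C, Arr = Arr C, Dom = Dom C, Cod = Cod C, Ident = Ident C, Comp = Comp C,
     Zero = Zero C, Add = Add C, Scale = Scale C, TensO = TensO C, TensA = TensA C, TUnit = TUnit C,
     Assoc = Assoc C, LUnit = LUnit C, RUnit = RUnit C, Braid = Braid C\<rparr>"

lemma forget_twist_fields [simp]:
  "Obj (forget_twist C) = Obj C" "Arr (forget_twist C) = Arr C" "Dom (forget_twist C) = Dom C"
  "Cod (forget_twist C) = Cod C" "Ident (forget_twist C) = Ident C" "Comp (forget_twist C) = Comp C"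
  "Zero (forget_twist C) = Zero C" "Add (forget_twist C) = Add C" "Scale (forget_twist C) = Scale C"
  "TensO (forget_twist C) = TensO C" "TensA (forget_twist C) = TensA C" "TUnit (forget_twist C) = TUnit C"
  "Assoc (forget_twist C) = Assoc C" "LUnit (forget_twist C) = LUnit C" "RUnit (forget_twist C) = RUnit C"
  "Braid (forget_twist C) = Braid C"
  by (simp_all add: forget_twist_def)

lemma forget_twist_hom [simp]: "Hom (forget_twist C) = Hom C" "hom_space (forget_twist C) = hom_space C"
  by (intro ext; simp add: Hom_def hom_space_def)+

lemma forget_twist_arrows [simp]:
  "inverse_arrows (forget_twist C) = inverse_arrows C" "is_mono (forget_twist C) = is_mono C"
  "is_epi (forget_twist C) = is_epi C" "zero_object (forget_twist C) = zero_object C"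
  "direct_sum (forget_twist C) = direct_sum C" "is_kernel (forget_twist C) = is_kernel C"
  "is_cokernel (forget_twist C) = is_cokernel C"
  by (intro ext; simp add: inverse_arrows_def is_mono_def is_epi_def zero_object_def direct_sum_def
      is_kernel_def is_cokernel_def)+

lemma forget_twist_iso [simp]:
  "is_iso (forget_twist C) = is_iso C" "inv_arr (forget_twist C) = inv_arr C"
  by (intro ext; simp add: is_iso_def inv_arr_def)+

lemma forget_twist_isomorphic [simp]: "isomorphic (forget_twist C) = isomorphic C"
  by (intro ext; simp add: isomorphic_def)

lemma forget_twist_objects [simp]:
  "iso_reps (forget_twist C) = iso_reps C" "simple_object (forget_twist C) = simple_object C"
  "is_dual (forget_twist C) = is_dual C" "invertible_object (forget_twist C) = invertible_object C"
  by (intro ext; simp add: iso_reps_def simple_object_def is_dual_def invertible_object_def)+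

lemma fusion_forget_twist [simp]: "fusion_category (forget_twist C) = fusion_category C"
  unfolding fusion_category_def fusion_category_axioms_def monoidal_category_def monoidal_category_axioms_def
    semisimple_category_def semisimple_category_axioms_def abelian_category_def abelian_category_axioms_def
    linear_category_def linear_category_axioms_def category_def
  by simp

lemma braided_forget_twist [simp]: "braided_fusion_category (forget_twist C) = braided_fusion_category C"
  unfolding braided_fusion_category_def braided_fusion_category_axioms_def by simp

lemma (in braided_fusion_category) braided_equivalent_copy:
  assumes [simp]: "Obj D = Obj C" "Hom D = Hom C" "Ident D = Ident C" "Comp D = Comp C" "Add D = Add C"
    "Scale D = Scale C" "TensO D = TensO C" "TensA D = TensA C" "TUnit D = TUnit C" "Assoc D = Assoc C"
    "LUnit D = LUnit C" "RUnit D = RUnit C" "Braid D = Braid C" "is_iso D = is_iso C"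
  shows "braided_equivalent C D"
proof -
  let ?F = "\<lparr>FObj = id, FArr = id, FTens = \<lambda>x y. Ident C (x \<boxtimes> y), FUnit = Ident C (TUnit C)\<rparr> :: ('o, 'm, 'o, 'm) tensor_functor"
  have "is_braided_functor C D ?F"
    by unfold_locales (auto simp: in_Hom)
  moreover have "is_equivalence C D ?F"
  proof
    have n: "nat_isomorphic C C (comp_functor id_functor ?F) id_functor" "nat_isomorphic D D (comp_functor ?F id_functor) id_functor"
      unfolding nat_isomorphic_def by (auto simp: comp_functor_def id_functor_def in_Hom intro!: exI[of _ "Ident C"])
    moreover have "is_functor D C (id_functor :: ('o, 'm, 'o, 'm) cat_functor)"
      by unfold_locales (auto simp: id_functor_def)
    ultimately show "\<exists>G :: ('o, 'm, 'o, 'm) cat_functor. is_functor D C G \<and>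
        nat_isomorphic C C (comp_functor G ?F) id_functor \<and> nat_isomorphic D D (comp_functor ?F G) id_functor"
      by blast
  qed (auto simp: in_Hom)
  ultimately show ?thesis unfolding braided_equivalent_def by blast
qed

section \<open>The modularization of a braided Tambara-Yamagami category\<close>

lemma square_ne_twice_square:
  fixes k m :: nat
  assumes "k * k = 2 * (m * m)"
  shows "m = 0"
  using assms
proof (induction m arbitrary: k rule: less_induct)
  case (less m)
  show ?case
  proof (rule ccontr)
    assume m: "m \<noteq> 0"
    have "even (k * k)" using less.prems by simp
    then obtain k' where k: "k = 2 * k'" by auto
    then have e: "m * m = 2 * (k' * k')" using less.prems by simp
    have "k' < m"
    proof (rule ccontr)
      assume "\<not> k' < m"
      then have "m * m \<le> k' * k'" by (simp add: mult_le_mono)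
      then show False using e m by simp
    qed
    then have "k' = 0" using less.IH e by blast
    then show False using e m by simp
  qed
qed

lemma sqrt_int_iff_square:
  fixes n :: nat
  shows "sqrt (real n) \<in> \<int> \<longleftrightarrow> (\<exists>k. n = k * k)"
proof
  assume "sqrt (real n) \<in> \<int>"
  then obtain z :: int where z: "sqrt (real n) = of_int z" by (auto elim: Ints_cases)
  then have "z \<ge> 0" by (metis of_int_0_le_iff of_nat_0_le_iff real_sqrt_ge_zero)
  then obtain k where "z = int k" by (metis nonneg_int_cases)
  then have "sqrt (real n) = real k" using z by simp
  then have "real n = real (k * k)" by (metis of_nat_0_le_iff of_nat_mult real_sqrt_mult_self abs_of_nonneg)
  then show "\<exists>k. n = k * k" by (metis of_nat_eq_iff)
next
  assume "\<exists>k. n = k * k"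
  then show "sqrt (real n) \<in> \<int>" by auto
qed

theorem theorem6p5:
  fixes C :: "('o, 'm, 'k::{alg_closed_field, field_char_0}) ribbon_cat"
    and C' :: "('p, 'n, 'k) ribbon_cat"
    and F :: "('o, 'm, 'p, 'n) tensor_functor"
  assumes "premodular_category C"
    and "tambara_yamagami_category C"
    and "modularization C C' F"
  shows "(integral_category C \<longleftrightarrow> pointed_category C') \<and>
    (\<not> integral_category C \<longrightarrow>
      (\<exists>I :: ('p, 'n, 'k) braided_cat.
        braided_fusion_category I \<and> ising_category I \<and> braided_equivalent C' I))"
proof -
  interpret TY: tambara_yamagami_category C by fact
  interpret F: modularization C C' F by fact
  obtain X gs where X: "simple_object C X" "\<not> invertible_object C X"
      "\<And>y. \<lbrakk>simple_object C y; \<not> invertible_object C y\<rbrakk> \<Longrightarrow> isomorphic C y X"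
    and gs: "iso_reps C (invertible_object C) gs" "direct_sum C gs (X \<boxtimes>\<^bsub>C\<^esub> X)"
    using TY.tambara_yamagami by blast
  interpret M: modular_square C' "FObj F X" "map (FObj F) gs"
    by (rule F.modular_square_image[OF X(1,3) gs])
  have int: "integral_category C \<longleftrightarrow> (\<exists>k. length gs = k * k)"
    using F.source.integral_iff_sqrt[OF X gs] sqrt_int_iff_square by simp
  have "gs \<noteq> []" using M.unit_in_ks by auto
  have not_int: "\<not> integral_category C" if "\<not> pointed_category C'"
    using M.not_pointed_ising(2)[OF that] \<open>gs \<noteq> []\<close> square_ne_twice_square unfolding int by fastforce
  have iff: "integral_category C \<longleftrightarrow> pointed_category C'"
    using M.pointed_square not_int int by auto
  moreover have "\<exists>I :: ('p, 'n, 'k) braided_cat. braided_fusion_category I \<and> ising_category I \<and> braided_equivalent C' I"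
    if "\<not> integral_category C"
  proof (intro exI conjI)
    let ?I = "forget_twist C'"
    have np: "\<not> pointed_category C'" using iff that by simp
    show "braided_fusion_category ?I" using F.target.braided_fusion_category_axioms by simp
    show "ising_category ?I"
      unfolding ising_category_def ising_category_axioms_def
      using M.not_pointed_ising(1)[OF np] F.target.fusion_category_axioms by simp
    show "braided_equivalent C' ?I" by (rule F.target.braided_equivalent_copy) simp_all
  qed
  ultimately show ?thesis by blast
qed

end
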